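(* Let $H$ be a complex separable infinite-dimensional Hilbert space. If $A,B$ are self-adjoint bounded operators on $H$ and if $A-B\in\mathcal{L}_1$, then $|A|-|B|\in\mathcal{L}_{1,\infty}$ and $$\||A|-|B|\|_{1,\infty}\leq \Big(34+\frac{2560e}{\pi}\Big)\|A-B\|_1.$$
   Context: For a compact operator $A$ on $H$, $\{\mu(k;A)\}_{k\ge 0}$ denotes the sequence of singular numbers of $A$ (in decreasing order, with multiplicity). $\mathcal{L}_1$ is the trace class, i.e. the compact operators $A$ with $\|A\|_1:=\sum_{k\ge 0}\mu(k;A)<\infty$. $\mathcal{L}_{1,\infty}$ is the set of compact operators $A$ with $\|A\|_{1,\infty}:=\sup_{k\ge 0}(k+1)\mu(k;A)<\infty$. $|A|=(A^*A)^{1/2}$. *)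

theory Defs
  imports "HOL-Analysis.Analysis"
begin

text \<open>
  Complex inner product spaces, built on top of the library's real ones: the real inner product is
  the real part of the complex one, so the inherited norm is \<open>norm x = sqrt (Re (cinner x x))\<close>.
  Positive definiteness of \<open>cinner\<close> then comes from \<^class>\<open>real_inner\<close>.  The form is linear in its
  second argument and conjugate-linear in the first.
\<close>

class complex_inner = real_inner +
  fixes scaleC :: "complex \<Rightarrow> 'a \<Rightarrow> 'a" (infixr "*\<^sub>C" 75)
    and cinner :: "'a \<Rightarrow> 'a \<Rightarrow> complex"
  assumes scaleC_add_right: "a *\<^sub>C (x + y) = a *\<^sub>C x + a *\<^sub>C y"
    and scaleC_add_left: "(a + b) *\<^sub>C x = a *\<^sub>C x + b *\<^sub>C x"
    and scaleC_scaleC: "a *\<^sub>C (b *\<^sub>C x) = (a * b) *\<^sub>C x"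
    and scaleR_scaleC: "r *\<^sub>R x = complex_of_real r *\<^sub>C x"
    and cinner_commute: "cinner x y = cnj (cinner y x)"
    and cinner_add_right: "cinner x (y + z) = cinner x y + cinner x z"
    and cinner_scaleC_right: "cinner x (a *\<^sub>C y) = a * cinner x y"
    and inner_cinner: "inner x y = Re (cinner x y)"

class complex_hilbert = complex_inner + complete_space

global_interpretation complex_vector: vector_space "scaleC :: complex \<Rightarrow> 'a \<Rightarrow> 'a::complex_inner"
  defines cspan = complex_vector.span
    and cdependent = complex_vector.dependent
    and cdim = complex_vector.dim
proof unfold_locales
  show "1 *\<^sub>C x = x" for x :: 'a
    using scaleR_scaleC[of 1 x] by simp
qed (simp_all add: scaleC_add_right scaleC_add_left scaleC_scaleC)

definition separable :: "'a::topological_space set \<Rightarrow> bool" where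
  "separable S \<longleftrightarrow> (\<exists>D. countable D \<and> D \<subseteq> S \<and> S \<subseteq> closure D)"

definition bounded_clinear :: "('a::complex_inner \<Rightarrow> 'a) \<Rightarrow> bool" where
  "bounded_clinear A \<longleftrightarrow> bounded_linear A \<and> (\<forall>c x. A (c *\<^sub>C x) = c *\<^sub>C A x)"

definition cadjoint :: "('a::complex_inner \<Rightarrow> 'a) \<Rightarrow> 'a \<Rightarrow> 'a" where
  "cadjoint A = (THE S. \<forall>x y. cinner (A x) y = cinner x (S y))"

definition selfadjoint :: "('a::complex_inner \<Rightarrow> 'a) \<Rightarrow> bool" where
  "selfadjoint A \<longleftrightarrow> bounded_clinear A \<and> cadjoint A = A"

definition positive_op :: "('a::complex_inner \<Rightarrow> 'a) \<Rightarrow> bool" where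
  "positive_op A \<longleftrightarrow> bounded_clinear A \<and> (\<forall>x. cinner x (A x) \<in> \<real>\<^sub>\<ge>\<^sub>0)"

definition op_sqrt :: "('a::complex_inner \<Rightarrow> 'a) \<Rightarrow> 'a \<Rightarrow> 'a" where
  "op_sqrt A = (THE R. positive_op R \<and> R \<circ> R = A)"

definition op_abs :: "('a::complex_inner \<Rightarrow> 'a) \<Rightarrow> 'a \<Rightarrow> 'a" where
  "op_abs A = op_sqrt (cadjoint A \<circ> A)"

definition compact_op :: "('a::complex_inner \<Rightarrow> 'a) \<Rightarrow> bool" where
  "compact_op A \<longleftrightarrow> bounded_clinear A \<and> compact (closure (A ` cball 0 1))"

text \<open>
  \<open>singular_number A k\<close> is the \<open>k\<close>-th eigenvalue of \<open>op_abs A\<close> (counted from \<open>k = 0\<close>, decreasing,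
  with multiplicity), for compact \<open>A\<close>.  Only the positive eigenvalues are listed; if there are
  finitely many of them, convergence to \<open>0\<close> forces the remaining terms of the sequence to be \<open>0\<close>.
  For non-compact \<open>A\<close> the value is not meaningful.
\<close>

definition singular_number :: "('a::complex_inner \<Rightarrow> 'a) \<Rightarrow> nat \<Rightarrow> real" where
  "singular_number A = (THE s. decseq s \<and> s \<longlonglongrightarrow> 0 \<and>
     (\<forall>t>0. card {k. s k = t} = cdim {x. op_abs A x = complex_of_real t *\<^sub>C x}))"

definition trace_class :: "('a::complex_inner \<Rightarrow> 'a) \<Rightarrow> bool" where
  "trace_class A \<longleftrightarrow> compact_op A \<and> summable (singular_number A)"

definition trace_norm :: "('a::complex_inner \<Rightarrow> 'a) \<Rightarrow> real" where
  "trace_norm A = (\<Sum>k. singular_number A k)"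

definition weak_trace_class :: "('a::complex_inner \<Rightarrow> 'a) \<Rightarrow> bool" where
  "weak_trace_class A \<longleftrightarrow>
     compact_op A \<and> bdd_above (range (\<lambda>k. real (k + 1) * singular_number A k))"

definition weak_trace_norm :: "('a::complex_inner \<Rightarrow> 'a) \<Rightarrow> real" where
  "weak_trace_norm A = (SUP k. real (k + 1) * singular_number A k)"

end

theory Submission
  imports Defs
begin

text \<open>
  The estimate is an operator version of Kolmogorov's argument for the weak type inequality of
  harmonic conjugation.  Let \<open>T\<close> and \<open>Y\<close> be nonnegative operators for which \<open>X = T Y + Y T\<close> is
  nonnegative and of finite trace.  Then \<open>V = T Y\<close> is accretive and, for invertible \<open>T\<close>,
  similar to the nonnegative operator \<open>sqrt T Y sqrt T\<close>.  For \<open>t > 0\<close>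
  put \<open>Z = V (V + t)\<inverse>\<close>.  Accretivity gives \<open>Z\<^sup>* Z \<le> Re Z\<close>, and similarity gives
  \<open>tr Z \<le> tr V / t = tr X / (2 t)\<close>.  Hence the Hilbert-Schmidt norm of \<open>Z\<close> is controlled and
  \<open>|Z f| \<le> |f| / 2\<close> off at most \<open>2 tr X / t\<close> directions.  With \<open>f = (V + t) y\<close> this reads
  \<open>|V y| \<le> |V y + t y| / 2\<close>, so \<open>|V y| \<le> t |y|\<close> off equally many directions.  This is
  \<open>accretive_product_weak_bound\<close>: the map from \<open>X\<close> to \<open>T Y\<close> is of weak type.

  To apply it, let \<open>C = A - B\<close>, \<open>P = sqrt (A\<^sup>2 + \<delta>)\<close> and \<open>Q = sqrt (B\<^sup>2 + \<delta>)\<close>.  Then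
  \<open>P (P - Q) + (P - Q) Q = A\<^sup>2 - B\<^sup>2 = A C + C B\<close>.  The operators \<open>P\<inverse> A\<close> and \<open>B Q\<inverse>\<close> are
  contractions, so \<open>A C = P X\<^sub>1\<close> and \<open>C B = X\<^sub>2 Q\<close>, where \<open>X\<^sub>1\<close> and \<open>X\<^sub>2\<close> have trace norm at
  most that of \<open>C\<close>.  By uniqueness for the Sylvester equation, \<open>P - Q = P Y\<^sub>1 + Y\<^sub>2 Q\<close>, where
  \<open>P Y\<^sub>i + Y\<^sub>i Q = X\<^sub>i\<close>.  An operator \<open>\<Sum> a\<^sub>n b\<^sub>n\<^sup>*\<close> is a corner of the nonnegative operator
  \<open>\<Sum> (a\<^sub>n, b\<^sub>n) (a\<^sub>n, b\<^sub>n)\<^sup>*\<close> on the sum of two copies of the space, and there the Sylvester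
  equation has coefficient \<open>T = P \<oplus> Q\<close>.  So both summands are of weak type.  Finally
  \<open>\<delta> \<rightarrow> 0\<close>, because taking square roots is continuous in norm
  (\<open>norm_diff_le_sqrt_square_diff\<close>).

  All of this happens in a real Hilbert space, with the real part of the complex inner product.
  The complex structure enters when the conclusion is expressed through singular numbers.  A
  compact self-adjoint operator is diagonalized by maximizing \<open>|T y|\<close> repeatedly; this identifies
  \<open>singular_number\<close>, writes \<open>C\<close> as a sum of rank-one operators, and bounds the \<open>k\<close>-th singular
  number of the difference by its norm off any \<open>k\<close> directions.  The constant obtained is 32.
\<close>

section \<open>Coercive and symmetric operators on a real Hilbert space\<close>

class real_hilbert = real_inner + complete_space

instance real_hilbert \<subseteq> banach ..

instance prod :: (real_hilbert, real_hilbert) real_hilbert ..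

instance complex_hilbert \<subseteq> real_hilbert ..

definition symmetric_op :: "('a::real_inner \<Rightarrow> 'a) \<Rightarrow> bool" where
  "symmetric_op T \<longleftrightarrow> bounded_linear T \<and> (\<forall>x y. inner (T x) y = inner x (T y))"

definition nonneg_op :: "('a::real_inner \<Rightarrow> 'a) \<Rightarrow> bool" where
  "nonneg_op T \<longleftrightarrow> symmetric_op T \<and> (\<forall>x. 0 \<le> inner x (T x))"

definition coercive :: "real \<Rightarrow> ('a::real_inner \<Rightarrow> 'a) \<Rightarrow> bool" where
  "coercive \<epsilon> T \<longleftrightarrow> bounded_linear T \<and> 0 < \<epsilon> \<and> (\<forall>x. \<epsilon> * (norm x)\<^sup>2 \<le> inner x (T x))"

lemma symmetric_opD:
  assumes "symmetric_op T"
  shows "bounded_linear T" "inner (T x) y = inner x (T y)"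
  using assms by (auto simp: symmetric_op_def)

lemma nonneg_opD:
  assumes "nonneg_op T"
  shows "symmetric_op T" "bounded_linear T" "inner (T x) y = inner x (T y)" "0 \<le> inner x (T x)"
  using assms by (auto simp: nonneg_op_def symmetric_op_def)

lemma coerciveD:
  assumes "coercive \<epsilon> T"
  shows "bounded_linear T" "0 < \<epsilon>" "\<epsilon> * (norm x)\<^sup>2 \<le> inner x (T x)"
  using assms by (auto simp: coercive_def)

lemma coercive_norm_le:
  assumes "coercive \<epsilon> T"
  shows "\<epsilon> * norm x \<le> norm (T x)"
proof (cases "x = 0")
  case False
  have "\<epsilon> * norm x * norm x \<le> norm (T x) * norm x"
    using coerciveD(3)[OF assms, of x] norm_cauchy_schwarz[of x "T x"]
    by (simp add: power2_eq_square mult.commute mult.left_commute)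
  with False show ?thesis by simp
qed simp

lemma coercive_imp_nonneg:
  assumes "symmetric_op T" "coercive \<epsilon> T"
  shows "nonneg_op T"
  unfolding nonneg_op_def
proof (intro conjI assms(1) allI)
  show "0 \<le> inner x (T x)" for x
    by (rule order_trans[OF _ coerciveD(3)[OF assms(2)]]) (use coerciveD(2)[OF assms(2)] in simp)
qed

text \<open>
  The choice \<open>c = \<epsilon> / K\<^sup>2\<close>, with \<open>K \<ge> \<epsilon>\<close> a norm bound for \<open>T\<close>, minimizes the bound
  \<open>1 - 2 c \<epsilon> + c\<^sup>2 K\<^sup>2\<close> for the squared norm of \<open>1 - c T\<close>.  The contraction serves both to invert
  \<open>T\<close> and to extract its square root.
\<close>

lemma coercive_contraction:
  assumes "coercive \<epsilon> T"
  obtains c q where "0 < c" "0 \<le> q" "q < 1" "\<And>x. norm (x - c *\<^sub>R T x) \<le> q * norm x"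
proof -
  note e = coerciveD[OF assms]
  obtain K0 where K0: "\<And>x. norm (T x) \<le> norm x * K0"
    using bounded_linear.bounded[OF e(1)] by blast
  define K where "K = max K0 \<epsilon>"
  have K: "norm (T x) \<le> K * norm x" for x
    using K0[of x] mult_left_mono[of K0 K "norm x"] by (simp add: K_def mult.commute)
  have Kpos: "0 < K" "\<epsilon> \<le> K" using e(2) by (auto simp: K_def)
  define c where "c = \<epsilon> / K\<^sup>2"
  define q where "q = sqrt (1 - \<epsilon>\<^sup>2 / K\<^sup>2)"
  have le1: "\<epsilon>\<^sup>2 / K\<^sup>2 \<le> 1" using Kpos e(2) by (simp add: power_mono)
  show thesis
  proof (rule that)
    show "0 < c" using e(2) Kpos by (simp add: c_def)
    show "0 \<le> q" using le1 by (simp add: q_def)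
    show "q < 1" using e(2) Kpos by (simp add: q_def)
    fix x
    have "(norm (x - c *\<^sub>R T x))\<^sup>2 = (norm x)\<^sup>2 - 2 * c * inner x (T x) + c\<^sup>2 * (norm (T x))\<^sup>2"
      unfolding power2_norm_eq_inner
      by (simp add: inner_diff_left inner_diff_right inner_commute power2_eq_square algebra_simps)
    also have "\<dots> \<le> (norm x)\<^sup>2 - 2 * c * (\<epsilon> * (norm x)\<^sup>2) + c\<^sup>2 * (K * norm x)\<^sup>2"
    proof -
      have "2 * c * (\<epsilon> * (norm x)\<^sup>2) \<le> 2 * c * inner x (T x)"
        using e(3)[of x] \<open>0 < c\<close> by (intro mult_left_mono) auto
      moreover have "c\<^sup>2 * (norm (T x))\<^sup>2 \<le> c\<^sup>2 * (K * norm x)\<^sup>2"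
        using K[of x] by (intro mult_left_mono power_mono) auto
      ultimately show ?thesis by linarith
    qed
    also have "\<dots> = (1 - \<epsilon>\<^sup>2 / K\<^sup>2) * (norm x)\<^sup>2"
      using Kpos unfolding c_def by (simp add: field_simps power2_eq_square)
    also have "\<dots> = (q * norm x)\<^sup>2" using le1 by (simp add: q_def power_mult_distrib)
    finally show "norm (x - c *\<^sub>R T x) \<le> q * norm x"
      by (rule power2_le_imp_le) (use \<open>0 \<le> q\<close> in simp)
  qed
qed

text \<open>
  Solving \<open>T x = y\<close> means finding a fixed point of \<open>x \<mapsto> x - c (T x - y)\<close>.  The
  accretive operators \<open>V + t\<close> below, which are not symmetric, are inverted in the same way.
\<close>

lemma coercive_bij:
  fixes T :: "'a::real_hilbert \<Rightarrow> 'a"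
  assumes "coercive \<epsilon> T"
  shows "bij T"
proof -
  obtain c q where c: "0 < c" "0 \<le> q" "q < 1" "\<And>x. norm (x - c *\<^sub>R T x) \<le> q * norm x"
    using coercive_contraction[OF assms] by blast
  interpret T: bounded_linear T using coerciveD[OF assms] by simp
  have "\<exists>!x. T x = y" for y
  proof -
    have "\<exists>!x. x - c *\<^sub>R (T x - y) = x"
    proof (rule banach_fix_type[OF c(2,3)], intro allI)
      fix u v
      have "u - c *\<^sub>R (T u - y) - (v - c *\<^sub>R (T v - y)) = (u - v) - c *\<^sub>R T (u - v)"
        by (simp add: T.diff algebra_simps)
      then show "dist (u - c *\<^sub>R (T u - y)) (v - c *\<^sub>R (T v - y)) \<le> q * dist u v"
        using c(4)[of "u - v"] by (simp only: dist_norm)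
    qed
    then show ?thesis using c(1) by simp
  qed
  then show ?thesis unfolding bij_iff by blast
qed

text \<open>
  Vectors that almost attain the norm replace eigenvectors, which need not exist without compactness.
\<close>

lemma near_norm_vector:
  fixes E :: "'a::real_inner \<Rightarrow> 'b::real_normed_vector"
  assumes "bounded_linear E" "0 < onorm E" "0 < \<delta>"
  obtains x where "norm x = 1" "(onorm E)\<^sup>2 - \<delta> \<le> (norm (E x))\<^sup>2"
proof -
  interpret E: bounded_linear E by fact
  define s where "s = onorm E"
  define r where "r = sqrt (max 0 (s\<^sup>2 - \<delta>))"
  have r: "0 \<le> r" by (simp add: r_def)
  have "r < s"
    using assms by (auto simp: r_def s_def max_def intro!: real_less_lsqrt)
  have "\<exists>x. \<not> norm (E x) \<le> r * norm x"
    using onorm_bound[OF r, of E] \<open>r < s\<close> unfolding s_def by (meson not_less)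
  then obtain x where x: "r * norm x < norm (E x)" by (auto simp: not_le)
  then have x0: "x \<noteq> 0" using r E.zero by fastforce
  define y where "y = x /\<^sub>R norm x"
  have "norm y = 1" using x0 by (simp add: y_def)
  moreover have "r \<le> norm (E y)" using x x0
    by (simp add: y_def E.scaleR field_simps)
  then have "r\<^sup>2 \<le> (norm (E y))\<^sup>2" using r by (simp add: power_mono)
  then have "s\<^sup>2 - \<delta> \<le> (norm (E y))\<^sup>2" by (simp add: r_def)
  ultimately show thesis using that s_def by blast
qed

lemma le_of_square_perturbation:
  fixes a b K :: real
  assumes "0 \<le> K" "\<And>\<eta>. 0 < \<eta> \<Longrightarrow> a \<le> b + \<eta>\<^sup>2 + \<eta> * K"
  shows "a \<le> b"
proof (rule field_le_epsilon)
  fix e :: real assume "0 < e"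
  define \<eta> where "\<eta> = min 1 (e / (1 + K))"
  have \<eta>: "0 < \<eta>" "\<eta> \<le> 1" using \<open>0 < e\<close> assms(1) by (auto simp: \<eta>_def)
  have "\<eta> \<le> e / (1 + K)" by (simp add: \<eta>_def)
  then have \<eta>3: "\<eta> * (1 + K) \<le> e" using assms(1) by (subst (asm) pos_le_divide_eq) auto
  have "\<eta>\<^sup>2 \<le> \<eta>" using \<eta> by (simp add: power2_eq_square mult_left_le)
  then show "a \<le> b + e" using assms(2)[OF \<eta>(1)] \<eta>3 by (simp add: algebra_simps)
qed

text \<open>
  The Cauchy-Schwarz inequality for the form of \<open>P\<close>, in the arithmetic-geometric form that comes
  from evaluating the form at \<open>u - s x\<close> and \<open>u + s x\<close>.
\<close>

lemma nonneg_op_weighted_cross_le: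
  assumes "nonneg_op P"
  shows "2 * s * inner u (P x) \<le> inner u (P u) + s\<^sup>2 * inner x (P x)"
    and "- (2 * s * inner u (P x)) \<le> inner u (P u) + s\<^sup>2 * inner x (P x)"
proof -
  note P = nonneg_opD[OF assms]
  interpret P: bounded_linear P using P by simp
  have "inner x (P u) = inner u (P x)" using P(3)[of u x] by (simp add: inner_commute)
  then show "2 * s * inner u (P x) \<le> inner u (P u) + s\<^sup>2 * inner x (P x)"
    and "- (2 * s * inner u (P x)) \<le> inner u (P u) + s\<^sup>2 * inner x (P x)"
    using P(4)[of "u - s *\<^sub>R x"] P(4)[of "u + s *\<^sub>R x"]
    by (simp_all add: P.diff P.add P.scaleR inner_diff_left inner_diff_right inner_add_left
        inner_add_right power2_eq_square algebra_simps)
qed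

text \<open>
  Let \<open>E = P - Q\<close> and \<open>G = P\<^sup>2 - Q\<^sup>2\<close>.  Then \<open>G = P E + E Q = Q E + E P\<close>.  If \<open>E\<^sup>2 x = s\<^sup>2 x\<close> for a
  unit vector \<open>x\<close>, where \<open>s\<close> is the norm of \<open>E\<close>, pair both expressions with \<open>u = E x\<close>: the
  result is \<open>2 \<langle>u, G x\<rangle> = \<langle>u, (P + Q) u\<rangle> + s\<^sup>2 \<langle>x, (P + Q) x\<rangle>\<close>, and the right-hand side is at
  least \<open>2 s \<langle>u, (P - Q) x\<rangle> = 2 s |u|\<^sup>2 = 2 s\<^sup>3\<close>.  So \<open>s\<^sup>2\<close> is at most the norm of \<open>G\<close>.  In
  general \<open>x\<close> is only approximately an eigenvector.  The inequality yields both the uniqueness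
  and the continuity of square roots.
\<close>

lemma norm_diff_le_sqrt_square_diff:
  fixes P Q :: "'a::real_inner \<Rightarrow> 'a"
  assumes P: "nonneg_op P" and Q: "nonneg_op Q" and "0 \<le> d"
    and d: "\<And>x. norm (P (P x) - Q (Q x)) \<le> d * norm x"
  shows "norm (P x - Q x) \<le> sqrt d * norm x"
proof -
  note p = nonneg_opD[OF P] and q = nonneg_opD[OF Q]
  interpret P: bounded_linear P using p by simp
  interpret Q: bounded_linear Q using q by simp
  define E where "E = (\<lambda>x. P x - Q x)"
  have E: "bounded_linear E" unfolding E_def by (intro bounded_linear_sub p q)
  interpret E: bounded_linear E by fact
  have Esym: "inner (E x) y = inner x (E y)" for x y
    by (simp add: E_def inner_diff_left inner_diff_right p(3) q(3))
  define s where "s = onorm E"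
  have s: "norm (E x) \<le> s * norm x" for x using onorm[OF E] by (simp add: s_def)
  have "0 \<le> s" using onorm_pos_le[OF E] by (simp add: s_def)
  obtain K where K: "\<And>x. norm (P x + Q x) \<le> norm x * K" "0 < K"
    using bounded_linear.pos_bounded[OF bounded_linear_add[OF p(2) q(2)]] by blast
  have "s \<le> sqrt d"
  proof (cases "s = 0")
    case False
    then have "0 < s" using \<open>0 \<le> s\<close> by simp
    have "s\<^sup>2 \<le> d + \<eta>\<^sup>2 + \<eta> * (K / 2)" if \<eta>0: "0 < \<eta>" for \<eta>
    proof -
      obtain x where x: "norm x = 1" "s\<^sup>2 - \<eta>\<^sup>2 \<le> (norm (E x))\<^sup>2"
        using near_norm_vector[OF E, of "\<eta>\<^sup>2"] zero_less_power[OF \<eta>0, of 2] \<open>0 < s\<close>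
        unfolding s_def by metis
      define u where "u = E x"
      \<comment> \<open>\<^term>\<open>x\<close> almost attains the norm of \<^term>\<open>E\<close>, hence is almost an eigenvector of
          \<^term>\<open>E \<circ> E\<close>; \<^term>\<open>r\<close> is the defect.\<close>
      define r where "r = E u - s\<^sup>2 *\<^sub>R x"
      have "(norm r)\<^sup>2 = (norm (E u))\<^sup>2 - 2 * s\<^sup>2 * inner (E u) x + (s\<^sup>2)\<^sup>2 * (norm x)\<^sup>2"
        unfolding r_def power2_norm_eq_inner
        by (simp add: inner_diff_left inner_diff_right inner_commute power2_eq_square algebra_simps)
      also have "inner (E u) x = (norm u)\<^sup>2"
        using Esym[of u x] by (simp add: u_def power2_norm_eq_inner)
      also have "(norm (E u))\<^sup>2 \<le> (s * norm u)\<^sup>2" using s[of u] by (simp add: power_mono)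
      finally have "(norm r)\<^sup>2 \<le> s\<^sup>2 * (s\<^sup>2 - (norm u)\<^sup>2)"
        using x(1) by (simp add: power2_eq_square algebra_simps)
      also have "\<dots> \<le> s\<^sup>2 * \<eta>\<^sup>2" using x(2) by (intro mult_left_mono) (auto simp: u_def)
      also have "\<dots> = (s * \<eta>)\<^sup>2" by (simp add: power_mult_distrib)
      finally have r: "norm r \<le> s * \<eta>"
        by (rule power2_le_imp_le) (use \<open>0 < s\<close> \<eta>0 in simp)
      have Eu: "E u = s\<^sup>2 *\<^sub>R x + r" by (simp add: r_def)
      define G where "G = P (P x) - Q (Q x)"
      have 1: "inner u G = inner u (P u) + s\<^sup>2 * inner x (Q x) + inner r (Q x)"
      proof -
        have "G = P u + E (Q x)" by (simp add: G_def u_def E_def P.diff)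
        then show ?thesis using Esym[of u "Q x"] Eu by (simp add: inner_add_right inner_add_left)
      qed
      have 2: "inner u G = inner u (Q u) + s\<^sup>2 * inner x (P x) + inner r (P x)"
      proof -
        have "G = Q u + E (P x)" by (simp add: G_def u_def E_def Q.diff)
        then show ?thesis using Esym[of u "P x"] Eu by (simp add: inner_add_right inner_add_left)
      qed
      have 3: "2 * s * (norm u)\<^sup>2
          \<le> inner u (P u) + s\<^sup>2 * inner x (P x) + (inner u (Q u) + s\<^sup>2 * inner x (Q x))"
      proof -
        have "(norm u)\<^sup>2 = inner u (P x) - inner u (Q x)"
          by (simp add: power2_norm_eq_inner u_def E_def inner_diff_right)
        then have "2 * s * (norm u)\<^sup>2 = 2 * s * inner u (P x) - 2 * s * inner u (Q x)"
          by (simp only: right_diff_distrib)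
        then show ?thesis
          using nonneg_op_weighted_cross_le(1)[OF P, of s u x]
            nonneg_op_weighted_cross_le(2)[OF Q, of s u x] by linarith
      qed
      have 4: "inner u G \<le> s * d"
      proof -
        have "norm u \<le> s" using s[of x] x by (simp add: u_def)
        moreover have "norm G \<le> d" using d[of x] x by (simp add: G_def)
        ultimately show ?thesis
          using norm_cauchy_schwarz[of u G] mult_mono[of "norm u" s "norm G" d] \<open>0 < s\<close>
          by simp
      qed
      have 5: "- inner r (P x + Q x) \<le> s * \<eta> * K"
      proof -
        have "- inner r (P x + Q x) \<le> norm r * norm (P x + Q x)"
          using norm_cauchy_schwarz[of "-r" "P x + Q x"] by simp
        also have "\<dots> \<le> (s * \<eta>) * K"
          using r K(1)[of x] x(1) \<open>0 < s\<close> \<eta>0 by (intro mult_mono) auto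
        finally show ?thesis .
      qed
      have "2 * s * (norm u)\<^sup>2 \<le> 2 * (s * d) + s * \<eta> * K"
        using 1 2 3 4 5 by (simp add: inner_add_right)
      then have "s * (2 * (norm u)\<^sup>2) \<le> s * (2 * d + \<eta> * K)" by (simp add: algebra_simps)
      then have "2 * (norm u)\<^sup>2 \<le> 2 * d + \<eta> * K" using \<open>0 < s\<close> by simp
      then show ?thesis using x(2) by (simp add: u_def)
    qed
    then have "s\<^sup>2 \<le> d" using le_of_square_perturbation[of "K/2" "s\<^sup>2" d] K(2) by simp
    then show ?thesis by (simp add: real_le_rsqrt)
  qed (use assms in simp)
  then have "s * norm x \<le> sqrt d * norm x" by (simp add: mult_right_mono)
  then show ?thesis using s[of x] by (simp add: E_def)
qed

lemma nonneg_op_eq_if_square_eq: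
  fixes P Q :: "'a::real_inner \<Rightarrow> 'a"
  assumes "nonneg_op P" "nonneg_op Q" "\<And>x. P (P x) = Q (Q x)"
  shows "P = Q"
  using norm_diff_le_sqrt_square_diff[OF assms(1,2), of 0] assms(3) by fastforce

section \<open>Square roots of nonnegative operators\<close>

text \<open>
  After scaling, \<open>M = 1 - B\<close> with \<open>|B| \<le> q < 1\<close>.  The operator \<open>1 - y\<close> is a square root of \<open>1 - B\<close>
  exactly if \<open>y = (B + y\<^sup>2) / 2\<close>, and the right-hand side is a contraction of the ball of radius
  \<open>q\<close>.  Running the iteration inside the closed set of symmetric operators that commute with
  everything commuting with \<open>B\<close> gives these two properties of the root for free.  The commutation
  property later yields that \<open>A\<close> commutes with \<open>sqrt (A\<^sup>2 + \<delta>)\<close>, and that roots of complex linear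
  operators are complex linear.
\<close>

lemma coercive_square_root:
  fixes M :: "'a::real_hilbert \<Rightarrow> 'a"
  assumes M: "symmetric_op M" and co: "coercive \<epsilon> M"
  obtains R \<rho> where "symmetric_op R" "coercive \<rho> R" "\<And>x. R (R x) = M x"
    "\<And>J x. bounded_linear J \<Longrightarrow> (\<And>x. J (M x) = M (J x)) \<Longrightarrow> J (R x) = R (J x)"
proof -
  note m = symmetric_opD[OF M]
  obtain c q where c: "0 < c" "0 \<le> q" "q < 1" "\<And>x. norm (x - c *\<^sub>R M x) \<le> q * norm x"
    using coercive_contraction[OF co] by blast
  define B :: "'a \<Rightarrow>\<^sub>L 'a" where "B = Blinfun (\<lambda>x. x - c *\<^sub>R M x)"
  have B: "blinfun_apply B x = x - c *\<^sub>R M x" for x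
    unfolding B_def
    by (subst bounded_linear_Blinfun_apply)
      (auto intro!: bounded_linear_sub bounded_linear_scaleR_right m(1)
        bounded_linear_compose[OF bounded_linear_scaleR_right] bounded_linear_ident)
  have Bq: "norm B \<le> q" by (rule norm_blinfun_bound) (use c B in auto)
  define F where "F y = (1/2) *\<^sub>R (B + (y o\<^sub>L y))" for y
  define S where "S = {y. norm y \<le> q} \<inter> (\<Inter>x z. {y :: 'a \<Rightarrow>\<^sub>L 'a. inner (y x) z = inner x (y z)})
    \<inter> (\<Inter>J\<in>{J. J o\<^sub>L B = B o\<^sub>L J}. {y. J o\<^sub>L y = y o\<^sub>L J})"
  have "closed S" unfolding S_def
    by (intro closed_Int closed_INT ballI closed_Collect_le closed_Collect_eq continuous_intros)
  then have "complete S" by (simp add: complete_eq_closed)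
  moreover have "S \<noteq> {}"
  proof -
    have "0 \<in> S" using c by (simp add: S_def blinfun_eqI)
    then show ?thesis by blast
  qed
  moreover have "F ` S \<subseteq> S"
  proof (rule image_subsetI)
    fix y assume "y \<in> S"
    then have yq: "norm y \<le> q" and ysym: "\<And>x z. inner (y x) z = inner x (y z)"
      and ycomm: "\<And>J. J o\<^sub>L B = B o\<^sub>L J \<Longrightarrow> J o\<^sub>L y = y o\<^sub>L J"
      by (simp_all add: S_def)
    have "norm (F y) \<le> q"
    proof -
      have "norm (y o\<^sub>L y) \<le> norm y * norm y" by (rule norm_blinfun_compose)
      also have "\<dots> \<le> q * q" using yq c by (intro mult_mono) auto
      also have "\<dots> \<le> q" using c by (simp add: mult_left_le)
      finally have "norm (B + (y o\<^sub>L y)) \<le> q + q" using Bq norm_triangle_mono by blast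
      then show ?thesis by (simp add: F_def)
    qed
    moreover have "inner (F y x) z = inner x (F y z)" for x z
      by (simp add: F_def B blinfun.add_left blinfun.scaleR_left inner_add_left
            inner_add_right inner_diff_left inner_diff_right m(2) ysym)
    moreover have "J o\<^sub>L F y = F y o\<^sub>L J" if J: "J o\<^sub>L B = B o\<^sub>L J" for J
    proof -
      have 1: "J (y x) = y (J x)" for x using ycomm[OF J] by (metis blinfun_apply_blinfun_compose)
      have 2: "J (B x) = B (J x)" for x using J by (metis blinfun_apply_blinfun_compose)
      show ?thesis
        by (rule blinfun_eqI)
          (simp add: F_def blinfun.add_left blinfun.scaleR_left blinfun.add_right
            blinfun.scaleR_right 1 2)
    qed
    ultimately show "F y \<in> S" by (simp add: S_def)
  qed
  moreover have "dist (F y) (F z) \<le> q * dist y z" if "y \<in> S" "z \<in> S" for y z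
  proof -
    have nyz: "norm y \<le> q" "norm z \<le> q" using that by (simp_all add: S_def)
    have "F y - F z = (1/2) *\<^sub>R ((y o\<^sub>L (y - z)) + ((y - z) o\<^sub>L z))"
      by (rule blinfun_eqI)
        (simp add: F_def blinfun.add_left blinfun.scaleR_left blinfun.diff_left
          blinfun.diff_right algebra_simps)
    then have "norm (F y - F z) \<le> (1/2) * (norm (y o\<^sub>L (y - z)) + norm ((y - z) o\<^sub>L z))"
      using norm_triangle_ineq[of "y o\<^sub>L (y - z)" "(y - z) o\<^sub>L z"] by simp
    also have "norm (y o\<^sub>L (y - z)) \<le> q * norm (y - z)"
      using norm_blinfun_compose[of y "y - z"] mult_right_mono[OF nyz(1), of "norm (y - z)"]
      by simp
    also have "norm ((y - z) o\<^sub>L z) \<le> q * norm (y - z)"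
      using norm_blinfun_compose[of "y - z" z] mult_left_mono[OF nyz(2), of "norm (y - z)"]
      by (simp add: mult.commute)
    finally show ?thesis by (simp add: dist_norm)
  qed
  ultimately have "\<exists>!y\<in>S. F y = y"
    using c by (intro Banach_fix[of S q F]) blast+
  then obtain y where y: "y \<in> S" "F y = y" by blast
  have yq: "norm y \<le> q" and ysym: "\<And>x z. inner (y x) z = inner x (y z)"
    and ycomm: "\<And>J. J o\<^sub>L B = B o\<^sub>L J \<Longrightarrow> J o\<^sub>L y = y o\<^sub>L J"
    using y(1) by (simp_all add: S_def)
  have yy: "y (y x) = 2 *\<^sub>R y x - B x" for x
  proof -
    have "blinfun_apply (F y) x = y x" using y(2) by simp
    then have "(1/2) *\<^sub>R (B x + y (y x)) = y x"
      by (simp add: F_def blinfun.add_left blinfun.scaleR_left)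
    then have "2 *\<^sub>R ((1/2) *\<^sub>R (B x + y (y x))) = 2 *\<^sub>R y x" by simp
    then show ?thesis by (simp add: algebra_simps)
  qed
  define k where "k = 1 / sqrt c"
  have k: "0 < k" "k * k * c = 1" using c(1) by (auto simp: k_def)
  define R where "R = (\<lambda>x. k *\<^sub>R (x - y x))"
  have Rlin: "bounded_linear R" unfolding R_def
    by (intro bounded_linear_const_scaleR bounded_linear_sub bounded_linear_ident
        blinfun.bounded_linear_right)
  show thesis
  proof (rule that)
    show "symmetric_op R" unfolding symmetric_op_def
      using Rlin by (auto simp: R_def inner_diff_left inner_diff_right ysym)
    show "coercive (k * (1 - q)) R"
      unfolding coercive_def
    proof (intro conjI allI Rlin)
      show "0 < k * (1 - q)" using k c by simp
      fix x
      have "inner x (y x) \<le> norm x * (q * norm x)"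
        using norm_cauchy_schwarz[of x "y x"] norm_blinfun[of y x] yq
          mult_left_mono[of "norm (y x)" "q * norm x" "norm x"]
          mult_right_mono[of "norm y" q "norm x"] by force
      then have "k * ((1 - q) * (norm x)\<^sup>2) \<le> k * (inner x x - inner x (y x))"
        using k by (intro mult_left_mono)
          (auto simp: power2_norm_eq_inner[symmetric] power2_eq_square algebra_simps)
      then show "k * (1 - q) * (norm x)\<^sup>2 \<le> inner x (R x)"
        by (simp add: R_def inner_diff_right mult.assoc)
    qed
    show "R (R x) = M x" for x
    proof -
      have "R (R x) = (k * k) *\<^sub>R (x - y x - (y x - y (y x)))"
        by (simp add: R_def blinfun.scaleR_right blinfun.diff_right algebra_simps)
      also have "x - y x - (y x - y (y x)) = x - B x" by (simp add: yy scaleR_2)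
      also have "\<dots> = c *\<^sub>R M x" by (simp add: B)
      finally show ?thesis using k by simp
    qed
    show "J (R x) = R (J x)" if J: "bounded_linear J" "\<And>x. J (M x) = M (J x)" for J x
    proof -
      interpret J: bounded_linear J by fact
      have "Blinfun J o\<^sub>L B = B o\<^sub>L Blinfun J"
        by (rule blinfun_eqI)
          (simp add: bounded_linear_Blinfun_apply[OF J(1)] B J.diff J.scaleR J(2))
      then have "Blinfun J o\<^sub>L y = y o\<^sub>L Blinfun J" by (rule ycomm)
      then have "J (y x) = y (J x)" for x
        by (metis blinfun_apply_blinfun_compose bounded_linear_Blinfun_apply[OF J(1)])
      then show ?thesis by (simp add: R_def J.diff J.scaleR)
    qed
  qed
qed

text \<open>
  The roots of \<open>M + 1 / (n + 1)\<close> form a Cauchy sequence by \<open>norm_diff_le_sqrt_square_diff\<close>.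
\<close>

lemma nonneg_square_root:
  fixes M :: "'a::real_hilbert \<Rightarrow> 'a"
  assumes M: "nonneg_op M"
  obtains R where "nonneg_op R" "\<And>x. R (R x) = M x"
    "\<And>J x. bounded_linear J \<Longrightarrow> (\<And>x. J (M x) = M (J x)) \<Longrightarrow> J (R x) = R (J x)"
proof -
  note m = nonneg_opD[OF M]
  interpret M: bounded_linear M using m by simp
  define \<delta> :: "nat \<Rightarrow> real" where "\<delta> n = inverse (real (Suc n))" for n
  have \<delta>: "0 < \<delta> n" "\<delta> n \<le> 1" for n by (auto simp: \<delta>_def field_simps)
  have \<delta>_mono: "\<delta> n \<le> \<delta> k" if "k \<le> n" for n k using that by (auto simp: \<delta>_def field_simps)
  define N where "N n x = M x + \<delta> n *\<^sub>R x" for n x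
  have Nlin: "bounded_linear (N n)" for n
    unfolding N_def by (intro bounded_linear_add m bounded_linear_scaleR_right bounded_linear_const_scaleR bounded_linear_ident)
  have Nsym: "symmetric_op (N n)" for n
    unfolding symmetric_op_def using Nlin by (auto simp: N_def inner_add_left inner_add_right m(3))
  have Nco: "coercive (\<delta> n) (N n)" for n
    unfolding coercive_def using Nlin \<delta> m(4) by (auto simp: N_def inner_add_right power2_norm_eq_inner)
  have "\<exists>R. symmetric_op R \<and> (\<exists>\<rho>. coercive \<rho> R) \<and> (\<forall>x. R (R x) = N n x) \<and>
      (\<forall>J. bounded_linear J \<longrightarrow> (\<forall>x. J (N n x) = N n (J x)) \<longrightarrow> (\<forall>x. J (R x) = R (J x)))" for n
    using coercive_square_root[OF Nsym Nco, of n] by metis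
  then obtain R where Rsym: "\<And>n. symmetric_op (R n)" and Rco: "\<And>n. \<exists>\<rho>. coercive \<rho> (R n)"
    and RR: "\<And>n x. R n (R n x) = N n x"
    and Rcomm: "\<And>n J x. bounded_linear J \<Longrightarrow> (\<And>x. J (N n x) = N n (J x)) \<Longrightarrow> J (R n x) = R n (J x)"
    by metis
  have Rnn: "nonneg_op (R n)" for n using Rco coercive_imp_nonneg[OF Rsym] by blast
  note r = nonneg_opD[OF Rnn]
  have close: "norm (R n x - R k x) \<le> sqrt (\<delta> n) * norm x" if "n \<le> k" for n k x
  proof (rule norm_diff_le_sqrt_square_diff[OF Rnn Rnn])
    show "0 \<le> \<delta> n" using \<delta>[of n] by simp
    fix x
    have "R n (R n x) - R k (R k x) = (\<delta> n - \<delta> k) *\<^sub>R x"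
      by (simp add: RR N_def algebra_simps)
    then show "norm (R n (R n x) - R k (R k x)) \<le> \<delta> n * norm x"
      using \<delta>_mono[OF that] \<delta>[of k] by (simp add: mult_right_mono)
  qed
  have "convergent (\<lambda>n. R n x)" for x
  proof (rule Cauchy_convergent, rule CauchyI')
    fix e :: real assume "0 < e"
    have "(\<lambda>n. sqrt (\<delta> n) * norm x) \<longlonglongrightarrow> sqrt 0 * norm x"
      unfolding \<delta>_def by (intro tendsto_intros LIMSEQ_inverse_real_of_nat)
    then have "eventually (\<lambda>n. sqrt (\<delta> n) * norm x < e) sequentially"
      using \<open>0 < e\<close> by (intro order_tendstoD(2)) auto
    then obtain n0 where n0: "\<And>n. n0 \<le> n \<Longrightarrow> sqrt (\<delta> n) * norm x < e"
      by (auto simp: eventually_sequentially)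
    have "dist (R n x) (R k x) < e" if "n0 \<le> n" "n < k" for n k
      using close[of n k x] n0[of n] that by (simp add: dist_norm)
    then show "\<exists>n0. \<forall>n\<ge>n0. \<forall>k>n. dist (R n x) (R k x) < e" by blast
  qed
  then obtain L where L: "\<And>x. (\<lambda>n. R n x) \<longlonglongrightarrow> L x" unfolding convergent_def by metis
  obtain K where K: "\<And>x. norm (M x) \<le> norm x * K" "0 < K"
    using bounded_linear.pos_bounded[OF m(2)] by blast
  have Rbound: "norm (R n x) \<le> sqrt (K + 1) * norm x" for n x
  proof -
    have "(norm (R n x))\<^sup>2 = inner x (N n x)"
      using r(3)[of n x "R n x"] by (simp add: power2_norm_eq_inner RR)
    also have "\<dots> = inner x (M x) + \<delta> n * (norm x)\<^sup>2"
      by (simp add: N_def inner_add_right power2_norm_eq_inner)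
    also have "\<dots> \<le> norm x * (norm x * K) + 1 * (norm x)\<^sup>2"
    proof (rule add_mono)
      show "inner x (M x) \<le> norm x * (norm x * K)"
        using norm_cauchy_schwarz[of x "M x"] mult_left_mono[OF K(1)[of x], of "norm x"] by simp
      show "\<delta> n * (norm x)\<^sup>2 \<le> 1 * (norm x)\<^sup>2" by (rule mult_right_mono) (use \<delta> in auto)
    qed
    also have "\<dots> = (sqrt (K + 1) * norm x)\<^sup>2"
      using K(2) by (simp add: power_mult_distrib power2_eq_square algebra_simps)
    finally show ?thesis by (rule power2_le_imp_le) (use K(2) in simp)
  qed
  have Llin: "bounded_linear L"
  proof (rule bounded_linear_intro[where K = "sqrt (K + 1)"])
    fix x y :: 'a and c :: real
    show "L (x + y) = L x + L y"
    proof (rule LIMSEQ_unique[OF L])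
      show "(\<lambda>n. R n (x + y)) \<longlonglongrightarrow> L x + L y"
        using tendsto_add[OF L[of x] L[of y]] by (simp add: bounded_linear.linear[OF r(2)] linear_add)
    qed
    show "L (c *\<^sub>R x) = c *\<^sub>R L x"
    proof (rule LIMSEQ_unique[OF L])
      show "(\<lambda>n. R n (c *\<^sub>R x)) \<longlonglongrightarrow> c *\<^sub>R L x"
        using tendsto_scaleR[OF tendsto_const L[of x], of c]
        by (simp add: bounded_linear.linear[OF r(2)] linear_scale)
    qed
    show "norm (L x) \<le> norm x * sqrt (K + 1)"
      using LIMSEQ_le_const2[OF tendsto_norm[OF L[of x]]] Rbound[of _ x] by (metis mult.commute)
  qed
  show thesis
  proof (rule that)
    have Lsym: "inner (L x) y = inner x (L y)" for x y
      using LIMSEQ_unique[OF tendsto_inner[OF L[of x] tendsto_const[of y]]]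
        tendsto_inner[OF tendsto_const[of x] L[of y]] by (simp add: r(3))
    moreover have "0 \<le> inner x (L x)" for x
      using LIMSEQ_le_const[OF tendsto_inner[OF tendsto_const[of x] L[of x]], of 0] r(4) by blast
    ultimately show "nonneg_op L" using Llin by (simp add: nonneg_op_def symmetric_op_def)
    show "L (L x) = M x" for x
    proof -
      have "inner y (L (L x)) = inner y (M x)" for y
      proof -
        have "(\<lambda>n. inner (R n y) (R n x)) \<longlonglongrightarrow> inner (L y) (L x)" by (intro tendsto_inner L)
        moreover have "inner (R n y) (R n x) = inner y (N n x)" for n by (simp add: r(3) RR)
        moreover have "(\<lambda>n. inner y (N n x)) \<longlonglongrightarrow> inner y (M x + 0 *\<^sub>R x)"
          unfolding N_def \<delta>_def by (intro tendsto_intros LIMSEQ_inverse_real_of_nat)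
        ultimately have "inner (L y) (L x) = inner y (M x)" using LIMSEQ_unique by fastforce
        then show ?thesis by (simp add: Lsym)
      qed
      then show ?thesis by (metis inner_commute vector_eq_ldot)
    qed
    show "J (L x) = L (J x)" if J: "bounded_linear J" "\<And>x. J (M x) = M (J x)" for J x
    proof -
      interpret J: bounded_linear J by fact
      have "J (R n x) = R n (J x)" for n x
        by (rule Rcomm[OF J(1)]) (simp add: N_def J.add J.scaleR J(2))
      then have "(\<lambda>n. J (R n x)) \<longlonglongrightarrow> L (J x)" using L by simp
      moreover have "(\<lambda>n. J (R n x)) \<longlonglongrightarrow> J (L x)" by (intro J.tendsto L)
      ultimately show ?thesis using LIMSEQ_unique by blast
    qed
  qed
qed

section \<open>The Sylvester equation by a Cayley iteration\<close>

text \<open>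
  Let \<open>K = (T - 1/2) (T + 1/2)\<inverse>\<close> be the Cayley transform of \<open>T\<close>.  The orbit of \<open>\<xi>\<close> is
  \<open>h\<^sub>k = K\<^sup>k \<xi>\<close> and the steps are \<open>g\<^sub>k = (T + 1/2)\<inverse> h\<^sub>k\<close>.  With the shift \<open>1/2\<close>, the relation
  \<open>h\<^sub>k\<^sub>+\<^sub>1 = K h\<^sub>k\<close> takes the simple form \<open>h\<^sub>k\<^sub>+\<^sub>1 = h\<^sub>k - g\<^sub>k\<close>, and
  \<open>h\<^sub>k h\<^sub>k\<^sup>* - h\<^sub>k\<^sub>+\<^sub>1 h\<^sub>k\<^sub>+\<^sub>1\<^sup>* = T g\<^sub>k g\<^sub>k\<^sup>* + g\<^sub>k g\<^sub>k\<^sup>* T\<close>.  Since \<open>h\<^sub>k \<rightarrow> 0\<close>, summing over \<open>k\<close>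
  shows that \<open>Y = \<Sum> g\<^sub>k g\<^sub>k\<^sup>*\<close> solves \<open>T Y + Y T = \<xi> \<xi>\<^sup>*\<close>.  The solution comes as an explicit sum
  of nonnegative rank-one operators, which is the form needed for computing traces.
\<close>

definition cayley_shift :: "('a::real_hilbert \<Rightarrow> 'a) \<Rightarrow> 'a \<Rightarrow> 'a" where
  "cayley_shift T x = T x + (1/2) *\<^sub>R x"

primrec cayley_orbit :: "('a::real_hilbert \<Rightarrow> 'a) \<Rightarrow> 'a \<Rightarrow> nat \<Rightarrow> 'a" where
  "cayley_orbit T \<xi> 0 = \<xi>"
| "cayley_orbit T \<xi> (Suc k) = cayley_orbit T \<xi> k - inv (cayley_shift T) (cayley_orbit T \<xi> k)"

definition cayley_step :: "('a::real_hilbert \<Rightarrow> 'a) \<Rightarrow> 'a \<Rightarrow> nat \<Rightarrow> 'a" where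
  "cayley_step T \<xi> k = inv (cayley_shift T) (cayley_orbit T \<xi> k)"

context
  fixes T :: "'a::real_hilbert \<Rightarrow> 'a" and \<epsilon> :: real
  assumes Tsym: "symmetric_op T" and Tco: "coercive \<epsilon> T"
begin

lemma cayley_shift_coercive: "coercive (\<epsilon> + 1/2) (cayley_shift T)"
proof -
  note t = coerciveD[OF Tco]
  have "bounded_linear (cayley_shift T)"
    unfolding cayley_shift_def
    by (intro bounded_linear_add t bounded_linear_const_scaleR bounded_linear_ident)
  then show ?thesis
    using t by (auto simp: coercive_def cayley_shift_def inner_add_right distrib_right power2_norm_eq_inner)
qed

lemma cayley_step_shift: "cayley_shift T (cayley_step T \<xi> k) = cayley_orbit T \<xi> k"
  unfolding cayley_step_def
  using coercive_bij[OF cayley_shift_coercive] by (simp add: bij_is_surj surj_f_inv_f)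

lemma cayley_step_eq_diff: "cayley_step T \<xi> k = cayley_orbit T \<xi> k - cayley_orbit T \<xi> (Suc k)"
  by (simp add: cayley_step_def)

lemma cayley_orbit_eq:
  "cayley_orbit T \<xi> k = T (cayley_step T \<xi> k) + (1/2) *\<^sub>R cayley_step T \<xi> k"
  using cayley_step_shift[of \<xi> k] by (simp add: cayley_shift_def)

lemma cayley_orbit_Suc_eq:
  "cayley_orbit T \<xi> (Suc k) = T (cayley_step T \<xi> k) - (1/2) *\<^sub>R cayley_step T \<xi> k"
proof -
  define g where "g = cayley_step T \<xi> k"
  have "cayley_orbit T \<xi> (Suc k) = T g + (1/2) *\<^sub>R g - g"
    using cayley_orbit_eq[of \<xi> k] by (simp add: cayley_step_eq_diff g_def)
  also have "\<dots> = T g + ((1/2) - 1) *\<^sub>R g"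
    by (simp only: scaleR_left_diff_distrib scaleR_one add_diff_eq)
  finally show ?thesis by (simp add: g_def)
qed

lemma cayley_step_image:
  "T (cayley_step T \<xi> k) = (1/2) *\<^sub>R (cayley_orbit T \<xi> k + cayley_orbit T \<xi> (Suc k))"
  unfolding cayley_orbit_eq[of \<xi> k] cayley_orbit_Suc_eq by (simp flip: scaleR_2)

lemma cayley_step_energy:
  "inner (cayley_step T \<xi> k) (T (cayley_step T \<xi> k))
    = ((norm (cayley_orbit T \<xi> k))\<^sup>2 - (norm (cayley_orbit T \<xi> (Suc k)))\<^sup>2) / 2"
  unfolding cayley_step_image
  unfolding cayley_step_eq_diff power2_norm_eq_inner
  by (simp add: inner_diff_left inner_diff_right inner_add_right inner_commute del: cayley_orbit.simps)

text \<open>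
  The squared norms of the orbit decrease by \<open>2 \<langle>g\<^sub>k, T g\<^sub>k\<rangle>\<close>, so these energies tend to \<open>0\<close>.  By
  coercivity \<open>g\<^sub>k \<rightarrow> 0\<close>, and therefore \<open>h\<^sub>k = (T + 1/2) g\<^sub>k \<rightarrow> 0\<close>.
\<close>

lemma cayley_orbit_tendsto_0: "cayley_orbit T \<xi> \<longlonglongrightarrow> 0"
proof -
  note t = coerciveD[OF Tco]
  define h where "h = cayley_orbit T \<xi>"
  define g where "g = cayley_step T \<xi>"
  have gT: "inner (g k) (T (g k)) = ((norm (h k))\<^sup>2 - (norm (h (Suc k)))\<^sup>2) / 2" for k
    unfolding g_def h_def by (rule cayley_step_energy)
  have gpos: "\<epsilon> * (norm (g k))\<^sup>2 \<le> inner (g k) (T (g k))" for k by (rule t)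
  have "(norm (h (Suc k)))\<^sup>2 \<le> (norm (h k))\<^sup>2" for k
  proof -
    have "0 \<le> inner (g k) (T (g k))"
      by (rule order_trans[OF _ gpos]) (use t(2) in simp)
    then show ?thesis unfolding gT by simp
  qed
  then have "decseq (\<lambda>k. (norm (h k))\<^sup>2)" by (simp add: decseq_Suc_iff)
  then obtain l where l: "(\<lambda>k. (norm (h k))\<^sup>2) \<longlonglongrightarrow> l"
    by (rule decseq_convergent[of _ 0]) auto
  have "(\<lambda>k. inner (g k) (T (g k))) \<longlonglongrightarrow> (l - l) / 2"
    unfolding gT by (intro tendsto_divide tendsto_diff l LIMSEQ_Suc[OF l] tendsto_const) auto
  then have lim: "(\<lambda>k. inner (g k) (T (g k)) / \<epsilon>) \<longlonglongrightarrow> 0"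
    using tendsto_divide_zero[of "\<lambda>k. inner (g k) (T (g k))"] by simp
  have "(norm (g k))\<^sup>2 \<le> inner (g k) (T (g k)) / \<epsilon>" for k
    by (subst pos_le_divide_eq[OF t(2)]) (metis gpos mult.commute)
  then have "(\<lambda>k. (norm (g k))\<^sup>2) \<longlonglongrightarrow> 0"
    by (intro tendsto_sandwich[OF always_eventually always_eventually tendsto_const lim] allI)
      (rule zero_le_power2)
  then have "(\<lambda>k. sqrt ((norm (g k))\<^sup>2)) \<longlonglongrightarrow> sqrt 0" by (rule tendsto_real_sqrt)
  then have "g \<longlonglongrightarrow> 0" by (simp add: tendsto_norm_zero_iff)
  then have "(\<lambda>k. cayley_shift T (g k)) \<longlonglongrightarrow> cayley_shift T 0"
    by (rule bounded_linear.tendsto[OF coerciveD(1)[OF cayley_shift_coercive]])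
  then show ?thesis
    using coerciveD(1)[OF cayley_shift_coercive]
    by (simp add: g_def cayley_step_shift bounded_linear.linear linear_0)
qed

lemma cayley_energy_sums:
  "(\<lambda>k. inner (cayley_step T \<xi> k) (T (cayley_step T \<xi> k))) sums ((norm \<xi>)\<^sup>2 / 2)"
proof -
  have "(\<lambda>k. (norm (cayley_orbit T \<xi> k))\<^sup>2 / 2) \<longlonglongrightarrow> (norm (0::'a))\<^sup>2 / 2"
    by (intro tendsto_intros cayley_orbit_tendsto_0) auto
  from telescope_sums'[OF this] show ?thesis
    by (simp add: cayley_step_energy diff_divide_distrib del: cayley_orbit.simps(2))
qed

lemma cayley_bilinear_sums:
  "(\<lambda>k. inner x (T (cayley_step T \<xi> k)) * inner (cayley_step T \<xi> k) y
       + inner x (cayley_step T \<xi> k) * inner (T (cayley_step T \<xi> k)) y)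
    sums (inner x \<xi> * inner \<xi> y)"
proof -
  have "(\<lambda>k. inner x (cayley_orbit T \<xi> k) * inner (cayley_orbit T \<xi> k) y) \<longlonglongrightarrow> inner x 0 * inner 0 y"
    by (intro tendsto_intros cayley_orbit_tendsto_0)
  from telescope_sums'[OF this]
  have *: "(\<lambda>k. inner x (cayley_orbit T \<xi> k) * inner (cayley_orbit T \<xi> k) y
       - inner x (cayley_orbit T \<xi> (Suc k)) * inner (cayley_orbit T \<xi> (Suc k)) y)
     sums (inner x \<xi> * inner \<xi> y)"
    by (simp del: cayley_orbit.simps(2))
  moreover have "inner x (T (cayley_step T \<xi> k)) * inner (cayley_step T \<xi> k) y
       + inner x (cayley_step T \<xi> k) * inner (T (cayley_step T \<xi> k)) y
     = inner x (cayley_orbit T \<xi> k) * inner (cayley_orbit T \<xi> k) y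
       - inner x (cayley_orbit T \<xi> (Suc k)) * inner (cayley_orbit T \<xi> (Suc k)) y" for k
    unfolding cayley_step_image unfolding cayley_step_eq_diff
    by (simp add: inner_diff_left inner_diff_right inner_add_right inner_add_left field_simps
        del: cayley_orbit.simps)
  ultimately show ?thesis by simp
qed

text \<open>
  Superposition of the rank-one case for a right-hand side \<open>X = \<Sum> \<xi>\<^sub>n \<xi>\<^sub>n\<^sup>*\<close>; the double family of
  steps is enumerated by a single index.  The first sum is the trace of \<open>T Y\<close>, which is half the
  trace of \<open>X\<close>.
\<close>

lemma sylvester_nuclear_expansion:
  fixes \<xi> :: "nat \<Rightarrow> 'a"
  assumes \<xi>: "summable (\<lambda>n. (norm (\<xi> n))\<^sup>2)"
  obtains g :: "nat \<Rightarrow> 'a" where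
    "(\<lambda>l. inner (g l) (T (g l))) sums ((\<Sum>n. (norm (\<xi> n))\<^sup>2) / 2)"
    "\<And>x y. (\<lambda>l. inner x (T (g l)) * inner (g l) y + inner x (g l) * inner (T (g l)) y)
        sums (\<Sum>n. inner x (\<xi> n) * inner (\<xi> n) y)"
proof -
  note t = coerciveD[OF Tco]
  define G where "G = (\<lambda>(n, k). cayley_step T (\<xi> n) k)"
  have pos: "0 \<le> inner x (T x)" for x
    by (rule order_trans[OF _ t(3)]) (use t(2) in simp)
  have 1: "((\<lambda>k. inner (G (n, k)) (T (G (n, k)))) has_sum ((norm (\<xi> n))\<^sup>2 / 2)) UNIV" for n
    using sums_nonneg_imp_has_sum[OF cayley_energy_sums[of "\<xi> n"] pos] by (simp add: G_def)
  have 2: "((\<lambda>n. (norm (\<xi> n))\<^sup>2 / 2) has_sum ((\<Sum>n. (norm (\<xi> n))\<^sup>2) / 2)) UNIV"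
    by (intro sums_nonneg_imp_has_sum sums_divide summable_sums \<xi>) auto
  have 3: "(\<lambda>p. inner (G p) (T (G p))) summable_on (UNIV \<times> UNIV)"
    by (rule summable_on_SigmaI[OF 1 has_sum_imp_summable[OF 2]]) (use pos in auto)
  have 4: "((\<lambda>p. inner (G p) (T (G p))) has_sum ((\<Sum>n. (norm (\<xi> n))\<^sup>2) / 2)) (UNIV \<times> UNIV)"
    by (rule has_sum_SigmaI[OF 1 2 3])
  define f where "f x y p = inner x (T (G p)) * inner (G p) y + inner x (G p) * inner (T (G p)) y"
    for x y p
  have 5: "((\<lambda>k. f x y (n, k)) has_sum (inner x (\<xi> n) * inner (\<xi> n) y)) UNIV" 
    and 6: "f x y summable_on (UNIV \<times> UNIV)" for x y n
  proof -
    obtain K where K: "\<And>x. norm (T x) \<le> norm x * K" "0 < K"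
      using bounded_linear.pos_bounded[OF t(1)] by blast
    define c where "c = 2 * K * norm x * norm y / \<epsilon>"
    have bound: "norm (f x y p) \<le> c * inner (G p) (T (G p))" for p
    proof -
      have "\<bar>inner x (T (G p)) * inner (G p) y\<bar> \<le> (norm x * (norm (G p) * K)) * (norm (G p) * norm y)"
        unfolding abs_mult using K
        by (intro mult_mono order_trans[OF Cauchy_Schwarz_ineq2] mult_left_mono) auto
      moreover have "\<bar>inner x (G p) * inner (T (G p)) y\<bar> \<le> (norm x * norm (G p)) * ((norm (G p) * K) * norm y)"
        unfolding abs_mult using K
        by (intro mult_mono order_trans[OF Cauchy_Schwarz_ineq2] mult_right_mono) auto
      ultimately have "norm (f x y p) \<le> (2 * K * norm x * norm y) * (norm (G p))\<^sup>2"
        unfolding f_def by (simp add: power2_eq_square mult.commute mult.left_commute)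
      also have "(norm (G p))\<^sup>2 \<le> inner (G p) (T (G p)) / \<epsilon>"
        by (subst pos_le_divide_eq[OF t(2)]) (metis t(3) mult.commute)
      finally show ?thesis using K(2) by (simp add: c_def mult_left_mono)
    qed
    have "(\<lambda>p. norm (f x y p)) summable_on (UNIV \<times> UNIV)"
      by (rule summable_on_comparison_test[OF summable_on_cmult_right[OF 3, of c]]) (use bound in auto)
    then show "f x y summable_on (UNIV \<times> UNIV)" by (rule abs_summable_summable)
    have "summable (\<lambda>k. norm (f x y (n, k)))"
    proof (rule summable_comparison_test')
      show "summable (\<lambda>k. c * inner (G (n,k)) (T (G (n,k))))"
        using sums_summable[OF cayley_energy_sums[of "\<xi> n"]] by (intro summable_mult) (simp add: G_def)
    qed (use bound in auto)
    then show "((\<lambda>k. f x y (n, k)) has_sum (inner x (\<xi> n) * inner (\<xi> n) y)) UNIV"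
      by (rule norm_summable_imp_has_sum)
        (use cayley_bilinear_sums[of x "\<xi> n" y] in \<open>simp add: f_def G_def\<close>)
  qed
  have "(f x y has_sum infsum (f x y) (UNIV \<times> UNIV)) (UNIV \<times> UNIV)" for x y
    using 6 by (rule has_sum_infsum)
  moreover from has_sum_SigmaD[OF this 5]
  have "infsum (f x y) (UNIV \<times> UNIV) = (\<Sum>n. inner x (\<xi> n) * inner (\<xi> n) y)" for x y
    using has_sum_imp_sums sums_unique by fastforce
  ultimately have 7: "(f x y has_sum (\<Sum>n. inner x (\<xi> n) * inner (\<xi> n) y)) UNIV" for x y
    by simp
  show thesis
  proof (rule that[of "\<lambda>l. G (prod_decode l)"])
    show "(\<lambda>l. inner (G (prod_decode l)) (T (G (prod_decode l)))) sums ((\<Sum>n. (norm (\<xi> n))\<^sup>2) / 2)"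
      using 4 has_sum_reindex_bij_betw[OF bij_prod_decode, of "\<lambda>p. inner (G p) (T (G p))"]
      by (intro has_sum_imp_sums) simp
    show "(\<lambda>l. inner x (T (G (prod_decode l))) * inner (G (prod_decode l)) y
        + inner x (G (prod_decode l)) * inner (T (G (prod_decode l))) y)
        sums (\<Sum>n. inner x (\<xi> n) * inner (\<xi> n) y)" for x y
      using 7[of x y] has_sum_reindex_bij_betw[OF bij_prod_decode, of "f x y"]
      unfolding f_def by (intro has_sum_imp_sums) simp
  qed
qed

end

text \<open>
  If \<open>P E + E Q = 0\<close>, then \<open>\<langle>x, E y\<rangle>\<close> does not change when \<open>x\<close> and \<open>y\<close> are replaced by their
  images under the Cayley transforms of \<open>P\<close> and \<open>Q\<close>.  Both orbits tend to \<open>0\<close>.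
\<close>

lemma sylvester_unique:
  fixes E P Q :: "'a::real_hilbert \<Rightarrow> 'a"
  assumes P: "symmetric_op P" "coercive \<epsilon> P" and Q: "symmetric_op Q" "coercive \<epsilon>' Q"
    and E: "bounded_linear E" and eq: "\<And>x. P (E x) + E (Q x) = 0"
  shows "E x = 0"
proof -
  interpret P: bounded_linear P using symmetric_opD[OF P(1)] by simp
  interpret Q: bounded_linear Q using symmetric_opD[OF Q(1)] by simp
  interpret E: bounded_linear E by fact
  have zero: "inner u (E v) = 0" for u v
  proof -
    define p where "p = cayley_orbit P u"
    define q where "q = cayley_orbit Q v"
    have const: "inner (p k) (E (q k)) = inner u (E v)" for k
    proof (induction k)
      case (Suc k)
      define g where "g = cayley_step P u k"
      define h where "h = cayley_step Q v k"
      have g: "p k = P g + (1/2) *\<^sub>R g" "p (Suc k) = P g - (1/2) *\<^sub>R g"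
        unfolding p_def g_def by (rule cayley_orbit_eq[OF P] cayley_orbit_Suc_eq[OF P])+
      have h: "q k = Q h + (1/2) *\<^sub>R h" "q (Suc k) = Q h - (1/2) *\<^sub>R h"
        unfolding q_def h_def by (rule cayley_orbit_eq[OF Q] cayley_orbit_Suc_eq[OF Q])+
      have "inner (p k) (E (q k)) - inner (p (Suc k)) (E (q (Suc k))) = inner g (P (E h) + E (Q h))"
        unfolding g h using symmetric_opD(2)[OF P(1), of g "E h"]
        by (simp add: E.add E.diff E.scaleR inner_add_left inner_add_right inner_diff_left
            inner_diff_right algebra_simps)
      then show ?case using Suc eq by simp
    qed (simp add: p_def q_def)
    have "(\<lambda>k. inner (p k) (E (q k))) \<longlonglongrightarrow> inner 0 (E 0)"
      unfolding p_def q_def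
      by (intro tendsto_inner E.tendsto cayley_orbit_tendsto_0[OF P] cayley_orbit_tendsto_0[OF Q])
    then show ?thesis unfolding const by (simp add: LIMSEQ_const_iff)
  qed
  show ?thesis using zero[of "E x" x] by simp
qed

section \<open>Finite orthonormal sets\<close>

text \<open>
  Finiteness is part of the notion, because these sets index finite sums and are counted.
\<close>

definition orthonormal :: "'a::real_inner set \<Rightarrow> bool" where
  "orthonormal E \<longleftrightarrow> finite E \<and> pairwise orthogonal E \<and> (\<forall>e\<in>E. norm e = 1)"

definition proj_on :: "'a::real_inner set \<Rightarrow> 'a \<Rightarrow> 'a" where
  "proj_on E x = (\<Sum>e\<in>E. inner e x *\<^sub>R e)"

lemma orthonormal_inner:
  assumes "orthonormal E" "e \<in> E" "f \<in> E"
  shows "inner e f = (if e = f then 1 else 0)"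
  using assms by (auto simp: orthonormal_def pairwise_def orthogonal_def norm_eq_sqrt_inner)

lemma inner_proj_on:
  assumes "orthonormal E" "e \<in> E"
  shows "inner e (proj_on E x) = inner e x"
proof -
  have "inner e (proj_on E x) = (\<Sum>f\<in>E. if e = f then inner f x else 0)"
    unfolding proj_on_def inner_sum_right
    by (rule sum.cong) (use orthonormal_inner[OF assms] in auto)
  also have "\<dots> = inner e x" using assms by (simp add: orthonormal_def)
  finally show ?thesis .
qed

lemma norm_proj_on_le:
  assumes "orthonormal E"
  shows "norm (proj_on E x) \<le> norm x"
proof -
  have "inner (proj_on E x) (x - proj_on E x) = 0"
    unfolding proj_on_def[of E x] inner_sum_left
    by (rule sum.neutral)
      (use inner_proj_on[OF assms, of _ x] in \<open>auto simp: inner_diff_right proj_on_def\<close>)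
  then have "(norm (proj_on E x))\<^sup>2 = inner (proj_on E x) x"
    by (simp add: inner_diff_right power2_norm_eq_inner)
  also have "\<dots> \<le> norm (proj_on E x) * norm x" by (rule norm_cauchy_schwarz)
  finally show ?thesis by (cases "proj_on E x = 0") (auto simp: power2_eq_square)
qed

lemma proj_on_in_span: "proj_on E x \<in> span E"
  unfolding proj_on_def by (intro span_sum span_scale span_base)

lemma proj_on_eq_self:
  assumes "orthonormal E" "x \<in> span E"
  shows "proj_on E x = x"
proof -
  have "x - proj_on E x \<in> span E" using assms(2) proj_on_in_span by (rule span_diff)
  moreover have "orthogonal (x - proj_on E x) e" if "e \<in> E" for e
    using inner_proj_on[OF assms(1) that, of x]
    by (simp add: orthogonal_def inner_diff_left inner_diff_right inner_commute)
  ultimately have "orthogonal (x - proj_on E x) (x - proj_on E x)"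
    using orthogonal_to_span by blast
  then show ?thesis by (simp add: orthogonal_self)
qed

lemma orthonormal_insert:
  assumes "orthonormal E" "\<And>e. e \<in> E \<Longrightarrow> inner e r = 0" "r \<noteq> 0"
  shows "orthonormal (insert (r /\<^sub>R norm r) E)" "r /\<^sub>R norm r \<notin> E"
proof -
  show "orthonormal (insert (r /\<^sub>R norm r) E)"
    using assms by (auto simp: orthonormal_def pairwise_insert orthogonal_def inner_commute)
  show "r /\<^sub>R norm r \<notin> E"
    using assms(2)[of "r /\<^sub>R norm r"] assms(3) by auto
qed

lemma orthonormal_extension:
  assumes "orthonormal F" "finite X"
  obtains E where "orthonormal E" "F \<subseteq> E" "X \<subseteq> span E"
proof -
  have "\<exists>E. orthonormal E \<and> F \<subseteq> E \<and> X \<subseteq> span E"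
    using assms(2)
  proof (induction X)
    case empty then show ?case using assms(1) by auto
  next
    case (insert x X)
    then obtain E where E: "orthonormal E" "F \<subseteq> E" "X \<subseteq> span E" by blast
    define r where "r = x - proj_on E x"
    show ?case
    proof (cases "r = 0")
      case True
      then have "x \<in> span E" using proj_on_in_span[of E x] by (simp add: r_def)
      then show ?thesis using E by blast
    next
      case False
      let ?E = "insert (r /\<^sub>R norm r) E"
      have "orthonormal ?E"
        by (rule orthonormal_insert[OF E(1) _ False])
          (simp add: r_def inner_diff_right inner_proj_on[OF E(1)])
      moreover have "X \<subseteq> span ?E" using E(3) span_mono[of E ?E] by blast
      moreover have "x \<in> span ?E"
      proof -
        have "proj_on E x \<in> span ?E" using proj_on_in_span[of E x] span_mono[of E ?E] by blast
        moreover have "norm r *\<^sub>R (r /\<^sub>R norm r) \<in> span ?E" by (intro span_scale span_base) simp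
        then have "r \<in> span ?E" using False by simp
        ultimately have "proj_on E x + r \<in> span ?E" by (rule span_add)
        then show ?thesis by (simp add: r_def)
      qed
      ultimately show ?thesis using E(2) by blast
    qed
  qed
  then show thesis using that by blast
qed

section \<open>Finite-codimensional bounds\<close>

text \<open>
  A weak type bound without singular numbers: for each \<open>t\<close>, the operator has norm at most \<open>t\<close> on the
  orthogonal complement of at most \<open>c / t\<close> vectors.  In terms of singular numbers this says
  \<open>\<mu> k \<le> t\<close> for some \<open>k \<le> c / t\<close>.  It makes sense for operators that are not known to be compact,
  and sums, adjoints and corners can be treated directly.
\<close>

definition weak_bound :: "real \<Rightarrow> ('a::real_inner \<Rightarrow> 'b::real_normed_vector) \<Rightarrow> bool" where
  "weak_bound c V \<longleftrightarrow> (\<forall>t>0. \<exists>F. finite F \<and> t * real (card F) \<le> c \<and>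
     (\<forall>y. (\<forall>f\<in>F. inner f y = 0) \<longrightarrow> norm (V y) \<le> t * norm y))"

lemma weak_boundD:
  assumes "weak_bound c V" "0 < t"
  obtains F where "finite F" "t * real (card F) \<le> c"
    "\<And>y. (\<And>f. f \<in> F \<Longrightarrow> inner f y = 0) \<Longrightarrow> norm (V y) \<le> t * norm y"
proof -
  obtain F where "finite F" "t * real (card F) \<le> c"
    "\<forall>y. (\<forall>f\<in>F. inner f y = 0) \<longrightarrow> norm (V y) \<le> t * norm y"
    using assms(1)[unfolded weak_bound_def, rule_format, OF assms(2)] by (elim exE conjE)
  then show thesis by (intro that[of F]) auto
qed

lemma weak_bound_mono:
  assumes "weak_bound c V" "c \<le> d"
  shows "weak_bound d V"
  unfolding weak_bound_def
proof (intro allI impI)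
  fix t :: real assume "0 < t"
  obtain F where F: "finite F" "t * real (card F) \<le> c"
    "\<And>y. (\<And>f. f \<in> F \<Longrightarrow> inner f y = 0) \<Longrightarrow> norm (V y) \<le> t * norm y"
    using weak_boundD[OF assms(1) \<open>0 < t\<close>] by metis
  then show "\<exists>F. finite F \<and> t * real (card F) \<le> d \<and>
     (\<forall>y. (\<forall>f\<in>F. inner f y = 0) \<longrightarrow> norm (V y) \<le> t * norm y)"
    using assms(2) by (intro exI[of _ F] conjI allI impI) auto
qed

text \<open>
  The factor 2 is the quasi-norm constant: each summand is used with \<open>t / 2\<close>.
\<close>

lemma weak_bound_add:
  assumes "weak_bound c V" "weak_bound d W"
  shows "weak_bound (2 * (c + d)) (\<lambda>y. V y + W y)"
  unfolding weak_bound_def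
proof (intro allI impI)
  fix t :: real assume "0 < t"
  then have "0 < t / 2" by simp
  obtain F where F: "finite F" "t / 2 * real (card F) \<le> c"
    "\<And>y. (\<And>f. f \<in> F \<Longrightarrow> inner f y = 0) \<Longrightarrow> norm (V y) \<le> t / 2 * norm y"
    using weak_boundD[OF assms(1) \<open>0 < t / 2\<close>] by metis
  obtain G where G: "finite G" "t / 2 * real (card G) \<le> d"
    "\<And>y. (\<And>f. f \<in> G \<Longrightarrow> inner f y = 0) \<Longrightarrow> norm (W y) \<le> t / 2 * norm y"
    using weak_boundD[OF assms(2) \<open>0 < t / 2\<close>] by metis
  have "t * real (card (F \<union> G)) \<le> t * (real (card F) + real (card G))"
    using card_Un_le[of F G] \<open>0 < t\<close> by (intro mult_left_mono) auto
  also have "\<dots> \<le> 2 * (c + d)" using F(2) G(2) by (simp add: algebra_simps)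
  finally have "t * real (card (F \<union> G)) \<le> 2 * (c + d)" .
  moreover have "norm (V y + W y) \<le> t * norm y" if "\<forall>f\<in>F \<union> G. inner f y = 0" for y
    using norm_triangle_ineq[of "V y" "W y"] F(3)[of y] G(3)[of y] that by simp
  ultimately show "\<exists>F. finite F \<and> t * real (card F) \<le> 2 * (c + d) \<and>
     (\<forall>y. (\<forall>f\<in>F. inner f y = 0) \<longrightarrow> norm (V y + W y) \<le> t * norm y)"
    using F(1) G(1) by (intro exI[of _ "F \<union> G"]) auto
qed

text \<open>
  If \<open>V\<close> is small on the orthogonal complement of \<open>F\<close> and \<open>y\<close> is orthogonal to \<open>V ` F\<close>, then \<open>W y\<close>
  is orthogonal to \<open>F\<close>, and \<open>|W y|\<^sup>2 = \<langle>V (W y), y\<rangle> \<le> t |W y| |y|\<close>.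
\<close>

lemma weak_bound_adjoint:
  fixes V W :: "'a::real_inner \<Rightarrow> 'a"
  assumes "weak_bound c V" and adj: "\<And>x y. inner (V x) y = inner x (W y)"
  shows "weak_bound c W"
  unfolding weak_bound_def
proof (intro allI impI)
  fix t :: real assume "0 < t"
  obtain F where F: "finite F" "t * real (card F) \<le> c"
    "\<And>y. (\<And>f. f \<in> F \<Longrightarrow> inner f y = 0) \<Longrightarrow> norm (V y) \<le> t * norm y"
    using weak_boundD[OF assms(1) \<open>0 < t\<close>] by metis
  have "t * real (card (V ` F)) \<le> t * real (card F)"
    using card_image_le[OF F(1)] \<open>0 < t\<close> by (intro mult_left_mono) auto
  moreover have "norm (W y) \<le> t * norm y" if "\<forall>f\<in>V ` F. inner f y = 0" for y
  proof -
    have "norm (V (W y)) \<le> t * norm (W y)" by (rule F(3)) (use that adj in auto)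
    then have "norm (W y) * norm (W y) \<le> (t * norm y) * norm (W y)"
      using norm_cauchy_schwarz[of "V (W y)" y] adj[of "W y" y]
        mult_right_mono[of "norm (V (W y))" "t * norm (W y)" "norm y"]
      by (simp add: norm_eq_sqrt_inner[symmetric] power2_norm_eq_inner[symmetric]
          power2_eq_square algebra_simps)
    then show ?thesis using \<open>0 < t\<close> by (cases "W y = 0") auto
  qed
  ultimately show "\<exists>F. finite F \<and> t * real (card F) \<le> c \<and>
     (\<forall>y. (\<forall>f\<in>F. inner f y = 0) \<longrightarrow> norm (W y) \<le> t * norm y)"
    using F(1,2) by (intro exI[of _ "V ` F"]) auto
qed

lemma weak_bound_corner:
  fixes V :: "'a::real_inner \<times> 'b::real_inner \<Rightarrow> 'c::real_normed_vector \<times> 'd::real_normed_vector"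
  assumes "weak_bound c V"
  shows "weak_bound c (\<lambda>y. fst (V (0, y)))"
  unfolding weak_bound_def
proof (intro allI impI)
  fix t :: real assume "0 < t"
  obtain F where F: "finite F" "t * real (card F) \<le> c"
    "\<And>y. (\<And>f. f \<in> F \<Longrightarrow> inner f y = 0) \<Longrightarrow> norm (V y) \<le> t * norm y"
    using weak_boundD[OF assms \<open>0 < t\<close>] by metis
  have "t * real (card (snd ` F)) \<le> t * real (card F)"
    using card_image_le[OF F(1)] \<open>0 < t\<close> by (intro mult_left_mono) auto
  moreover have "norm (fst (V (0, y))) \<le> t * norm y" if "\<forall>f\<in>snd ` F. inner f y = 0" for y
  proof -
    have "norm (V (0, y)) \<le> t * norm ((0::'a), y)"
      by (rule F(3)) (use that in \<open>auto simp: inner_prod_def\<close>)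
    then show ?thesis
      using norm_fst_le[of "fst (V (0, y))" "snd (V (0, y))"] by (simp add: norm_Pair)
  qed
  ultimately show "\<exists>F. finite F \<and> t * real (card F) \<le> c \<and>
     (\<forall>y. (\<forall>f\<in>F. inner f y = 0) \<longrightarrow> norm (fst (V (0, y))) \<le> t * norm y)"
    using F(1,2) by (intro exI[of _ "snd ` F"]) auto
qed

section \<open>Accretive products of nonnegative operators\<close>

definition gram_op :: "(nat \<Rightarrow> 'a::real_hilbert) \<Rightarrow> 'a \<Rightarrow> 'a" where
  "gram_op g x = (\<Sum>l. inner (g l) x *\<^sub>R g l)"

context
  fixes g :: "nat \<Rightarrow> 'a::real_hilbert"
  assumes g: "summable (\<lambda>l. (norm (g l))\<^sup>2)"
begin

lemma gram_op_term_le: "norm (inner (g l) x *\<^sub>R g l) \<le> (norm (g l))\<^sup>2 * norm x"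
  using mult_right_mono[OF Cauchy_Schwarz_ineq2[of "g l" x], of "norm (g l)"]
  by (simp add: power2_eq_square algebra_simps)

lemma gram_op_sums: "(\<lambda>l. inner (g l) x *\<^sub>R g l) sums gram_op g x"
  unfolding gram_op_def
  by (intro summable_sums summable_comparison_test'[OF summable_mult2[OF g, of "norm x"]]
      gram_op_term_le)

lemma inner_gram_op_sums: "(\<lambda>l. inner x (g l) * inner (g l) y) sums inner x (gram_op g y)"
  using bounded_linear.sums[OF bounded_linear_inner_right gram_op_sums[of y], of x]
  by (simp add: mult.commute)

lemma symmetric_gram_op: "symmetric_op (gram_op g)"
  unfolding symmetric_op_def
proof (intro conjI allI)
  show "bounded_linear (gram_op g)"
  proof (rule bounded_linear_intro[where K = "\<Sum>l. (norm (g l))\<^sup>2"])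
    fix x y :: 'a and c :: real
    show "gram_op g (x + y) = gram_op g x + gram_op g y"
      by (rule sums_unique2[OF gram_op_sums])
        (use sums_add[OF gram_op_sums[of x] gram_op_sums[of y]]
          in \<open>simp add: inner_add_right scaleR_left_distrib\<close>)
    show "gram_op g (c *\<^sub>R x) = c *\<^sub>R gram_op g x"
      by (rule sums_unique2[OF gram_op_sums])
        (use sums_scaleR_right[OF gram_op_sums[of x], of c] in simp)
    have "norm (gram_op g x) \<le> (\<Sum>l. (norm (g l))\<^sup>2 * norm x)"
      unfolding gram_op_def
      by (rule order_trans[OF summable_norm suminf_le[OF gram_op_term_le]])
        (use summable_comparison_test'[OF summable_mult2[OF g, of "norm x"], of 0
            "\<lambda>l. norm (inner (g l) x *\<^sub>R g l)"] gram_op_term_le g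
          in \<open>auto intro!: summable_mult2\<close>)
    then show "norm (gram_op g x) \<le> norm x * (\<Sum>l. (norm (g l))\<^sup>2)"
      using suminf_mult2[OF g, of "norm x"] by (simp add: mult.commute)
  qed
  show "inner (gram_op g x) y = inner x (gram_op g y)" for x y
    using sums_unique2[OF inner_gram_op_sums[of x y]] inner_gram_op_sums[of y x]
    by (simp add: inner_commute mult.commute)
qed

lemma nonneg_gram_op: "nonneg_op (gram_op g)"
  unfolding nonneg_op_def
proof (intro conjI symmetric_gram_op allI)
  show "0 \<le> inner x (gram_op g x)" for x
    using sums_le[OF _ sums_zero inner_gram_op_sums[of x x]] by (simp add: inner_commute)
qed

lemma accretive_shift_coercive:
  assumes T: "bounded_linear T" and acc: "\<And>y. 0 \<le> inner y (T (gram_op g y))" and t: "0 < t"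
  shows "coercive t (\<lambda>w. T (gram_op g w) + t *\<^sub>R w)"
  unfolding coercive_def
proof (intro conjI allI t)
  show "bounded_linear (\<lambda>w. T (gram_op g w) + t *\<^sub>R w)"
    by (intro bounded_linear_add bounded_linear_compose[OF T nonneg_opD(2)[OF nonneg_gram_op]]
        bounded_linear_scaleR_right bounded_linear_const_scaleR bounded_linear_ident)
  show "t * (norm x)\<^sup>2 \<le> inner x (T (gram_op g x) + t *\<^sub>R x)" for x
    using acc[of x] by (simp add: inner_add_right power2_norm_eq_inner)
qed

text \<open>
  Here \<open>Z = V (V + t)\<inverse>\<close> for \<open>V = T Y\<close> with \<open>Y\<close> the Gram operator, and the conclusion bounds the
  squared Hilbert-Schmidt norm of \<open>Z\<close> by \<open>tr V / t\<close>.  By accretivity \<open>|Z x|\<^sup>2 \<le> \<langle>x, Z x\<rangle>\<close>, so it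
  suffices to bound the trace of \<open>Z\<close>.  With \<open>L = (V + t)\<inverse>\<close> one has \<open>Z = T Y L\<close>, whose trace is
  \<open>\<Sum> \<langle>g\<^sub>l, L T g\<^sub>l\<rangle>\<close>.  If \<open>T\<close> is invertible, \<open>L T\<close> equals \<open>(t T\<inverse> + Y)\<inverse> \<le> T / t\<close>, so each term
  is at most \<open>\<langle>g\<^sub>l, T g\<^sub>l\<rangle> / t\<close>.
\<close>

lemma accretive_product_hilbert_schmidt:
  fixes T :: "'a \<Rightarrow> 'a"
  assumes T: "nonneg_op T"
    and acc: "\<And>y. 0 \<le> inner y (T (gram_op g y))"
    and b: "(\<lambda>l. inner (g l) (T (g l))) sums b"
    and t: "0 < t" and F: "orthonormal F"
    and Z: "\<And>w. Z (T (gram_op g w) + t *\<^sub>R w) = T (gram_op g w)"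
  shows "(\<Sum>f\<in>F. (norm (Z f))\<^sup>2) \<le> b / t"
proof -
  define Y where "Y = gram_op g"
  note tt = nonneg_opD[OF T]
  note y = nonneg_opD[OF nonneg_gram_op, folded Y_def]
  interpret T: bounded_linear T using tt by simp
  interpret Y: bounded_linear Y using y by simp
  define C where "C w = T (Y w) + t *\<^sub>R w" for w
  have C: "coercive t C"
    unfolding C_def Y_def by (rule accretive_shift_coercive[OF tt(2) acc t])
  interpret C: bounded_linear C using coerciveD[OF C] by simp
  define L where "L = inv C"
  have CL: "C (L x) = x" for x
    using coercive_bij[OF C] by (simp add: L_def bij_is_surj surj_f_inv_f)
  have LC: "L (C x) = x" for x
    using coercive_bij[OF C] by (simp add: L_def bij_is_inj)
  have Ladd: "L (u + v) = L u + L v" for u v by (metis CL LC C.add)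
  have Lscale: "L (r *\<^sub>R u) = r *\<^sub>R L u" for r u by (metis CL LC C.scaleR)
  have Lbound: "norm (L u) \<le> norm u / t" for u
    using coercive_norm_le[OF C, of "L u"] t by (simp add: CL field_simps)
  have ZL: "Z x = T (Y (L x))" for x
    using Z[of "L x"] CL[of x] by (simp add: C_def Y_def)
  have Zacc: "(norm (Z x))\<^sup>2 \<le> inner x (Z x)" for x
  proof -
    have "inner x (Z x) = inner (T (Y (L x)) + t *\<^sub>R L x) (T (Y (L x)))"
      using CL[of x] by (simp add: ZL C_def)
    also have "\<dots> = (norm (Z x))\<^sup>2 + t * inner (L x) (T (Y (L x)))"
      by (simp add: ZL inner_add_left power2_norm_eq_inner)
    finally show ?thesis using acc[of "L x"] t by (simp add: Y_def)
  qed
  \<comment> \<open>The inequality \<open>L T \<le> T / t\<close>, without inverting \<open>T\<close>: for \<open>w = L T x\<close> and \<open>h = x - Y w\<close>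
      one has \<open>T h = t w\<close>, which plays the role of \<open>h = t T\<inverse> w\<close>.\<close>
  have trace_term: "inner x (L (T x)) \<le> inner x (T x) / t" for x
  proof -
    define w where "w = L (T x)"
    define h where "h = x - Y w"
    have Th: "T h = t *\<^sub>R w"
      using CL[of "T x"] by (simp add: h_def w_def C_def T.diff algebra_simps)
    have "inner h (T h) \<le> inner x (T h)"
    proof -
      have "inner x (T h) = inner h (T h) + inner (Y w) (T h)"
        by (simp add: h_def inner_diff_left)
      then show ?thesis using y(4)[of w] t by (simp add: Th inner_commute)
    qed
    moreover have "2 * inner x (T h) \<le> inner x (T x) + inner h (T h)"
      using nonneg_op_weighted_cross_le(1)[OF T, of 1 x h] by simp
    ultimately have "inner x (T h) \<le> inner x (T x)" by simp
    then show ?thesis using t by (simp add: Th w_def field_simps)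
  qed
  obtain K where K: "\<And>x. norm (T x) \<le> norm x * K" "0 < K"
    using bounded_linear.pos_bounded[OF tt(2)] by blast
  show ?thesis
  proof (rule field_le_epsilon)
    fix \<delta> :: real assume "0 < \<delta>"
    \<comment> \<open>\<open>a l\<close> dominates the contribution of the \<open>l\<close>-th rank-one term to the trace over any orthonormal
        set.  Only the first \<open>J\<close> terms are evaluated exactly, over an orthonormal set \<open>E\<close> whose
        span contains the vectors \<open>T (g l)\<close> for \<open>l < J\<close>; the others contribute less than \<open>\<delta>\<close>.\<close>
    define a where "a l = (norm (g l))\<^sup>2 * (K / t)" for l
    have a: "summable a" unfolding a_def by (intro summable_mult2 g)
    have "eventually (\<lambda>J. suminf a - \<delta> < sum a {..<J}) sequentially"
      using summable_LIMSEQ[OF a] \<open>0 < \<delta>\<close> by (intro order_tendstoD) auto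
    then obtain J where J: "suminf a - sum a {..<J} < \<delta>"
      by (auto simp: eventually_sequentially algebra_simps)
    obtain E where E: "orthonormal E" "F \<subseteq> E" "(\<lambda>l. T (g l)) ` {..<J} \<subseteq> span E"
      using orthonormal_extension[OF F, of "(\<lambda>l. T (g l)) ` {..<J}"] by auto
    have fE: "finite E" using E(1) by (simp add: orthonormal_def)
    define c where "c l = inner (g l) (L (proj_on E (T (g l))))" for l
    have c_eq: "c l = (\<Sum>e\<in>E. inner (T e) (g l) * inner (g l) (L e))" for l
    proof -
      have "L (\<Sum>e\<in>X. r e *\<^sub>R e) = (\<Sum>e\<in>X. r e *\<^sub>R L e)" if "finite X" for X r
        using that by (induction X) (use Lscale[of 0] in \<open>auto simp: Ladd Lscale\<close>)
      then show ?thesis using fE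
        by (simp add: c_def proj_on_def inner_sum_right tt(3))
    qed
    have c_sums: "c sums (\<Sum>e\<in>E. inner e (Z e))"
    proof -
      have "(\<lambda>l. inner (T e) (g l) * inner (g l) (L e)) sums inner e (Z e)" for e
        using inner_gram_op_sums[of "T e" "L e"] by (simp add: ZL Y_def tt(3))
      then show ?thesis unfolding c_eq by (intro sums_sum)
    qed
    define d where "d l = inner (g l) (T (g l)) / t + (a l - (if l < J then a l else 0))" for l
    have c_le: "c l \<le> d l" for l
    proof (cases "l < J")
      case True
      then have "proj_on E (T (g l)) = T (g l)" using E by (intro proj_on_eq_self) auto
      then show ?thesis using trace_term[of "g l"] True by (simp add: c_def d_def)
    next
      case False
      have "c l \<le> norm (g l) * norm (L (proj_on E (T (g l))))"
        unfolding c_def by (rule norm_cauchy_schwarz)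
      also have "\<dots> \<le> norm (g l) * ((norm (g l) * K) / t)"
      proof (rule mult_left_mono)
        have "norm (L (proj_on E (T (g l)))) \<le> norm (T (g l)) / t"
          using Lbound[of "proj_on E (T (g l))"] norm_proj_on_le[OF E(1), of "T (g l)"] t
          by (meson divide_right_mono less_imp_le order_trans)
        also have "\<dots> \<le> norm (g l) * K / t" using K t by (intro divide_right_mono) auto
        finally show "norm (L (proj_on E (T (g l)))) \<le> norm (g l) * K / t" .
      qed simp
      finally have "c l \<le> a l" by (simp add: a_def power2_eq_square)
      then show ?thesis using tt(4)[of "g l"] t False by (simp add: d_def add_increasing)
    qed
    have "d sums (b / t + (suminf a - sum a {..<J}))"
      unfolding d_def
      using sums_If_finite_set[of "{..<J}" a]
      by (intro sums_add sums_diff sums_divide b summable_sums a) auto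
    from sums_le[OF c_le c_sums this]
    have "(\<Sum>e\<in>E. inner e (Z e)) \<le> b / t + \<delta>" using J by simp
    moreover have "(\<Sum>f\<in>F. (norm (Z f))\<^sup>2) \<le> (\<Sum>e\<in>E. (norm (Z e))\<^sup>2)"
      by (rule sum_mono2) (use fE E in auto)
    moreover have "\<dots> \<le> (\<Sum>e\<in>E. inner e (Z e))" by (rule sum_mono) (rule Zacc)
    ultimately show "(\<Sum>f\<in>F. (norm (Z f))\<^sup>2) \<le> b / t + \<delta>" by linarith
  qed
qed

text \<open>
  Take a maximal orthonormal set \<open>F\<close> of vectors with \<open>|Z f| > 1/2\<close>.  The Hilbert-Schmidt bound
  limits its size to \<open>4 b / t\<close>, and by maximality \<open>|Z u| \<le> |u| / 2\<close> for \<open>u\<close> orthogonal to \<open>F\<close>.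
  Apply this to \<open>u = (V + t) v\<close>.  That \<open>u\<close> is orthogonal to \<open>F\<close> means that \<open>v\<close> is orthogonal to the
  image of \<open>F\<close> under the adjoint \<open>Y T + t\<close>.
\<close>

lemma accretive_product_weak_bound:
  fixes T :: "'a \<Rightarrow> 'a"
  assumes T: "nonneg_op T"
    and acc: "\<And>y. 0 \<le> inner y (T (gram_op g y))"
    and b: "(\<lambda>l. inner (g l) (T (g l))) sums b"
  shows "weak_bound (4 * b) (\<lambda>y. T (gram_op g y))"
  unfolding weak_bound_def
proof (intro allI impI)
  fix t :: real assume t: "0 < t"
  note tt = nonneg_opD[OF T]
  note y = nonneg_opD[OF nonneg_gram_op]
  interpret T: bounded_linear T using tt by simp
  interpret Y: bounded_linear "gram_op g" using y by simp
  define C where "C w = T (gram_op g w) + t *\<^sub>R w" for w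
  have C: "coercive t C"
    unfolding C_def by (rule accretive_shift_coercive[OF tt(2) acc t])
  interpret C: bounded_linear C using coerciveD[OF C] by simp
  define Z where "Z x = T (gram_op g (inv C x))" for x
  have ZC: "Z (C w) = T (gram_op g w)" for w
    using coercive_bij[OF C] by (simp add: Z_def bij_is_inj)
  have Zscale: "Z (r *\<^sub>R x) = r *\<^sub>R Z x" for r x
  proof -
    obtain w where "x = C w" using bij_is_surj[OF coercive_bij[OF C]] by (metis surj_def)
    then show ?thesis using ZC[of "r *\<^sub>R w"] by (simp add: ZC C.scaleR T.scaleR Y.scaleR)
  qed
  define big where "big F \<longleftrightarrow> orthonormal F \<and> (\<forall>f\<in>F. 1 / 2 < norm (Z f))" for F
  have big_card: "t * real (card F) \<le> 4 * b" if "big F" for F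
  proof -
    have "real (card F) * (1 / 4) = (\<Sum>f\<in>F. 1 / 4)" by simp
    also have "\<dots> \<le> (\<Sum>f\<in>F. (norm (Z f))\<^sup>2)"
    proof (rule sum_mono)
      fix f assume "f \<in> F"
      then have "1 / 2 < norm (Z f)" using that by (simp add: big_def)
      then have "(1 / 2)\<^sup>2 \<le> (norm (Z f))\<^sup>2" by (intro power_mono) auto
      then show "1 / 4 \<le> (norm (Z f))\<^sup>2" by (simp add: power2_eq_square)
    qed
    also have "\<dots> \<le> b / t"
      using accretive_product_hilbert_schmidt[OF T acc b t, of F Z] ZC that
      by (simp add: big_def C_def)
    finally show ?thesis using t by (simp add: field_simps)
  qed
  have "big {}" by (simp add: big_def orthonormal_def)
  moreover have "card F \<le> nat \<lceil>4 * b / t\<rceil>" if "big F" for F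
  proof -
    have "real (card F) \<le> 4 * b / t" using big_card[OF that] t by (simp add: field_simps)
    then show ?thesis by linarith
  qed
  ultimately have "\<exists>F. big F \<and> (\<forall>G. big G \<longrightarrow> card G \<le> card F)"
    by (intro ex_has_greatest_nat[of big "{}" card "Suc (nat \<lceil>4 * b / t\<rceil>)"])
      (auto simp: less_Suc_eq_le)
  then obtain F where F: "big F" "\<And>G. big G \<Longrightarrow> card G \<le> card F" by metis
  have oF: "orthonormal F" and fF: "finite F" using F(1) by (auto simp: big_def orthonormal_def)
  have small: "norm (Z u) \<le> norm u / 2" if "\<And>f. f \<in> F \<Longrightarrow> inner f u = 0" for u
  proof (rule ccontr)
    assume "\<not> norm (Z u) \<le> norm u / 2"
    then have u: "norm u / 2 < norm (Z u)" by simp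
    then have "u \<noteq> 0" using Zscale[of 0 u] by auto
    then have "1 / 2 < norm (Z (u /\<^sub>R norm u))" using u by (simp add: Zscale field_simps)
    then have "big (insert (u /\<^sub>R norm u) F)"
      using orthonormal_insert(1)[OF oF that \<open>u \<noteq> 0\<close>] F(1) by (auto simp: big_def)
    then have "card (insert (u /\<^sub>R norm u) F) \<le> card F" by (rule F(2))
    then show False using orthonormal_insert(2)[OF oF that \<open>u \<noteq> 0\<close>] fF by simp
  qed
  define G where "G = (\<lambda>f. gram_op g (T f) + t *\<^sub>R f) ` F"
  have "finite G" using fF by (simp add: G_def)
  moreover have "t * real (card G) \<le> 4 * b"
  proof -
    have "t * real (card G) \<le> t * real (card F)"
      using card_image_le[OF fF] t by (intro mult_left_mono) (auto simp: G_def)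
    then show ?thesis using big_card[OF F(1)] by linarith
  qed
  moreover have "norm (T (gram_op g v)) \<le> t * norm v" if "\<forall>f\<in>G. inner f v = 0" for v
  proof -
    have "inner f (C v) = 0" if "f \<in> F" for f
    proof -
      have "inner (gram_op g (T f) + t *\<^sub>R f) v = 0"
        using \<open>\<forall>f\<in>G. inner f v = 0\<close> that by (auto simp: G_def)
      then show ?thesis by (simp add: C_def inner_add_left inner_add_right y(3) tt(3))
    qed
    then have "norm (T (gram_op g v)) \<le> norm (C v) / 2" using small[of "C v"] ZC by simp
    also have "norm (C v) \<le> norm (T (gram_op g v)) + t * norm v"
      unfolding C_def using norm_triangle_ineq[of "T (gram_op g v)" "t *\<^sub>R v"] t by simp
    finally show ?thesis by simp
  qed
  ultimately show "\<exists>F. finite F \<and> t * real (card F) \<le> 4 * b \<and>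
     (\<forall>y. (\<forall>f\<in>F. inner f y = 0) \<longrightarrow> norm (T (gram_op g y)) \<le> t * norm y)" by blast
qed

end

text \<open>
  Nonnegativity of the right-hand side \<open>X = \<Sum> \<xi>\<^sub>n \<xi>\<^sub>n\<^sup>*\<close> makes \<open>T Y\<close> accretive, since the symmetric
  part of \<open>T Y\<close> is \<open>X / 2\<close>.
\<close>

lemma sylvester_weak_bound:
  fixes T :: "'a::real_hilbert \<Rightarrow> 'a"
  assumes T: "symmetric_op T" "coercive \<epsilon> T" and \<xi>: "summable (\<lambda>n. (norm (\<xi> n))\<^sup>2)"
  obtains Y where "symmetric_op Y"
    "\<And>x y. inner x (T (Y y)) + inner x (Y (T y)) = (\<Sum>n. inner x (\<xi> n) * inner (\<xi> n) y)"
    "weak_bound (2 * (\<Sum>n. (norm (\<xi> n))\<^sup>2)) (\<lambda>y. T (Y y))"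
proof -
  note tc = coerciveD[OF T(2)] and ts = symmetric_opD[OF T(1)]
  obtain g where g:
    "(\<lambda>l. inner (g l) (T (g l))) sums ((\<Sum>n. (norm (\<xi> n))\<^sup>2) / 2)"
    "\<And>x y. (\<lambda>l. inner x (T (g l)) * inner (g l) y + inner x (g l) * inner (T (g l)) y)
        sums (\<Sum>n. inner x (\<xi> n) * inner (\<xi> n) y)"
    by (rule sylvester_nuclear_expansion[OF T \<xi>]) (rule that)
  have gsq: "(norm (g l))\<^sup>2 \<le> inner (g l) (T (g l)) / \<epsilon>" for l
    by (subst pos_le_divide_eq[OF tc(2)]) (metis tc(3) mult.commute)
  have gs: "summable (\<lambda>l. (norm (g l))\<^sup>2)"
    by (rule summable_comparison_test'[OF summable_divide[OF sums_summable[OF g(1)], of \<epsilon>]])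
      (use gsq in simp)
  define Y where "Y = gram_op g"
  have Ysym: "symmetric_op Y" unfolding Y_def by (rule symmetric_gram_op[OF gs])
  have eq: "inner x (T (Y y)) + inner x (Y (T y)) = (\<Sum>n. inner x (\<xi> n) * inner (\<xi> n) y)" for x y
  proof -
    have "(\<lambda>l. inner (T x) (g l) * inner (g l) y + inner x (g l) * inner (g l) (T y))
        sums (inner (T x) (Y y) + inner x (Y (T y)))"
      unfolding Y_def by (intro sums_add inner_gram_op_sums gs)
    then show ?thesis using sums_unique2[OF g(2)[of x y]] by (simp add: ts(2))
  qed
  have Tnn: "nonneg_op T" by (rule coercive_imp_nonneg[OF T])
  have acc: "0 \<le> inner y (T (Y y))" for y
  proof -
    have "inner y (Y (T y)) = inner y (T (Y y))"
      using symmetric_opD(2)[OF Ysym, of y "T y"] ts(2)[of "Y y" y] by (simp add: inner_commute)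
    then have "2 * inner y (T (Y y)) = (\<Sum>n. inner y (\<xi> n) * inner (\<xi> n) y)"
      using eq[of y y] by simp
    also have "\<dots> \<ge> 0"
    proof (rule suminf_nonneg)
      show "summable (\<lambda>n. inner y (\<xi> n) * inner (\<xi> n) y)"
        using inner_gram_op_sums[OF \<xi>, of y y] by (rule sums_summable)
    qed (simp add: inner_commute)
    finally show ?thesis by simp
  qed
  have "weak_bound (4 * ((\<Sum>n. (norm (\<xi> n))\<^sup>2) / 2)) (\<lambda>y. T (gram_op g y))"
    by (rule accretive_product_weak_bound[OF gs Tnn _ g(1)]) (use acc in \<open>simp add: Y_def\<close>)
  then have "weak_bound (2 * (\<Sum>n. (norm (\<xi> n))\<^sup>2)) (\<lambda>y. T (Y y))" by (simp add: Y_def)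
  with Ysym eq show thesis by (rule that)
qed

text \<open>
  A right-hand side \<open>\<Sum> a\<^sub>n b\<^sub>n\<^sup>*\<close> without any sign is the upper right corner of the nonnegative
  operator \<open>\<Sum> (a\<^sub>n, b\<^sub>n) (a\<^sub>n, b\<^sub>n)\<^sup>*\<close> on the product space.  With \<open>T = P \<oplus> Q\<close> the upper right
  corner of the solution solves the mixed equation.  The bound for \<open>Y Q\<close> is the corner of the bound
  for the adjoint of \<open>T Y\<close>.
\<close>

lemma sylvester_pair_weak_bound:
  fixes P Q :: "'a::real_hilbert \<Rightarrow> 'a"
  assumes P: "symmetric_op P" "coercive \<epsilon> P" and Q: "symmetric_op Q" "coercive \<epsilon>' Q"
    and a: "summable (\<lambda>n. (norm (a n))\<^sup>2)" and b: "summable (\<lambda>n. (norm (b n))\<^sup>2)"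
  obtains Y where "bounded_linear Y"
    "\<And>x y. inner x (P (Y y)) + inner x (Y (Q y)) = (\<Sum>n. inner x (a n) * inner (b n) y)"
    "weak_bound (2 * ((\<Sum>n. (norm (a n))\<^sup>2) + (\<Sum>n. (norm (b n))\<^sup>2))) (\<lambda>y. P (Y y))"
    "weak_bound (2 * ((\<Sum>n. (norm (a n))\<^sup>2) + (\<Sum>n. (norm (b n))\<^sup>2))) (\<lambda>y. Y (Q y))"
proof -
  note p = symmetric_opD[OF P(1)] and q = symmetric_opD[OF Q(1)]
  interpret P: bounded_linear P by (rule p)
  interpret Q: bounded_linear Q by (rule q)
  define T where "T = (\<lambda>z. (P (fst z), Q (snd z)))"
  have Tlin: "bounded_linear T"
    unfolding T_def
    by (intro bounded_linear_Pair bounded_linear_compose[OF p(1) bounded_linear_fst]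
        bounded_linear_compose[OF q(1) bounded_linear_snd])
  have T: "symmetric_op T"
    unfolding symmetric_op_def using Tlin by (auto simp: T_def inner_prod_def p q)
  have Tco: "coercive (min \<epsilon> \<epsilon>') T"
    unfolding coercive_def
  proof (intro conjI allI Tlin)
    show "0 < min \<epsilon> \<epsilon>'" using coerciveD(2)[OF P(2)] coerciveD(2)[OF Q(2)] by simp
    fix z :: "'a \<times> 'a"
    have "min \<epsilon> \<epsilon>' * (norm z)\<^sup>2 = min \<epsilon> \<epsilon>' * (norm (fst z))\<^sup>2 + min \<epsilon> \<epsilon>' * (norm (snd z))\<^sup>2"
      by (simp add: norm_prod_def distrib_left)
    also have "\<dots> \<le> \<epsilon> * (norm (fst z))\<^sup>2 + \<epsilon>' * (norm (snd z))\<^sup>2"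
      by (intro add_mono mult_right_mono) auto
    also have "\<dots> \<le> inner (fst z) (P (fst z)) + inner (snd z) (Q (snd z))"
      by (intro add_mono coerciveD(3)[OF P(2)] coerciveD(3)[OF Q(2)])
    finally show "min \<epsilon> \<epsilon>' * (norm z)\<^sup>2 \<le> inner z (T z)" by (simp add: T_def inner_prod_def)
  qed
  define \<xi> where "\<xi> n = (a n, b n)" for n
  have n\<xi>: "(norm (\<xi> n))\<^sup>2 = (norm (a n))\<^sup>2 + (norm (b n))\<^sup>2" for n
    by (simp add: \<xi>_def norm_Pair)
  have \<xi>: "summable (\<lambda>n. (norm (\<xi> n))\<^sup>2)" unfolding n\<xi> by (intro summable_add a b)
  have \<xi>sum: "(\<Sum>n. (norm (\<xi> n))\<^sup>2) = (\<Sum>n. (norm (a n))\<^sup>2) + (\<Sum>n. (norm (b n))\<^sup>2)"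
    unfolding n\<xi> using suminf_add[OF a b] by simp
  obtain W where W: "symmetric_op W"
    "\<And>x y. inner x (T (W y)) + inner x (W (T y)) = (\<Sum>n. inner x (\<xi> n) * inner (\<xi> n) y)"
    "weak_bound (2 * (\<Sum>n. (norm (\<xi> n))\<^sup>2)) (\<lambda>y. T (W y))"
    by (rule sylvester_weak_bound[OF T Tco \<xi>]) (rule that)
  note w = symmetric_opD[OF W(1)]
  define Y where "Y y = fst (W (0, y))" for y
  show thesis
  proof (rule that)
    show "bounded_linear Y"
      unfolding Y_def
      by (intro bounded_linear_compose[OF bounded_linear_fst] bounded_linear_compose[OF w(1)]
          bounded_linear_Pair bounded_linear_zero bounded_linear_ident)
    show "inner x (P (Y y)) + inner x (Y (Q y)) = (\<Sum>n. inner x (a n) * inner (b n) y)" for x y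
      using W(2)[of "(x, 0)" "(0, y)"] by (simp add: T_def Y_def \<xi>_def inner_prod_def)
    show "weak_bound (2 * ((\<Sum>n. (norm (a n))\<^sup>2) + (\<Sum>n. (norm (b n))\<^sup>2))) (\<lambda>y. P (Y y))"
      using weak_bound_corner[OF W(3)] by (simp add: T_def Y_def \<xi>sum)
    have "weak_bound (2 * (\<Sum>n. (norm (\<xi> n))\<^sup>2)) (\<lambda>y. W (T y))"
      by (rule weak_bound_adjoint[OF W(3)]) (simp add: w(2) symmetric_opD(2)[OF T])
    then show "weak_bound (2 * ((\<Sum>n. (norm (a n))\<^sup>2) + (\<Sum>n. (norm (b n))\<^sup>2))) (\<lambda>y. Y (Q y))"
      by (drule_tac weak_bound_corner) (simp add: T_def Y_def \<xi>sum)
  qed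
qed

section \<open>The difference of two absolute values\<close>

text \<open>
  The vector is \<open>a = P\<inverse> A u = A P\<inverse> u\<close>.  Because \<open>P\<^sup>2 = A\<^sup>2 + \<delta>\<close>, \<open>|A v| \<le> |P v|\<close> for all \<open>v\<close>.
\<close>

lemma contraction_through_square_root:
  fixes A P :: "'a::real_hilbert \<Rightarrow> 'a"
  assumes A: "symmetric_op A" and P: "symmetric_op P" "coercive \<epsilon> P" and "0 \<le> \<delta>"
    and sq: "\<And>x. P (P x) = A (A x) + \<delta> *\<^sub>R x" and comm: "\<And>x. A (P x) = P (A x)"
  obtains a where "P a = A u" "norm a \<le> norm u"
proof -
  obtain v where v: "u = P v" using bij_is_surj[OF coercive_bij[OF P(2)]] by (metis surj_def)
  have "(norm (A v))\<^sup>2 = inner v (A (A v))"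
    using symmetric_opD(2)[OF A, of v "A v"] by (simp add: power2_norm_eq_inner)
  also have "\<dots> \<le> inner v (P (P v))"
    using \<open>0 \<le> \<delta>\<close> by (simp add: sq inner_add_right)
  also have "\<dots> = (norm u)\<^sup>2"
    using symmetric_opD(2)[OF P(1), of v "P v"] by (simp add: v power2_norm_eq_inner)
  finally have "norm (A v) \<le> norm u" by (rule power2_le_imp_le) simp
  then show thesis using that[of "A v"] by (simp add: v comm)
qed

text \<open>
  With \<open>C = A - B = \<Sum> u\<^sub>n v\<^sub>n\<^sup>*\<close>, put \<open>a\<^sub>n = P\<inverse> A u\<^sub>n\<close> and \<open>b\<^sub>n = Q\<inverse> B v\<^sub>n\<close>.  Then
  \<open>P (P - Q) + (P - Q) Q = A C + C B = P (\<Sum> a\<^sub>n v\<^sub>n\<^sup>*) + (\<Sum> u\<^sub>n b\<^sub>n\<^sup>*) Q\<close>.  If \<open>Y\<close> and \<open>X\<close> solve the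
  Sylvester equations with these two sums as right-hand sides, \<open>P Y + X Q\<close> solves the same
  equation as \<open>P - Q\<close>, so the two are equal.
\<close>

lemma coercive_abs_diff_weak_bound:
  fixes A B P Q :: "'a::real_hilbert \<Rightarrow> 'a"
  assumes A: "symmetric_op A" and B: "symmetric_op B"
    and P: "symmetric_op P" "coercive \<epsilon> P" and Q: "symmetric_op Q" "coercive \<epsilon>' Q"
    and \<delta>: "0 \<le> \<delta>"
    and Psq: "\<And>x. P (P x) = A (A x) + \<delta> *\<^sub>R x" and Pcomm: "\<And>x. A (P x) = P (A x)"
    and Qsq: "\<And>x. Q (Q x) = B (B x) + \<delta> *\<^sub>R x" and Qcomm: "\<And>x. B (Q x) = Q (B x)"
    and u: "summable (\<lambda>n. (norm (u n))\<^sup>2)" and v: "summable (\<lambda>n. (norm (v n))\<^sup>2)"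
    and uv: "\<And>x y. (\<lambda>n. inner x (u n) * inner (v n) y) sums inner x (A y - B y)"
  shows "weak_bound (8 * ((\<Sum>n. (norm (u n))\<^sup>2) + (\<Sum>n. (norm (v n))\<^sup>2))) (\<lambda>y. P y - Q y)"
proof -
  interpret A: bounded_linear A using symmetric_opD[OF A] by simp
  interpret P: bounded_linear P using symmetric_opD[OF P(1)] by simp
  have "\<forall>n. \<exists>a. P a = A (u n) \<and> norm a \<le> norm (u n)"
    using contraction_through_square_root[OF A P \<delta> Psq Pcomm] by metis
  then obtain a where a: "\<And>n. P (a n) = A (u n)" "\<And>n. norm (a n) \<le> norm (u n)" by metis
  have "\<forall>n. \<exists>b. Q b = B (v n) \<and> norm b \<le> norm (v n)"
    using contraction_through_square_root[OF B Q \<delta> Qsq Qcomm] by metis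
  then obtain b where b: "\<And>n. Q (b n) = B (v n)" "\<And>n. norm (b n) \<le> norm (v n)" by metis
  have a2: "(norm (a n))\<^sup>2 \<le> (norm (u n))\<^sup>2" and b2: "(norm (b n))\<^sup>2 \<le> (norm (v n))\<^sup>2" for n
    using a(2) b(2) by (auto intro: power_mono)
  have as: "summable (\<lambda>n. (norm (a n))\<^sup>2)"
    by (rule summable_comparison_test'[OF u]) (use a2 in simp)
  have bs: "summable (\<lambda>n. (norm (b n))\<^sup>2)"
    by (rule summable_comparison_test'[OF v]) (use b2 in simp)
  obtain Y where Y: "bounded_linear Y"
    "\<And>x y. inner x (P (Y y)) + inner x (Y (Q y)) = (\<Sum>n. inner x (a n) * inner (v n) y)"
    "weak_bound (2 * ((\<Sum>n. (norm (a n))\<^sup>2) + (\<Sum>n. (norm (v n))\<^sup>2))) (\<lambda>y. P (Y y))"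
    by (rule sylvester_pair_weak_bound[OF P Q as v]) (rule that)
  obtain X where X: "bounded_linear X"
    "\<And>x y. inner x (P (X y)) + inner x (X (Q y)) = (\<Sum>n. inner x (u n) * inner (b n) y)"
    "weak_bound (2 * ((\<Sum>n. (norm (u n))\<^sup>2) + (\<Sum>n. (norm (b n))\<^sup>2))) (\<lambda>y. X (Q y))"
    by (rule sylvester_pair_weak_bound[OF P Q u bs]) (rule that)
  define E where "E y = P y - Q y - (P (Y y) + X (Q y))" for y
  have Elin: "bounded_linear E"
    unfolding E_def
    by (intro bounded_linear_sub bounded_linear_add symmetric_opD(1)[OF P(1)]
        symmetric_opD(1)[OF Q(1)] bounded_linear_compose[OF symmetric_opD(1)[OF P(1)] Y(1)]
        bounded_linear_compose[OF X(1) symmetric_opD(1)[OF Q(1)]])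
  have "P (E y) + E (Q y) = 0" for y
  proof -
    have "inner z (P (E y) + E (Q y)) = 0" for z
    proof -
      have 1: "inner z (P (P y - Q y) + (P (Q y) - Q (Q y)))
          = inner (A z) (A y - B y) + inner z (A (B y) - B (B y))"
      proof -
        have "P (P y - Q y) + (P (Q y) - Q (Q y)) = A (A y) - B (B y)"
          by (simp add: P.diff Psq Qsq)
        also have "\<dots> = A (A y - B y) + (A (B y) - B (B y))" by (simp add: A.diff)
        finally show ?thesis using symmetric_opD(2)[OF A, of z "A y - B y"]
          by (simp add: inner_add_right)
      qed
      have 2: "inner z (P (P (Y y)) + P (Y (Q y))) = inner (A z) (A y - B y)"
      proof -
        have "inner z (P (P (Y y)) + P (Y (Q y))) = inner (P z) (P (Y y)) + inner (P z) (Y (Q y))"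
          by (simp add: inner_add_right symmetric_opD(2)[OF P(1)])
        also have "\<dots> = (\<Sum>n. inner (P z) (a n) * inner (v n) y)" by (rule Y(2))
        also have "\<dots> = (\<Sum>n. inner (A z) (u n) * inner (v n) y)"
          by (simp add: symmetric_opD(2)[OF P(1)] symmetric_opD(2)[OF A] a(1))
        also have "\<dots> = inner (A z) (A y - B y)" using uv sums_unique by metis
        finally show ?thesis .
      qed
      have 3: "inner z (P (X (Q y)) + X (Q (Q y))) = inner z (A (B y) - B (B y))"
      proof -
        have "inner z (P (X (Q y)) + X (Q (Q y))) = (\<Sum>n. inner z (u n) * inner (b n) (Q y))"
          using X(2)[of z "Q y"] by (simp add: inner_add_right)
        also have "\<dots> = (\<Sum>n. inner z (u n) * inner (v n) (B y))"
          by (simp add: symmetric_opD(2)[OF Q(1), symmetric] symmetric_opD(2)[OF B, symmetric] b(1))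
        also have "\<dots> = inner z (A (B y) - B (B y))" using uv sums_unique by metis
        finally show ?thesis .
      qed
      have "P (E y) + E (Q y) = (P (P y - Q y) + (P (Q y) - Q (Q y)))
          - (P (P (Y y)) + P (Y (Q y))) - (P (X (Q y)) + X (Q (Q y)))"
        by (simp add: E_def P.diff P.add)
      then show ?thesis using 1 2 3 by (simp only: inner_diff_right)
    qed
    then show ?thesis by (metis inner_eq_zero_iff)
  qed
  then have E0: "E y = 0" for y by (rule sylvester_unique[OF P Q Elin])
  have "weak_bound (2 * (2 * ((\<Sum>n. (norm (a n))\<^sup>2) + (\<Sum>n. (norm (v n))\<^sup>2))
      + 2 * ((\<Sum>n. (norm (u n))\<^sup>2) + (\<Sum>n. (norm (b n))\<^sup>2)))) (\<lambda>y. P (Y y) + X (Q y))"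
    by (rule weak_bound_add[OF Y(3) X(3)])
  also have "(\<lambda>y. P (Y y) + X (Q y)) = (\<lambda>y. P y - Q y)"
    by (rule ext) (use E0 in \<open>simp add: E_def\<close>)
  finally show ?thesis
    by (rule weak_bound_mono)
      (use suminf_le[OF a2 as u] suminf_le[OF b2 bs v] in simp)
qed

lemma coercive_square_plus:
  fixes A :: "'a::real_hilbert \<Rightarrow> 'a"
  assumes A: "symmetric_op A" and "0 < \<delta>"
  obtains P \<rho> where "symmetric_op P" "coercive \<rho> P" "\<And>x. P (P x) = A (A x) + \<delta> *\<^sub>R x"
    "\<And>x. A (P x) = P (A x)"
proof -
  note a = symmetric_opD[OF A]
  interpret A: bounded_linear A by (rule a)
  define M where "M x = A (A x) + \<delta> *\<^sub>R x" for x
  have M: "bounded_linear M"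
    unfolding M_def
    by (intro bounded_linear_add bounded_linear_compose[OF a(1) a(1)]
        bounded_linear_const_scaleR bounded_linear_scaleR_right bounded_linear_ident)
  have "symmetric_op M"
    using M by (auto simp: symmetric_op_def M_def inner_add_left inner_add_right a(2))
  moreover have "coercive \<delta> M"
    unfolding coercive_def
  proof (intro conjI allI M \<open>0 < \<delta>\<close>)
    show "\<delta> * (norm x)\<^sup>2 \<le> inner x (M x)" for x
      using a(2)[of x "A x", symmetric] by (simp add: M_def inner_add_right power2_norm_eq_inner)
  qed
  ultimately show thesis
  proof (rule coercive_square_root)
    fix R \<rho>
    assume R: "symmetric_op R" "coercive \<rho> R" "\<And>x. R (R x) = M x"
      "\<And>J x. bounded_linear J \<Longrightarrow> (\<And>x. J (M x) = M (J x)) \<Longrightarrow> J (R x) = R (J x)"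
    have "A (R x) = R (A x)" for x
      by (rule R(4)[OF a(1)]) (simp add: M_def A.add A.scaleR)
    then show thesis by (rule that[OF R(1,2) R(3)[unfolded M_def]])
  qed
qed

text \<open>
  The regularization \<open>\<delta> = (\<eta> / 2)\<^sup>2\<close> moves each absolute value by at most \<open>\<eta> / 2\<close> in norm.
\<close>

lemma abs_diff_weak_estimate:
  fixes A B P Q :: "'a::real_hilbert \<Rightarrow> 'a"
  assumes A: "symmetric_op A" and B: "symmetric_op B"
    and P: "nonneg_op P" "\<And>x. P (P x) = A (A x)" and Q: "nonneg_op Q" "\<And>x. Q (Q x) = B (B x)"
    and u: "summable (\<lambda>n. (norm (u n))\<^sup>2)" and v: "summable (\<lambda>n. (norm (v n))\<^sup>2)"
    and uv: "\<And>x y. (\<lambda>n. inner x (u n) * inner (v n) y) sums inner x (A y - B y)"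
    and "0 < t" "0 < \<eta>"
  obtains F where "finite F"
    "t * real (card F) \<le> 8 * ((\<Sum>n. (norm (u n))\<^sup>2) + (\<Sum>n. (norm (v n))\<^sup>2))"
    "\<And>y. (\<And>f. f \<in> F \<Longrightarrow> inner f y = 0) \<Longrightarrow> norm (P y - Q y) \<le> (t + \<eta>) * norm y"
proof -
  define \<delta> where "\<delta> = (\<eta> / 2)\<^sup>2"
  have \<delta>: "0 < \<delta>" "sqrt \<delta> = \<eta> / 2" using \<open>0 < \<eta>\<close> by (auto simp: \<delta>_def)
  obtain P' \<rho> where P': "symmetric_op P'" "coercive \<rho> P'" "\<And>x. P' (P' x) = A (A x) + \<delta> *\<^sub>R x"
    "\<And>x. A (P' x) = P' (A x)"
    by (rule coercive_square_plus[OF A \<delta>(1)]) (rule that)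
  obtain Q' \<rho>' where Q': "symmetric_op Q'" "coercive \<rho>' Q'" "\<And>x. Q' (Q' x) = B (B x) + \<delta> *\<^sub>R x"
    "\<And>x. B (Q' x) = Q' (B x)"
    by (rule coercive_square_plus[OF B \<delta>(1)]) (rule that)
  obtain F where F: "finite F"
    "t * real (card F) \<le> 8 * ((\<Sum>n. (norm (u n))\<^sup>2) + (\<Sum>n. (norm (v n))\<^sup>2))"
    "\<And>y. (\<And>f. f \<in> F \<Longrightarrow> inner f y = 0) \<Longrightarrow> norm (P' y - Q' y) \<le> t * norm y"
    using weak_boundD[OF coercive_abs_diff_weak_bound[OF A B P'(1,2) Q'(1,2)
          less_imp_le[OF \<delta>(1)] P'(3,4) Q'(3,4) u v uv] \<open>0 < t\<close>] by metis
  have p: "norm (P y - P' y) \<le> \<eta> / 2 * norm y" for y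
    using norm_diff_le_sqrt_square_diff[OF P(1) coercive_imp_nonneg[OF P'(1,2)], of \<delta> y] \<delta>
    by (simp add: P P')
  have q: "norm (Q' y - Q y) \<le> \<eta> / 2 * norm y" for y
    using norm_diff_le_sqrt_square_diff[OF coercive_imp_nonneg[OF Q'(1,2)] Q(1), of \<delta> y] \<delta>
    by (simp add: Q Q')
  show thesis
  proof (rule that[OF F(1,2)])
    fix y assume "\<And>f. f \<in> F \<Longrightarrow> inner f y = 0"
    then have "norm (P' y - Q' y) \<le> t * norm y" by (rule F(3))
    moreover have "norm (P y - Q y) \<le> norm (P y - P' y) + norm (P' y - Q' y) + norm (Q' y - Q y)"
      using norm_triangle_ineq[of "P y - Q' y" "Q' y - Q y"]
        norm_triangle_ineq[of "P y - P' y" "P' y - Q' y"] by simp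
    ultimately show "norm (P y - Q y) \<le> (t + \<eta>) * norm y"
      using p[of y] q[of y] by (simp add: algebra_simps)
  qed
qed

section \<open>Complex inner products in terms of real ones\<close>

lemma cinner_scaleC_left: "cinner (a *\<^sub>C x) y = cnj a * cinner x y"
  using cinner_commute[of "a *\<^sub>C x" y] cinner_commute[of x y]
  by (simp add: cinner_scaleC_right)

lemma cinner_add_left: "cinner (x + y) z = cinner x z + cinner y z"
  using cinner_commute[of "x + y" z] cinner_commute[of x z] cinner_commute[of y z]
  by (simp add: cinner_add_right)

lemma Im_cinner: "Im (cinner x y) = inner (\<i> *\<^sub>C x) y"
  by (simp add: inner_cinner cinner_scaleC_left)

lemma inner_ii: "inner (\<i> *\<^sub>C x) y = - inner x (\<i> *\<^sub>C y)"
  by (simp add: inner_cinner cinner_scaleC_left cinner_scaleC_right)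

lemma norm_ii: "norm (\<i> *\<^sub>C x) = norm (x::'a::complex_inner)"
  by (simp add: norm_eq_sqrt_inner inner_cinner cinner_scaleC_left cinner_scaleC_right)

lemma cinner_eq_iff:
  "cinner x y = cinner u v \<longleftrightarrow> inner x y = inner u v \<and> inner (\<i> *\<^sub>C x) y = inner (\<i> *\<^sub>C u) v"
  unfolding complex_eq_iff Im_cinner by (simp add: inner_cinner)

lemma cinner_eq_0_iff: "cinner x y = 0 \<longleftrightarrow> inner x y = 0 \<and> inner (\<i> *\<^sub>C x) y = 0"
  unfolding complex_eq_iff Im_cinner by (simp add: inner_cinner)

lemma scaleC_decompose: "c *\<^sub>C x = Re c *\<^sub>R x + Im c *\<^sub>R (\<i> *\<^sub>C (x::'a::complex_inner))"
proof -
  have "c *\<^sub>C x = (complex_of_real (Re c) + complex_of_real (Im c) * \<i>) *\<^sub>C x"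
    by (metis complex_eq mult.commute)
  then show ?thesis by (simp add: scaleC_add_left scaleR_scaleC scaleC_scaleC)
qed

lemma bounded_linear_ii: "bounded_linear (\<lambda>x::'a::complex_inner. \<i> *\<^sub>C x)"
proof (rule bounded_linear_intro[where K = 1])
  show "\<i> *\<^sub>C (r *\<^sub>R x) = r *\<^sub>R (\<i> *\<^sub>C x)" for r and x :: 'a
    by (simp add: scaleR_scaleC scaleC_scaleC mult.commute)
qed (simp_all add: scaleC_add_right norm_ii)

lemma bounded_linear_cinner_right: "bounded_linear (cinner (x::'a::complex_inner))"
proof (rule bounded_linear_intro[where K = "2 * norm x"])
  show "cinner x (r *\<^sub>R y) = r *\<^sub>R cinner x y" for r y
    by (simp add: scaleR_scaleC cinner_scaleC_right scaleR_conv_of_real)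
  show "norm (cinner x y) \<le> norm y * (2 * norm x)" for y
  proof -
    have "norm (cinner x y) \<le> norm x * norm y + norm x * norm y"
      using cmod_le[of "cinner x y"] Cauchy_Schwarz_ineq2[of x y]
        Cauchy_Schwarz_ineq2[of "\<i> *\<^sub>C x" y]
      by (simp add: Im_cinner inner_cinner[symmetric] norm_ii)
    then show ?thesis by (simp add: mult.commute mult.left_commute)
  qed
qed (simp add: cinner_add_right)

lemma bounded_clinearI:
  assumes "bounded_linear A" "\<And>x. A (\<i> *\<^sub>C x) = \<i> *\<^sub>C A x"
  shows "bounded_clinear A"
proof -
  interpret A: bounded_linear A by fact
  have "A (c *\<^sub>C x) = c *\<^sub>C A x" for c x
    unfolding scaleC_decompose[of c x] scaleC_decompose[of c "A x"]
    by (simp add: A.add A.scaleR assms(2))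
  then show ?thesis using assms(1) by (simp add: bounded_clinear_def)
qed

section \<open>The Riesz representation and adjoints\<close>

text \<open>
  The representing vector minimizes \<open>|x|\<^sup>2 / 2 - \<phi> x\<close>.  A minimizing sequence is Cauchy by the
  parallelogram law, and the first variation at the minimum vanishes.
\<close>

lemma riesz_representation:
  fixes \<phi> :: "'a::real_hilbert \<Rightarrow> real"
  assumes "bounded_linear \<phi>"
  obtains r where "\<And>x. \<phi> x = inner r x"
proof -
  interpret \<phi>: bounded_linear \<phi> by fact
  define f where "f x = (norm x)\<^sup>2 / 2 - \<phi> x" for x
  obtain K where K: "\<And>x. norm (\<phi> x) \<le> norm x * K" "0 < K"
    using bounded_linear.pos_bounded[OF assms] by blast
  have lower: "- (K\<^sup>2 / 2) \<le> f x" for x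
  proof -
    have "\<phi> x \<le> norm x * K" using K(1)[of x] by simp
    moreover have "0 \<le> (norm x - K)\<^sup>2" by simp
    ultimately show ?thesis by (simp add: f_def power2_eq_square algebra_simps)
  qed
  have bdd: "bdd_below (range f)" by (rule bdd_belowI[of _ "- (K\<^sup>2 / 2)"]) (use lower in auto)
  define m where "m = (INF x. f x)"
  have m_le: "m \<le> f x" for x unfolding m_def by (rule cINF_lower[OF bdd]) simp
  define \<delta> where "\<delta> n = inverse (real (Suc n))" for n
  have \<delta>: "0 < \<delta> n" for n by (simp add: \<delta>_def)
  have \<delta>_lim: "\<delta> \<longlonglongrightarrow> 0" unfolding \<delta>_def by (rule LIMSEQ_inverse_real_of_nat)
  have "\<exists>x. f x < m + \<delta> n" for n
    using cINF_less_iff[OF _ bdd, of "m + \<delta> n"] \<delta>[of n] by (auto simp: m_def)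
  then obtain X where X: "\<And>n. f (X n) < m + \<delta> n" by metis
  have par: "(norm (x - y))\<^sup>2 = 4 * (f x + f y - 2 * f ((1/2) *\<^sub>R (x + y)))" for x y
    unfolding f_def power2_norm_eq_inner
    by (simp add: \<phi>.add \<phi>.scaleR inner_add_left inner_add_right inner_diff_left inner_diff_right
        inner_commute algebra_simps)
  have "Cauchy X"
  proof (rule CauchyI')
    fix e :: real assume "0 < e"
    have "(\<lambda>n. 8 * \<delta> n) \<longlonglongrightarrow> 8 * 0" by (intro tendsto_intros \<delta>_lim)
    then have "eventually (\<lambda>n. 8 * \<delta> n < e\<^sup>2) sequentially"
      by (rule order_tendstoD(2)) (use \<open>0 < e\<close> in simp)
    then obtain N where N: "\<And>n. N \<le> n \<Longrightarrow> 8 * \<delta> n < e\<^sup>2"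
      by (auto simp: eventually_sequentially)
    have "dist (X n) (X k) < e" if "N \<le> n" "n < k" for n k
    proof -
      have "\<delta> k \<le> \<delta> n" using that by (simp add: \<delta>_def field_simps)
      define c where "c = f ((1/2) *\<^sub>R (X n + X k))"
      have "m \<le> c" unfolding c_def by (rule m_le)
      have "(norm (X n - X k))\<^sup>2 = 4 * (f (X n) + f (X k) - 2 * c)"
        unfolding c_def by (rule par)
      also have "\<dots> \<le> 8 * \<delta> n" using X[of n] X[of k] \<open>m \<le> c\<close> \<open>\<delta> k \<le> \<delta> n\<close> by simp
      also have "\<dots> < e\<^sup>2" by (rule N[OF that(1)])
      finally have "(norm (X n - X k))\<^sup>2 < e\<^sup>2" .
      then have "norm (X n - X k) < e" by (rule power2_less_imp_less) (use \<open>0 < e\<close> in simp)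
      then show ?thesis by (simp add: dist_norm)
    qed
    then show "\<exists>N. \<forall>n\<ge>N. \<forall>k>n. dist (X n) (X k) < e" by blast
  qed
  then obtain r where r: "X \<longlonglongrightarrow> r" using Cauchy_convergent convergent_def by blast
  have fr: "f r \<le> m"
  proof (rule LIMSEQ_le)
    show "(\<lambda>n. f (X n)) \<longlonglongrightarrow> f r"
      unfolding f_def by (intro tendsto_intros r \<phi>.tendsto) auto
    show "(\<lambda>n. m + \<delta> n) \<longlonglongrightarrow> m"
      using tendsto_add[OF tendsto_const \<delta>_lim, of m] by simp
    show "\<exists>N. \<forall>n\<ge>N. f (X n) \<le> m + \<delta> n"
      using X by (meson less_imp_le)
  qed
  have "\<phi> y = inner r y" for y
  proof (cases "y = 0")
    case False
    define d where "d = inner r y - \<phi> y"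
    define t where "t = - d / (norm y)\<^sup>2"
    have ny: "(norm y)\<^sup>2 \<noteq> 0" using False by simp
    have "f (r + t *\<^sub>R y) = f r + t * d + t\<^sup>2 * (norm y)\<^sup>2 / 2"
      unfolding f_def d_def power2_norm_eq_inner
      by (simp add: \<phi>.add \<phi>.scaleR inner_add_left inner_add_right inner_commute
          power2_eq_square algebra_simps)
    moreover have "f r \<le> f (r + t *\<^sub>R y)" using fr m_le order_trans by blast
    ultimately have "0 \<le> t * d + t * (t * (norm y)\<^sup>2) / 2" by (simp add: power2_eq_square)
    also have "t * (norm y)\<^sup>2 = - d" using ny by (simp add: t_def)
    finally have "0 \<le> t * d" by (simp add: mult.commute)
    then have "d\<^sup>2 / (norm y)\<^sup>2 \<le> 0" by (simp add: t_def power2_eq_square)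
    then have "d = 0" using ny by (simp add: divide_le_0_iff)
    then show ?thesis by (simp add: d_def)
  qed (simp add: \<phi>.zero)
  then show thesis by (rule that)
qed

lemma cadjoint_eqI:
  fixes A :: "'a::complex_inner \<Rightarrow> 'a"
  assumes "\<And>x y. cinner (A x) y = cinner x (S y)"
  shows "cadjoint A = S"
  unfolding cadjoint_def
proof (rule the_equality)
  fix S' assume S': "\<forall>x y. cinner (A x) y = cinner x (S' y)"
  show "S' = S"
  proof
    fix y
    have "cinner x (S' y) = cinner x (S y)" for x using S' assms by metis
    then have "inner x (S' y) = inner x (S y)" for x by (simp add: inner_cinner)
    then show "S' y = S y" by (metis inner_commute vector_eq_ldot)
  qed
qed (use assms in simp)

text \<open>
  The real adjoint, from the Riesz representation, is also the complex one, because the imaginary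
  part of \<open>cinner x y\<close> is the real inner product of \<open>\<i> *\<^sub>C x\<close> and \<open>y\<close>.
\<close>

lemma cinner_cadjoint:
  fixes A :: "'a::complex_hilbert \<Rightarrow> 'a"
  assumes "bounded_clinear A"
  shows "cinner (A x) y = cinner x (cadjoint A y)"
proof -
  have A: "bounded_linear A" "\<And>c x. A (c *\<^sub>C x) = c *\<^sub>C A x"
    using assms by (auto simp: bounded_clinear_def)
  have "\<exists>r. \<forall>x. inner (A x) y = inner x r" for y
  proof -
    obtain r where "\<And>x. inner (A x) y = inner r x"
      by (rule riesz_representation[OF bounded_linear_compose[OF bounded_linear_inner_left A(1)]])
        (rule that)
    then show ?thesis by (metis inner_commute)
  qed
  then obtain S where S: "\<And>x y. inner (A x) y = inner x (S y)" by metis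
  have "cinner (A x) y = cinner x (S y)" for x y
    unfolding cinner_eq_iff using S[of x y] S[of "\<i> *\<^sub>C x" y] by (simp add: A(2))
  then show ?thesis using cadjoint_eqI[of A S] by simp
qed

lemma selfadjointD:
  fixes A :: "'a::complex_hilbert \<Rightarrow> 'a"
  assumes "selfadjoint A"
  shows "bounded_clinear A" "symmetric_op A"
    "A (c *\<^sub>C x) = c *\<^sub>C A x" "cinner (A x) y = cinner x (A y)" "cadjoint A = A"
proof -
  show A: "bounded_clinear A" "cadjoint A = A" using assms by (auto simp: selfadjoint_def)
  then show "A (c *\<^sub>C x) = c *\<^sub>C A x" by (simp add: bounded_clinear_def)
  have c: "cinner (A x) y = cinner x (A y)" for x y using cinner_cadjoint[OF A(1)] A(2) by simp
  then show "cinner (A x) y = cinner x (A y)" .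
  show "symmetric_op A"
    using A c by (simp add: symmetric_op_def bounded_clinear_def inner_cinner)
qed

lemma selfadjointI:
  fixes A :: "'a::complex_inner \<Rightarrow> 'a"
  assumes "symmetric_op A" "\<And>x. A (\<i> *\<^sub>C x) = \<i> *\<^sub>C A x"
  shows "selfadjoint A"
proof -
  have "cinner (A x) y = cinner x (A y)" for x y
    unfolding cinner_eq_iff
    using symmetric_opD(2)[OF assms(1), of x y] symmetric_opD(2)[OF assms(1), of "\<i> *\<^sub>C x" y]
    by (simp add: assms(2))
  then show ?thesis
    using cadjoint_eqI[of A A] bounded_clinearI[OF symmetric_opD(1)[OF assms(1)] assms(2)]
    by (simp add: selfadjoint_def)
qed

section \<open>The absolute value of a self-adjoint operator\<close>

text \<open>
  Polarization: a complex form that is real on the diagonal is Hermitian.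
\<close>

lemma positive_op_nonneg:
  fixes R :: "'a::complex_inner \<Rightarrow> 'a"
  assumes "positive_op R"
  shows "nonneg_op R"
proof -
  have R: "bounded_linear R" "\<And>c x. R (c *\<^sub>C x) = c *\<^sub>C R x" "\<And>x. cinner x (R x) \<in> \<real>\<^sub>\<ge>\<^sub>0"
    using assms by (auto simp: positive_op_def bounded_clinear_def)
  interpret R: bounded_linear R by (rule R)
  have im0: "Im (cinner x (R x)) = 0" and re: "0 \<le> Re (cinner x (R x))" for x
    using R(3)[of x] by (auto simp: complex_nonneg_Reals_iff)
  have "inner (R x) y = inner x (R y)" for x y
  proof -
    have "Im (cinner (\<i> *\<^sub>C x + y) (R (\<i> *\<^sub>C x + y))) = 0" by (rule im0)
    then have "Im (cinner (\<i> *\<^sub>C x) (R y) + cinner y (R (\<i> *\<^sub>C x))) = 0"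
      using im0[of "\<i> *\<^sub>C x"] im0[of y] by (simp add: R.add cinner_add_left cinner_add_right)
    then have "Re (cinner x (R y)) = Re (cinner y (R x))"
      by (simp add: R(2) cinner_scaleC_left cinner_scaleC_right)
    then show ?thesis by (simp add: inner_cinner[symmetric] inner_commute)
  qed
  then show ?thesis using R(1) re by (simp add: nonneg_op_def symmetric_op_def inner_cinner)
qed

text \<open>
  The real square root of \<open>T\<^sup>2\<close> commutes with multiplication by \<open>\<i>\<close>, since \<open>T\<^sup>2\<close> does.  So it is
  complex linear, and by symmetry its complex form is real on the diagonal.  It is the only candidate
  because every positive operator is nonnegative in the real sense, where roots are unique.
\<close>

lemma op_abs_selfadjoint:
  fixes T :: "'a::complex_hilbert \<Rightarrow> 'a"
  assumes T: "selfadjoint T"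
  shows "positive_op (op_abs T)" "op_abs T (op_abs T x) = T (T x)"
proof -
  note t = selfadjointD[OF T] and s = symmetric_opD[OF selfadjointD(2)[OF T]]
  define M where "M = T \<circ> T"
  have "nonneg_op M"
    unfolding nonneg_op_def symmetric_op_def M_def o_def
  proof (intro conjI allI bounded_linear_compose[OF s(1) s(1)])
    show "inner (T (T x)) y = inner x (T (T y))" for x y by (simp add: s(2))
    show "0 \<le> inner x (T (T x))" for x using s(2)[of x "T x", symmetric] by simp
  qed
  then have "\<exists>R. nonneg_op R \<and> (\<forall>x. R (R x) = M x) \<and> (\<forall>x. \<i> *\<^sub>C R x = R (\<i> *\<^sub>C x))"
  proof (rule nonneg_square_root)
    fix R
    assume R: "nonneg_op R" "\<And>x. R (R x) = M x"
      "\<And>J x. bounded_linear J \<Longrightarrow> (\<And>x. J (M x) = M (J x)) \<Longrightarrow> J (R x) = R (J x)"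
    have "\<i> *\<^sub>C R x = R (\<i> *\<^sub>C x)" for x
      by (rule R(3)[OF bounded_linear_ii]) (simp add: M_def t(3))
    then show ?thesis using R(1,2) by blast
  qed
  then obtain R where R: "nonneg_op R" "\<And>x. R (R x) = M x" and
    Ri: "\<And>x. R (\<i> *\<^sub>C x) = \<i> *\<^sub>C R x" by metis
  note r = nonneg_opD[OF R(1)]
  have "cinner x (R x) \<in> \<real>\<^sub>\<ge>\<^sub>0" for x
  proof -
    have "inner (\<i> *\<^sub>C x) (R x) = - inner (\<i> *\<^sub>C x) (R x)"
      using r(3)[of "\<i> *\<^sub>C x" x] inner_ii[of "R x" x] by (simp add: Ri inner_commute)
    then show ?thesis
      using r(4)[of x] by (simp add: complex_nonneg_Reals_iff inner_cinner Im_cinner)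
  qed
  then have pos: "positive_op R"
    using bounded_clinearI[OF r(2) Ri] by (simp add: positive_op_def)
  have RR: "R \<circ> R = M" using R(2) by auto
  have "op_sqrt M = R"
    unfolding op_sqrt_def
  proof (rule the_equality)
    fix R' assume R': "positive_op R' \<and> R' \<circ> R' = M"
    have "R' (R' x) = R (R x)" for x using R' RR by (metis comp_apply)
    then show "R' = R"
      using nonneg_op_eq_if_square_eq[OF positive_op_nonneg R(1)] R' by blast
  qed (use pos RR in simp)
  then have "op_abs T = R" by (simp add: op_abs_def t(5) M_def)
  then show "positive_op (op_abs T)" "op_abs T (op_abs T x) = T (T x)"
    using pos R(2) by (auto simp: M_def)
qed

lemma nonneg_op_abs:
  fixes T :: "'a::complex_hilbert \<Rightarrow> 'a"
  shows "selfadjoint T \<Longrightarrow> nonneg_op (op_abs T)"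
  by (intro positive_op_nonneg op_abs_selfadjoint(1))

lemma op_abs_scaleC:
  fixes T :: "'a::complex_hilbert \<Rightarrow> 'a"
  shows "selfadjoint T \<Longrightarrow> op_abs T (c *\<^sub>C x) = c *\<^sub>C op_abs T x"
  using op_abs_selfadjoint(1)[of T] by (simp add: positive_op_def bounded_clinear_def)

lemma cinner_op_abs:
  fixes T :: "'a::complex_hilbert \<Rightarrow> 'a"
  assumes T: "selfadjoint T"
  shows "cinner (op_abs T x) y = cinner x (op_abs T y)"
  unfolding cinner_eq_iff
  using nonneg_opD(3)[OF nonneg_op_abs[OF T]] by (metis op_abs_scaleC[OF T])

lemma norm_op_abs:
  fixes T :: "'a::complex_hilbert \<Rightarrow> 'a"
  assumes T: "selfadjoint T"
  shows "norm (op_abs T x) = norm (T x)"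
proof -
  note r = nonneg_opD[OF nonneg_op_abs[OF T]]
  have "inner (op_abs T x) (op_abs T x) = inner (T x) (T x)"
    using r(3)[of x "op_abs T x"] symmetric_opD(2)[OF selfadjointD(2)[OF T], of x "T x"]
    by (simp add: op_abs_selfadjoint(2)[OF T])
  then show ?thesis by (simp add: norm_eq_sqrt_inner)
qed

section \<open>Singular numbers of compact self-adjoint operators\<close>

lemma cinner_sum_scaleC:
  "cinner z (\<Sum>k\<in>K. c k *\<^sub>C f k) = (\<Sum>k\<in>K. c k * cinner z (f k))"
  unfolding linear_sum[OF bounded_linear.linear[OF bounded_linear_cinner_right]]
  by (simp add: cinner_scaleC_right)

lemma real_span_subset_cspan: "span X \<subseteq> cspan (X :: 'a::complex_inner set)"
proof
  fix x assume "x \<in> span X"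
  then show "x \<in> cspan X"
  proof (induction rule: span_induct_alt)
    case base then show ?case by (rule complex_vector.span_zero)
  next
    case (step c x y)
    then show ?case
      using complex_vector.span_add[OF complex_vector.span_scale[OF
          complex_vector.span_base[OF step(1)]] step(2)] by (simp add: scaleR_scaleC)
  qed
qed

text \<open>
  Complex orthogonality to \<open>E\<close> is real orthogonality to \<open>E\<close> and \<open>\<i> E\<close>, a finite set, whose real span
  is not the whole space.
\<close>

lemma finite_orthogonal_unit_vector:
  fixes E :: "'a::complex_inner set"
  assumes inf: "\<nexists>F :: 'a set. finite F \<and> cspan F = UNIV" and "finite E"
  obtains x where "norm x = 1" "\<And>e. e \<in> E \<Longrightarrow> cinner e x = 0"
proof -
  have "finite (E \<union> (*\<^sub>C) \<i> ` E)" using assms(2) by simp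
  then obtain O' where O: "orthonormal O'" "E \<union> (*\<^sub>C) \<i> ` E \<subseteq> span O'"
    using orthonormal_extension[of "{}" "E \<union> (*\<^sub>C) \<i> ` E"] by (auto simp: orthonormal_def)
  have "span O' \<noteq> UNIV"
    using real_span_subset_cspan[of O'] inf O(1) by (metis top.extremum_uniqueI orthonormal_def)
  then obtain z where z: "z \<notin> span O'" by blast
  define r where "r = z - proj_on O' z"
  have "r \<noteq> 0" using z proj_on_in_span[of O' z] by (auto simp: r_def)
  have r: "orthogonal r e" if "e \<in> span O'" for e
    by (rule orthogonal_to_span[OF that])
      (simp add: r_def orthogonal_def inner_diff_left inner_commute[of z] inner_commute[of "proj_on O' z"]
        inner_proj_on[OF O(1)])
  show thesis
  proof (rule that)
    show "norm (r /\<^sub>R norm r) = 1" using \<open>r \<noteq> 0\<close> by simp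
    show "cinner e (r /\<^sub>R norm r) = 0" if "e \<in> E" for e
    proof -
      have "orthogonal r e" "orthogonal r (\<i> *\<^sub>C e)" using O(2) that by (auto intro!: r)
      then show ?thesis
        unfolding cinner_eq_0_iff by (simp add: orthogonal_def inner_commute)
    qed
  qed
qed

lemma compact_op_subsequence:
  assumes "compact_op T" and "\<And>n. norm (x n) = 1"
  obtains r :: "nat \<Rightarrow> nat" and z where "strict_mono r" "(\<lambda>n. T (x (r n))) \<longlonglongrightarrow> z"
proof -
  have in_cl: "\<forall>n. T (x n) \<in> closure (T ` cball 0 1)"
    using assms(2) by (intro allI subsetD[OF closure_subset] imageI) simp
  have sc: "seq_compact (closure (T ` cball 0 1))"
    using assms(1) by (simp add: compact_op_def compact_imp_seq_compact)
  obtain z r where "strict_mono r" "((\<lambda>n. T (x n)) \<circ> r) \<longlonglongrightarrow> z"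
    by (rule seq_compactE[OF sc in_cl]) (rule that)
  then show thesis by (intro that[of r z]) (auto simp: o_def)
qed

text \<open>
  On the orthogonal complement \<open>M\<close> of finitely many eigenvectors, which is invariant, let \<open>s\<close> be the
  norm of \<open>R = op_abs T\<close>.  Unit vectors \<open>x\<^sub>n\<close> of \<open>M\<close> with \<open>|R x\<^sub>n| \<rightarrow> s\<close> satisfy
  \<open>R\<^sup>2 x\<^sub>n - s\<^sup>2 x\<^sub>n \<rightarrow> 0\<close>.  By compactness \<open>R x\<^sub>n\<close> converges along a subsequence, and if \<open>s > 0\<close> so
  does \<open>x\<^sub>n\<close>, to a vector \<open>e\<close> with \<open>R\<^sup>2 e = s\<^sup>2 e\<close>.  Nonnegativity of \<open>R\<close> excludes the eigenvalue
  \<open>-s\<close>, hence \<open>R e = s e\<close>.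
\<close>

lemma top_eigenvector:
  fixes T :: "'a::complex_hilbert \<Rightarrow> 'a" and E :: "'a set"
  assumes T: "selfadjoint T" and compT: "compact_op T"
    and inf: "\<nexists>F :: 'a set. finite F \<and> cspan F = UNIV" and "finite E"
    and eigE: "\<And>e. e \<in> E \<Longrightarrow> \<exists>s. op_abs T e = s *\<^sub>R e"
  shows "\<exists>e s. norm e = 1 \<and> (\<forall>d\<in>E. cinner d e = 0) \<and> 0 \<le> s \<and> op_abs T e = s *\<^sub>R e
    \<and> (\<forall>y. (\<forall>d\<in>E. cinner d y = 0) \<longrightarrow> norm (T y) \<le> s * norm y)"
proof -
  define R where "R = op_abs T"
  note rr = nonneg_opD[OF nonneg_op_abs[OF T], folded R_def]
  note abs_lin = rr(2) and abs_sym = rr(3) and abs_nonneg = rr(4)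
    and abs_norm = norm_op_abs[OF T, folded R_def] and abs_csym = cinner_op_abs[OF T, folded R_def]
    and eig = eigE[folded R_def]
  interpret R: bounded_linear R by (rule abs_lin)
  define M where "M = {y. \<forall>d\<in>E. cinner d y = 0}"
  have M_R: "R y \<in> M" if "y \<in> M" for y
  proof -
    have "cinner d (R y) = 0" if "d \<in> E" for d
    proof -
      obtain s where s: "R d = s *\<^sub>R d" using eig[OF \<open>d \<in> E\<close>] by blast
      have "cinner d (R y) = cinner (R d) y" by (rule abs_csym[symmetric])
      also have "\<dots> = 0" using \<open>y \<in> M\<close> \<open>d \<in> E\<close>
        by (simp add: s scaleR_scaleC cinner_scaleC_left M_def)
      finally show ?thesis .
    qed
    then show ?thesis by (simp add: M_def)
  qed
  have M_scale: "a *\<^sub>R y \<in> M" if "y \<in> M" for a y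
    using that by (simp add: M_def scaleR_scaleC cinner_scaleC_right)
  have M_closed: "closed M"
  proof -
    have "M = (\<Inter>d\<in>E. {y. cinner d y = 0})" by (auto simp: M_def)
    moreover have "closed {y. cinner d y = 0}" for d :: 'a
      by (intro closed_Collect_eq continuous_on_const linear_continuous_on bounded_linear_cinner_right)
    ultimately show ?thesis by auto
  qed
  obtain K where K: "\<And>x. norm (R x) \<le> norm x * K" "0 < K"
    using bounded_linear.pos_bounded[OF abs_lin] by blast
  define V where "V = (\<lambda>y. norm (R y)) ` {y\<in>M. norm y = 1}"
  have Vne: "V \<noteq> {}"
  proof -
    obtain x where "norm x = 1" "x \<in> M"
      by (rule finite_orthogonal_unit_vector[OF inf \<open>finite E\<close>]) (rule that, auto simp: M_def)
    then show ?thesis by (auto simp: V_def)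
  qed
  have "v \<le> K" if "v \<in> V" for v
    using that K(1) by (auto simp: V_def) (metis mult_1)
  then have Vbdd: "bdd_above V" by (rule bdd_aboveI)
  define s where "s = Sup V"
  have s_upper1: "norm (R y) \<le> s" if "y \<in> M" "norm y = 1" for y
    unfolding s_def by (rule cSup_upper[OF _ Vbdd]) (use that in \<open>auto simp: V_def\<close>)
  have s_upper: "norm (R y) \<le> s * norm y" if "y \<in> M" for y
  proof (cases "y = 0")
    case False
    then show ?thesis
      using s_upper1[OF M_scale[OF that, of "inverse (norm y)"]] by (simp add: R.scaleR field_simps)
  qed (simp add: R.zero)
  have s0: "0 \<le> s"
  proof -
    obtain y where "y \<in> M" "norm y = 1" using Vne by (auto simp: V_def)
    then show ?thesis using s_upper1 norm_ge_zero order_trans by blast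
  qed
  have "\<exists>e. e \<in> M \<and> norm e = 1 \<and> R e = s *\<^sub>R e"
  proof (cases "s = 0")
    case True
    obtain e where e: "e \<in> M" "norm e = 1" using Vne by (auto simp: V_def)
    then show ?thesis using s_upper[of e] True by auto
  next
    case False
    then have "0 < s" using s0 by simp
    have "\<exists>x\<in>M. norm x = 1 \<and> s - inverse (real (Suc n)) < norm (R x)" for n
      using less_cSup_iff[OF Vne Vbdd, of "s - inverse (real (Suc n))"] by (auto simp: s_def V_def)
    then obtain x where x: "\<And>n. x n \<in> M" "\<And>n. norm (x n) = 1"
      "\<And>n. s - inverse (real (Suc n)) < norm (R (x n))" by metis
    have lim: "(\<lambda>n. norm (R (x n))) \<longlonglongrightarrow> s"
    proof (rule tendsto_sandwich[OF always_eventually always_eventually])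
      show "(\<lambda>n. s - inverse (real (Suc n))) \<longlonglongrightarrow> s"
        using tendsto_diff[OF tendsto_const LIMSEQ_inverse_real_of_nat, of s] by simp
      show "\<forall>n. s - inverse (real (Suc n)) \<le> norm (R (x n))" using x(3) less_imp_le by blast
      show "\<forall>n. norm (R (x n)) \<le> s" using s_upper1 x by blast
    qed simp
    have defect: "(\<lambda>n. R (R (x n)) - s\<^sup>2 *\<^sub>R x n) \<longlonglongrightarrow> 0"
    proof -
      have le: "norm (R (R (x n)) - s\<^sup>2 *\<^sub>R x n) \<le> sqrt (s\<^sup>2 * (s\<^sup>2 - (norm (R (x n)))\<^sup>2))" for n
      proof (rule real_le_rsqrt)
        have "(norm (R (R (x n)) - s\<^sup>2 *\<^sub>R x n))\<^sup>2
          = (norm (R (R (x n))))\<^sup>2 - 2 * s\<^sup>2 * inner (R (R (x n))) (x n) + (s\<^sup>2)\<^sup>2 * (norm (x n))\<^sup>2"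
          unfolding power2_norm_eq_inner
          by (simp add: inner_diff_left inner_diff_right inner_commute power2_eq_square algebra_simps)
        also have "inner (R (R (x n))) (x n) = (norm (R (x n)))\<^sup>2"
          using abs_sym[of "R (x n)" "x n"] by (simp add: power2_norm_eq_inner)
        also have "(norm (R (R (x n))))\<^sup>2 \<le> (s * norm (R (x n)))\<^sup>2"
          by (rule power_mono[OF s_upper[OF M_R[OF x(1)]]]) simp
        finally show "(norm (R (R (x n)) - s\<^sup>2 *\<^sub>R x n))\<^sup>2 \<le> s\<^sup>2 * (s\<^sup>2 - (norm (R (x n)))\<^sup>2)"
          using x(2)[of n] by (simp add: power2_eq_square algebra_simps)
      qed
      have "(\<lambda>n. sqrt (s\<^sup>2 * (s\<^sup>2 - (norm (R (x n)))\<^sup>2))) \<longlonglongrightarrow> sqrt (s\<^sup>2 * (s\<^sup>2 - s\<^sup>2))"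
        by (intro tendsto_intros lim)
      then have "(\<lambda>n. sqrt (s\<^sup>2 * (s\<^sup>2 - (norm (R (x n)))\<^sup>2))) \<longlonglongrightarrow> 0" by simp
      then show ?thesis
        by (rule Lim_null_comparison[rotated]) (use le in \<open>simp add: always_eventually\<close>)
    qed
    obtain r z where r: "strict_mono r" "(\<lambda>n. T (x (r n))) \<longlonglongrightarrow> z"
      using compact_op_subsequence[OF compT, of x] x(2) by metis
    \<comment> \<open>Compactness is known for \<open>T\<close> and passes to \<open>R\<close> because \<open>|R y| = |T y|\<close>.\<close>
    have "Cauchy (\<lambda>n. R (x (r n)))"
    proof (rule CauchyI)
      fix e :: real assume "0 < e"
      interpret T: bounded_linear T using symmetric_opD[OF selfadjointD(2)[OF T]] by simp
      obtain N where N: "\<And>m n. N \<le> m \<Longrightarrow> N \<le> n \<Longrightarrow> norm (T (x (r m)) - T (x (r n))) < e"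
        using CauchyD[OF LIMSEQ_imp_Cauchy[OF r(2)] \<open>0 < e\<close>] by blast
      have "norm (R (x (r m)) - R (x (r n))) = norm (T (x (r m)) - T (x (r n)))" for m n
        using abs_norm[of "x (r m) - x (r n)"] by (simp add: R.diff T.diff)
      then show "\<exists>N. \<forall>m\<ge>N. \<forall>n\<ge>N. norm (R (x (r m)) - R (x (r n))) < e" using N by metis
    qed
    then obtain w where w: "(\<lambda>n. R (x (r n))) \<longlonglongrightarrow> w"
      using Cauchy_convergent convergent_def by blast
    define e where "e = R w /\<^sub>R s\<^sup>2"
    have xe: "(\<lambda>n. x (r n)) \<longlonglongrightarrow> e"
    proof -
      have "(\<lambda>n. R (R (x (r n))) - (R (R (x (r n))) - s\<^sup>2 *\<^sub>R x (r n))) \<longlonglongrightarrow> R w - 0"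
        by (intro tendsto_diff R.tendsto w LIMSEQ_subseq_LIMSEQ[OF defect r(1), unfolded o_def])
      then have "(\<lambda>n. inverse (s\<^sup>2) *\<^sub>R (s\<^sup>2 *\<^sub>R x (r n))) \<longlonglongrightarrow> e"
        unfolding e_def by (intro tendsto_scaleR tendsto_const) simp
      then show ?thesis using \<open>0 < s\<close> by simp
    qed
    have "e \<in> M" by (rule closed_sequentially[OF M_closed _ xe]) (rule x(1))
    moreover have ne: "norm e = 1" using LIMSEQ_unique[OF tendsto_norm[OF xe]] x(2) by simp
    moreover have "R e = s *\<^sub>R e"
    proof -
      have "(\<lambda>n. R (R (x (r n))) - s\<^sup>2 *\<^sub>R x (r n)) \<longlonglongrightarrow> R (R e) - s\<^sup>2 *\<^sub>R e"
        by (intro tendsto_diff R.tendsto tendsto_scaleR tendsto_const xe)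
      then have sq: "R (R e) - s\<^sup>2 *\<^sub>R e = 0"
        using LIMSEQ_unique LIMSEQ_subseq_LIMSEQ[OF defect r(1), unfolded o_def] by blast
      define u where "u = R e - s *\<^sub>R e"
      have "R u = - (s *\<^sub>R u)"
        using sq by (simp add: u_def R.diff R.scaleR power2_eq_square algebra_simps)
      then have "s * inner u u \<le> 0" using abs_nonneg[of u] by simp
      then have "inner u u \<le> 0" using \<open>0 < s\<close> by (simp add: mult_le_0_iff)
      then have "inner u u = 0" using inner_ge_zero[of u] by (rule antisym)
      then have "u = 0" by simp
      then show ?thesis by (simp add: u_def)
    qed
    ultimately show ?thesis by blast
  qed
  then obtain e where "e \<in> M" "norm e = 1" "R e = s *\<^sub>R e" by blast
  then show ?thesis
    using s0 s_upper by (intro exI[of _ e] exI[of _ s]) (auto simp: M_def abs_norm R_def[symmetric])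
qed

text \<open>
  An orthonormal sequence of eigenvectors of \<open>op_abs T\<close> with decreasing eigenvalues.  The last clause
  says that the eigenvectors exhaust the part of the space on which \<open>T\<close> does not vanish, in a form
  that also gives the speed of approximation.  Zero eigenvalues are padded with unit vectors of the
  kernel, so that the sequence never stops.
\<close>

definition singular_system :: "('a::complex_hilbert \<Rightarrow> 'a) \<Rightarrow> (nat \<Rightarrow> 'a) \<Rightarrow> (nat \<Rightarrow> real) \<Rightarrow> bool" where
  "singular_system T e s \<longleftrightarrow>
     (\<forall>n. norm (e n) = 1) \<and> (\<forall>m n. m \<noteq> n \<longrightarrow> cinner (e m) (e n) = 0) \<and>
     (\<forall>n. op_abs T (e n) = s n *\<^sub>R e n) \<and> (\<forall>n. 0 \<le> s n) \<and> decseq s \<and> s \<longlonglongrightarrow> 0 \<and>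
     (\<forall>n y. (\<forall>i<n. cinner (e i) y = 0) \<longrightarrow> norm (T y) \<le> s n * norm y)"

lemma singular_systemD:
  assumes "singular_system T e s"
  shows "norm (e n) = 1" "op_abs T (e n) = s n *\<^sub>R e n" "0 \<le> s n" "decseq s" "s \<longlonglongrightarrow> 0"
    "(\<And>i. i < n \<Longrightarrow> cinner (e i) y = 0) \<Longrightarrow> norm (T y) \<le> s n * norm y"
  using assms by (simp_all add: singular_system_def)

lemma singular_system_cinner:
  assumes "singular_system T e s"
  shows "cinner (e m) (e n) = (if m = n then 1 else 0)"
proof -
  have "cinner (e n) (e n) = 1"
  proof -
    have "inner (e n) (e n) = 1"
      using singular_systemD(1)[OF assms, of n] by (simp add: norm_eq_sqrt_inner)
    moreover have "inner (\<i> *\<^sub>C e n) (e n) = 0"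
      using inner_ii[of "e n" "e n"] by (simp add: inner_commute)
    ultimately show ?thesis by (simp add: complex_eq_iff Im_cinner) (simp add: inner_cinner)
  qed
  then show ?thesis using assms by (simp add: singular_system_def)
qed

text \<open>
  The sequence is built greedily by \<open>top_eigenvector\<close>.  Its eigenvalues tend to \<open>0\<close>: otherwise the
  images \<open>T e\<^sub>n\<close> would keep a positive distance from each other, contradicting compactness.
\<close>

lemma compact_selfadjoint_singular_system:
  fixes T :: "'a::complex_hilbert \<Rightarrow> 'a"
  assumes T: "selfadjoint T" and compT: "compact_op T"
    and inf: "\<nexists>F :: 'a set. finite F \<and> cspan F = UNIV"
  shows "\<exists>e s. singular_system T e s"
proof -
  let ?R = "op_abs T"
  define good where "good E e s \<longleftrightarrow> norm e = 1 \<and> (\<forall>d\<in>E. cinner d e = 0) \<and> 0 \<le> s \<and> ?R e = s *\<^sub>R e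
    \<and> (\<forall>y. (\<forall>d\<in>E. cinner d y = 0) \<longrightarrow> norm (T y) \<le> s * norm y)" for E e s
  define nxt where "nxt E = (SOME e. \<exists>s. good E e s)" for E
  define Es where "Es = rec_nat {} (\<lambda>_ E. insert (nxt E) E)"
  have Es0: "Es 0 = {}" and EsSuc: "Es (Suc n) = insert (nxt (Es n)) (Es n)" for n
    by (simp_all add: Es_def)
  have step: "\<exists>s. good E (nxt E) s" if "finite E" "\<And>e. e \<in> E \<Longrightarrow> \<exists>s. ?R e = s *\<^sub>R e" for E
    unfolding nxt_def by (rule someI_ex) (use top_eigenvector[OF T compT inf that] in \<open>simp add: good_def\<close>)
  have inv: "finite (Es n) \<and> (\<forall>e\<in>Es n. \<exists>s. ?R e = s *\<^sub>R e)" for n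
  proof (induction n)
    case (Suc n)
    then obtain s where "good (Es n) (nxt (Es n)) s" using step by blast
    then show ?case using Suc by (auto simp: EsSuc good_def)
  qed (simp add: Es0)
  have "\<forall>n. \<exists>s. good (Es n) (nxt (Es n)) s" using step inv by blast
  then obtain s where s: "\<And>n. good (Es n) (nxt (Es n)) (s n)" by metis
  define e where "e n = nxt (Es n)" for n
  have Es_eq: "Es n = e ` {..<n}" for n
    by (induction n) (auto simp: Es0 EsSuc e_def lessThan_Suc)
  have norm_e: "norm (e n) = 1" and s0: "0 \<le> s n" and eig: "?R (e n) = s n *\<^sub>R e n"
    and orth_less: "i < n \<Longrightarrow> cinner (e i) (e n) = 0"
    and bound: "(\<And>i. i < n \<Longrightarrow> cinner (e i) y = 0) \<Longrightarrow> norm (T y) \<le> s n * norm y" for n i y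
    using s[of n, folded e_def] unfolding good_def Es_eq by auto
  have orth: "cinner (e m) (e n) = 0" if "m \<noteq> n" for m n
    using that orth_less[of m n] orth_less[of n m] cinner_commute[of "e m" "e n"]
    by (cases "m < n") auto
  have dec: "decseq s"
  proof (rule decseq_SucI)
    fix n
    have "norm (T (e (Suc n))) \<le> s n * norm (e (Suc n))" by (rule bound) (rule orth, simp)
    then show "s (Suc n) \<le> s n"
      using norm_op_abs[OF T, of "e (Suc n)"] s0[of "Suc n"] by (simp add: eig norm_e)
  qed
  obtain l where l: "s \<longlonglongrightarrow> l" "\<And>n. l \<le> s n"
    using decseq_convergent[OF dec, of 0] s0 by blast
  have "l = 0"
  proof (rule ccontr)
    assume "l \<noteq> 0"
    have "0 \<le> l" using LIMSEQ_le_const[OF l(1)] s0 by blast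
    then have "0 < l" using \<open>l \<noteq> 0\<close> by simp
    obtain r z where r: "strict_mono r" "(\<lambda>n. T (e (r n))) \<longlonglongrightarrow> z"
      using compact_op_subsequence[OF compT, of e] norm_e by metis
    obtain N where N: "\<And>m n. N \<le> m \<Longrightarrow> N \<le> n \<Longrightarrow> norm (T (e (r m)) - T (e (r n))) < l"
      using CauchyD[OF LIMSEQ_imp_Cauchy[OF r(2)] \<open>0 < l\<close>] by blast
    define m n where "m = r N" and "n = r (Suc N)"
    have "m \<noteq> n" using strict_monoD[OF r(1), of N "Suc N"] by (simp add: m_def n_def)
    interpret T: bounded_linear T using symmetric_opD[OF selfadjointD(2)[OF T]] by simp
    interpret R: bounded_linear "?R"
      using nonneg_opD(2)[OF nonneg_op_abs[OF T]] .
    have "norm (T (e m) - T (e n)) = norm (s m *\<^sub>R e m - s n *\<^sub>R e n)"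
      using norm_op_abs[OF T, of "e m - e n"] by (simp add: T.diff R.diff eig)
    moreover have "(s m)\<^sup>2 \<le> (norm (s m *\<^sub>R e m - s n *\<^sub>R e n))\<^sup>2"
    proof -
      have "inner (e m) (e n) = 0" using orth[OF \<open>m \<noteq> n\<close>] by (simp add: inner_cinner)
      then have "(norm (s m *\<^sub>R e m - s n *\<^sub>R e n))\<^sup>2 = (s m)\<^sup>2 * (norm (e m))\<^sup>2 + (s n)\<^sup>2 * (norm (e n))\<^sup>2"
        unfolding power2_norm_eq_inner
        by (simp add: inner_diff_left inner_diff_right inner_commute power2_eq_square algebra_simps)
      then show ?thesis by (simp add: norm_e)
    qed
    then have "s m \<le> norm (s m *\<^sub>R e m - s n *\<^sub>R e n)" by (rule power2_le_imp_le) simp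
    moreover have "norm (T (e m) - T (e n)) < l" unfolding m_def n_def by (rule N) auto
    ultimately show False using l(2)[of m] by simp
  qed
  then have "s \<longlonglongrightarrow> 0" using l by simp
  with norm_e orth eig s0 dec bound have "singular_system T e s"
    unfolding singular_system_def by simp
  then show ?thesis by blast
qed

text \<open>
  If \<open>s k > s' k\<close> at the first place where the sequences differ, the level \<open>t = s k\<close> is positive, and
  \<open>s'\<close> attains it only before \<open>k\<close>, where the sequences agree.  So \<open>s\<close> attains it at least once more
  than \<open>s'\<close>.
\<close>

lemma decseq_le_of_level_card:
  fixes s s' :: "nat \<Rightarrow> real"
  assumes "decseq s" "s \<longlonglongrightarrow> 0" "decseq s'" "s' \<longlonglongrightarrow> 0"
    and card: "\<And>t. 0 < t \<Longrightarrow> card {k. s k = t} = card {k. s' k = t}"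
    and below: "\<And>j. j < k \<Longrightarrow> s j = s' j"
  shows "s k \<le> s' k"
proof (rule ccontr)
  assume "\<not> s k \<le> s' k"
  then have less: "s' k < s k" by simp
  define t where "t = s k"
  have "0 \<le> s' k" using decseq_ge[OF assms(3,4)] .
  then have "0 < t" using less by (simp add: t_def)
  have "eventually (\<lambda>n. s n < t) sequentially" using assms(2) \<open>0 < t\<close> by (rule order_tendstoD)
  then obtain N where N: "\<And>n. N \<le> n \<Longrightarrow> s n < t" by (auto simp: eventually_sequentially)
  have fin: "finite {j. s j = t}"
    by (rule finite_subset[of _ "{..<N}"]) (use N in \<open>force simp: not_le[symmetric]\<close>, simp)
  have "{j. s' j = t} \<subset> {j. s j = t}"
  proof
    show "{j. s' j = t} \<subseteq> {j. s j = t}"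
    proof
      fix j assume j: "j \<in> {j. s' j = t}"
      have "j < k"
      proof (rule ccontr)
        assume "\<not> j < k"
        then have "s' j \<le> s' k" using decseqD[OF assms(3), of k j] by simp
        then show False using j less by (simp add: t_def)
      qed
      then show "j \<in> {j. s j = t}" using below j by simp
    qed
    have "k \<in> {j. s j = t}" "k \<notin> {j. s' j = t}" using less by (auto simp: t_def)
    then show "{j. s' j = t} \<noteq> {j. s j = t}" by blast
  qed
  then have "card {j. s' j = t} < card {j. s j = t}" by (rule psubset_card_mono[OF fin])
  then show False using card[OF \<open>0 < t\<close>] by simp
qed

lemma decseq_eq_of_level_card:
  fixes s s' :: "nat \<Rightarrow> real"
  assumes s: "decseq s" "s \<longlonglongrightarrow> 0" and s': "decseq s'" "s' \<longlonglongrightarrow> 0"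
    and card: "\<And>t. 0 < t \<Longrightarrow> card {k. s k = t} = card {k. s' k = t}"
  shows "s = s'"
proof
  fix k show "s k = s' k"
  proof (induction k rule: less_induct)
    case (less k)
    show ?case
      using decseq_le_of_level_card[OF s s' card less.IH]
        decseq_le_of_level_card[OF s' s card[symmetric] less.IH[symmetric]] by (rule antisym)
  qed
qed

text \<open>
  The eigenspace of \<open>op_abs T\<close> for \<open>t > 0\<close> is spanned by the \<open>e n\<close> with \<open>s n = t\<close>.  The component of
  an eigenvector orthogonal to these is orthogonal to all \<open>e n\<close>, thus annihilated by \<open>T\<close>, and it is
  also multiplied by \<open>t\<close>.  Therefore it is \<open>0\<close>.
\<close>

lemma singular_number_eq:
  fixes T :: "'a::complex_hilbert \<Rightarrow> 'a"
  assumes T: "selfadjoint T" and sys: "singular_system T e s"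
  shows "singular_number T = s"
proof -
  note eig = singular_systemD(2)[OF sys] and s = singular_systemD(4,5)[OF sys]
    and bound = singular_systemD(6)[OF sys] and e_inner = singular_system_cinner[OF sys]
  let ?R = "op_abs T"
  note Rc = op_abs_scaleC[OF T] and Rsym = cinner_op_abs[OF T]
  interpret R: bounded_linear ?R using nonneg_opD(2)[OF nonneg_op_abs[OF T]] .
  have "inj e" using e_inner by (metis injI zero_neq_one)
  have level: "card {k. s k = t} = cdim {x. ?R x = complex_of_real t *\<^sub>C x}" if "0 < t" for t
  proof -
    define V where "V = {x. ?R x = complex_of_real t *\<^sub>C x}"
    define K where "K = {k. s k = t}"
    have "eventually (\<lambda>n. s n < t) sequentially" using s(2) \<open>0 < t\<close> by (rule order_tendstoD)
    then obtain N where N: "\<And>n. N \<le> n \<Longrightarrow> s n < t" by (auto simp: eventually_sequentially)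
    have fK: "finite K"
      unfolding K_def
      by (rule finite_subset[of _ "{..<N}"]) (use N in \<open>force simp: not_le[symmetric]\<close>, simp)
    have sub: "e ` K \<subseteq> V" by (auto simp: V_def K_def eig scaleR_scaleC)
    have "complex_vector.subspace V"
      unfolding complex_vector.subspace_def V_def
      by (auto simp: R.add R.zero Rc scaleC_add_right scaleC_scaleC mult.commute
          complex_vector.scale_zero_right)
    then have 1: "cspan (e ` K) \<subseteq> V" using sub by (rule complex_vector.span_minimal[rotated])
    have 2: "V \<subseteq> cspan (e ` K)"
    proof
      fix x assume x: "x \<in> V"
      define p where "p = (\<Sum>k\<in>K. cinner (e k) x *\<^sub>C e k)"
      have p: "p \<in> cspan (e ` K)"
        unfolding p_def
        by (intro complex_vector.span_sum complex_vector.span_scale complex_vector.span_base imageI)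
      then have "p \<in> V" using 1 by blast
      have "cinner (e n) (x - p) = 0" for n
      proof -
        have "cinner (e n) p = (\<Sum>k\<in>K. if n = k then cinner (e k) x else 0)"
          unfolding p_def cinner_sum_scaleC by (rule sum.cong) (auto simp: e_inner)
        then have ep: "cinner (e n) p = (if n \<in> K then cinner (e n) x else 0)" using fK by simp
        have "cinner (e n) x = 0" if "n \<notin> K"
        proof -
          have "complex_of_real t * cinner (e n) x = cinner (e n) (?R x)"
            using x by (simp add: V_def cinner_scaleC_right)
          also have "\<dots> = complex_of_real (s n) * cinner (e n) x"
            by (simp add: Rsym[symmetric] eig scaleR_scaleC cinner_scaleC_left)
          finally have "(complex_of_real t - complex_of_real (s n)) * cinner (e n) x = 0"
            by (simp add: left_diff_distrib)
          then show ?thesis using that by (simp add: K_def flip: of_real_diff)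
        qed
        then show ?thesis
          using ep by (auto simp: bounded_linear.linear[OF bounded_linear_cinner_right] linear_diff)
      qed
      then have le: "norm (T (x - p)) \<le> s n * norm (x - p)" for n by (intro bound)
      have "norm (T (x - p)) \<le> 0 * norm (x - p)"
        by (rule LIMSEQ_le_const[OF tendsto_mult[OF s(2) tendsto_const]]) (use le in blast)
      then have "?R (x - p) = 0" using norm_op_abs[OF T, of "x - p"] by simp
      moreover have "?R (x - p) = t *\<^sub>R (x - p)"
        using x \<open>p \<in> V\<close> by (simp add: V_def R.diff scaleR_scaleC[symmetric] scaleR_right_diff_distrib)
      ultimately have "x = p" using \<open>0 < t\<close> by simp
      then show "x \<in> cspan (e ` K)" using p by simp
    qed
    have ind: "\<not> cdependent (e ` K)"
    proof
      assume "cdependent (e ` K)"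
      then obtain u v where u: "v \<in> e ` K" "u v \<noteq> 0" "(\<Sum>w\<in>e ` K. u w *\<^sub>C w) = 0"
        using complex_vector.dependent_finite[of "e ` K"] fK by auto
      obtain k where k: "k \<in> K" "v = e k" using u(1) by blast
      have "(\<Sum>w\<in>e ` K. u w *\<^sub>C w) = (\<Sum>j\<in>K. u (e j) *\<^sub>C e j)"
        by (rule sum.reindex_cong[of e]) (use \<open>inj e\<close> in \<open>auto intro: inj_on_subset\<close>)
      then have "cinner (e k) (\<Sum>j\<in>K. u (e j) *\<^sub>C e j) = cinner (e k) 0" using u(3) by simp
      then have "(\<Sum>j\<in>K. u (e j) * cinner (e k) (e j)) = 0"
        by (simp add: cinner_sum_scaleC linear_0[OF bounded_linear.linear[OF bounded_linear_cinner_right]])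
      moreover have "(\<Sum>j\<in>K. u (e j) * cinner (e k) (e j)) = (\<Sum>j\<in>K. if k = j then u (e j) else 0)"
        by (rule sum.cong) (auto simp: e_inner)
      ultimately show False using u(2) k fK by simp
    qed
    have "cspan (e ` K) = cspan V" using 1 2 by (metis antisym complex_vector.span_span)
    then have "cdim V = card (e ` K)" using ind by (rule complex_vector.dim_eq_card)
    also have "\<dots> = card K" using \<open>inj e\<close> by (intro card_image) (auto intro: inj_on_subset)
    finally show ?thesis by (simp add: V_def K_def)
  qed
  show ?thesis
    unfolding singular_number_def
  proof (rule the_equality)
    show "decseq s \<and> s \<longlonglongrightarrow> 0 \<and> (\<forall>t>0. card {k. s k = t} = cdim {x. ?R x = complex_of_real t *\<^sub>C x})"
      using s level by blast
    fix s' assume "decseq s' \<and> s' \<longlonglongrightarrow> 0 \<and>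
      (\<forall>t>0. card {k. s' k = t} = cdim {x. ?R x = complex_of_real t *\<^sub>C x})"
    then show "s' = s" using s level by (intro decseq_eq_of_level_card) auto
  qed
qed

section \<open>Trace class operators as sums of real rank-one operators\<close>

lemma sums_interleave:
  fixes f g :: "nat \<Rightarrow> real"
  assumes "f sums a" "g sums b"
  shows "(\<lambda>n. if even n then f (n div 2) else g ((n - 1) div 2)) sums (a + b)"
  using sums_if[OF assms(2,1)] by (simp add: add.commute)

text \<open>
  The complex expansion is \<open>T y = \<Sum> cinner (e n) y *\<^sub>C T (e n)\<close>, with \<open>|T (e n)| = s n\<close>.  A complex
  rank-one operator \<open>a b\<^sup>*\<close> is the sum of the two real rank-one operators given by the pairs \<open>(a, b)\<close>
  and \<open>(\<i> a, \<i> b)\<close>.  Listing them alternately doubles the sum of the singular numbers.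
\<close>

lemma compact_selfadjoint_real_nuclear:
  fixes T :: "'a::complex_hilbert \<Rightarrow> 'a"
  assumes T: "selfadjoint T" and sys: "singular_system T e s" and ssum: "summable s"
  obtains u v where "(\<lambda>n. (norm (u n))\<^sup>2) sums (2 * suminf s)" "(\<lambda>n. (norm (v n))\<^sup>2) sums (2 * suminf s)"
    "\<And>x y. (\<lambda>n. inner x (u n) * inner (v n) y) sums inner x (T y)"
proof -
  note e = singular_systemD(1)[OF sys] and eig = singular_systemD(2)[OF sys]
    and s = singular_systemD(3,5)[OF sys] ssum
    and bound = singular_systemD(6)[OF sys] and e_inner = singular_system_cinner[OF sys]
  interpret T: bounded_linear T using symmetric_opD[OF selfadjointD(2)[OF T]] by simp
  have Tc: "T (c *\<^sub>C x) = c *\<^sub>C T x" for c x by (rule selfadjointD(3)[OF T])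
  have nT: "norm (T (e n)) = s n" for n
    using norm_op_abs[OF T, of "e n"] s(1)[of n] by (simp add: eig e)
  \<comment> \<open>The weight \<open>s n\<close> is split evenly between the two factors.  If \<open>s n = 0\<close>, then \<open>T (e n) = 0\<close>
      and \<open>inverse 0 = 0\<close> is the right value.\<close>
  define U where "U n = inverse (sqrt (s n)) *\<^sub>R T (e n)" for n
  define W where "W n = sqrt (s n) *\<^sub>R e n" for n
  have nU: "(norm (U n))\<^sup>2 = s n" and nW: "(norm (W n))\<^sup>2 = s n" for n
  proof -
    have "(inverse (sqrt (s n)) * s n)\<^sup>2 = s n"
      using s(1)[of n] by (cases "s n = 0") (auto simp: power_mult_distrib power_inverse power2_eq_square[of "s n"])
    then show "(norm (U n))\<^sup>2 = s n" using s(1)[of n] by (simp add: U_def nT)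
    show "(norm (W n))\<^sup>2 = s n" using s(1)[of n] by (simp add: W_def e)
  qed
  have UW: "inner x (U n) * inner (W n) y = inner x (T (e n)) * inner (e n) y" for n x y
  proof (cases "s n = 0")
    case True
    then show ?thesis using nT[of n] by (simp add: U_def)
  next
    case False
    then show ?thesis by (simp add: U_def W_def)
  qed
  define u where "u n = (if even n then U (n div 2) else \<i> *\<^sub>C U ((n - 1) div 2))" for n
  define v where "v n = (if even n then W (n div 2) else \<i> *\<^sub>C W ((n - 1) div 2))" for n
  have nu: "(norm (u n))\<^sup>2 = (if even n then s (n div 2) else s ((n - 1) div 2))"
    and nv: "(norm (v n))\<^sup>2 = (if even n then s (n div 2) else s ((n - 1) div 2))" for n
    by (simp_all add: u_def v_def norm_ii nU nW)
  have tsum: "(\<lambda>n. if even n then s (n div 2) else s ((n - 1) div 2)) sums (2 * suminf s)"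
    using sums_interleave[OF summable_sums[OF s(3)] summable_sums[OF s(3)]] by simp
  have ii_scale: "\<i> *\<^sub>C (r *\<^sub>R z) = r *\<^sub>R (\<i> *\<^sub>C z)" for r and z :: 'a
    by (simp add: scaleR_scaleC scaleC_scaleC mult.commute)
  have iUW: "inner x (\<i> *\<^sub>C U n) * inner (\<i> *\<^sub>C W n) y
      = inner x (\<i> *\<^sub>C T (e n)) * inner (\<i> *\<^sub>C e n) y" for n x y
  proof (cases "s n = 0")
    case True
    then have "norm (\<i> *\<^sub>C T (e n)) = 0" using nT[of n] by (simp only: norm_ii)
    then have "\<i> *\<^sub>C T (e n) = 0" by simp
    then show ?thesis using True by (simp add: W_def U_def ii_scale)
  next
    case False
    then show ?thesis by (simp add: U_def W_def ii_scale)
  qed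
  have csums: "(\<lambda>n. cinner (e n) y *\<^sub>C T (e n)) sums T y" for y
  proof -
    define p where "p n = (\<Sum>i<n. cinner (e i) y *\<^sub>C e i)" for n
    note clin = bounded_linear.linear[OF bounded_linear_cinner_right]
    have csum: "cinner z (p n) = (\<Sum>i<n. cinner (e i) y * cinner z (e i))" for z n
      unfolding p_def by (rule cinner_sum_scaleC)
    have orth: "cinner (e i) (y - p n) = 0" if "i < n" for i n
    proof -
      have "cinner (e i) (p n) = (\<Sum>j<n. if i = j then cinner (e j) y else 0)"
        unfolding csum by (rule sum.cong) (auto simp: e_inner)
      then show ?thesis using that by (simp add: linear_diff[OF clin])
    qed
    have le: "norm (y - p n) \<le> norm y" for n
    proof -
      have "cinner (y - p n) (p n) = (\<Sum>i<n. cinner (e i) y * cinner (y - p n) (e i))"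
        by (rule csum)
      also have "\<dots> = 0"
        using orth cinner_commute[of "y - p n"] by (intro sum.neutral) simp
      finally have "inner (y - p n) (p n) = 0" by (simp add: inner_cinner)
      then have "norm (y - p n) * norm (y - p n) = inner (y - p n) y"
        by (simp add: power2_norm_eq_inner[unfolded power2_eq_square] inner_diff_right)
      also have "\<dots> \<le> norm (y - p n) * norm y" by (rule norm_cauchy_schwarz)
      finally show ?thesis by (cases "y = p n") auto
    qed
    have "norm (T (y - p n)) \<le> s n * norm y" for n
    proof -
      have "norm (T (y - p n)) \<le> s n * norm (y - p n)" by (rule bound) (rule orth)
      also have "\<dots> \<le> s n * norm y" by (rule mult_left_mono[OF le s(1)])
      finally show ?thesis .
    qed
    moreover have "(\<lambda>n. s n * norm y) \<longlonglongrightarrow> 0" using tendsto_mult[OF s(2) tendsto_const] by simp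
    ultimately have "(\<lambda>n. T (y - p n)) \<longlonglongrightarrow> 0"
      by (intro Lim_null_comparison[of "\<lambda>n. T (y - p n)" "\<lambda>n. s n * norm y"]) auto
    then have "(\<lambda>n. T y - T (y - p n)) \<longlonglongrightarrow> T y - 0" by (intro tendsto_diff tendsto_const)
    moreover have "T y - T (y - p n) = (\<Sum>i<n. cinner (e i) y *\<^sub>C T (e i))" for n
      by (simp add: T.diff p_def T.sum Tc)
    ultimately show ?thesis by (simp add: sums_def)
  qed
  have "(\<lambda>n. inner x (u n) * inner (v n) y) sums inner x (T y)" for x y
  proof -
    have abs_summable: "summable (\<lambda>n. inner x (f n) * inner (g n) y)"
      if "\<And>n. norm (f n) = s n" "\<And>n. norm (g n) = 1" for f g
    proof (rule summable_comparison_test'[OF summable_mult[OF s(3), of "norm x * norm y"]])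
      fix n
      have "norm (inner x (f n) * inner (g n) y) \<le> (norm x * s n) * (1 * norm y)"
        using Cauchy_Schwarz_ineq2[of x "f n"] Cauchy_Schwarz_ineq2[of "g n" y] s(1)[of n]
        unfolding norm_mult real_norm_def that abs_mult by (intro mult_mono) auto
      then show "norm (inner x (f n) * inner (g n) y) \<le> norm x * norm y * s n"
        by (simp add: mult.commute mult.left_commute)
    qed
    define f where "f n = inner x (T (e n)) * inner (e n) y" for n
    define g where "g n = inner x (\<i> *\<^sub>C T (e n)) * inner (\<i> *\<^sub>C e n) y" for n
    have fg: "summable f" "summable g"
      unfolding f_def g_def by (rule abs_summable; simp add: nT e norm_ii)+
    have "inner x (cinner (e n) y *\<^sub>C T (e n)) = f n + g n" for n
      unfolding scaleC_decompose[of "cinner (e n) y"] f_def g_def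
      by (simp add: inner_add_right inner_cinner[symmetric] Im_cinner mult.commute)
    then have "(\<lambda>n. f n + g n) sums inner x (T y)"
      using bounded_linear.sums[OF bounded_linear_inner_right csums[of y], of x] by simp
    then have "suminf f + suminf g = inner x (T y)"
      using sums_add[OF summable_sums[OF fg(1)] summable_sums[OF fg(2)]] by (rule sums_unique2[symmetric])
    then have "(\<lambda>n. if even n then f (n div 2) else g ((n - 1) div 2)) sums inner x (T y)"
      using sums_interleave[OF summable_sums[OF fg(1)] summable_sums[OF fg(2)]] by simp
    moreover have "inner x (u n) * inner (v n) y = (if even n then f (n div 2) else g ((n - 1) div 2))" for n
      by (simp add: u_def v_def f_def g_def UW iUW)
    ultimately show ?thesis by simp
  qed
  then show thesis using tsum by (intro that[of u v]) (simp_all add: nu nv)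
qed

section \<open>Singular numbers from finite-codimensional bounds\<close>

text \<open>
  For a finite orthonormal set, this compact set contains the unit ball of the span.
\<close>

lemma compact_unit_cube_image:
  fixes O' :: "'a::real_normed_vector set"
  assumes "finite O'"
  shows "compact {\<Sum>w\<in>O'. c w *\<^sub>R w | c. \<forall>w\<in>O'. \<bar>c w\<bar> \<le> (1::real)}"
  using assms
proof (induction O')
  case (insert z O')
  let ?S = "{\<Sum>w\<in>O'. c w *\<^sub>R w | c. \<forall>w\<in>O'. \<bar>c w\<bar> \<le> (1::real)}"
  have "compact ((\<lambda>p. fst p *\<^sub>R z + snd p) ` ({-1..1::real} \<times> ?S))"
    using insert.IH by (intro compact_continuous_image compact_Times continuous_intros) auto
  moreover have "(\<lambda>p. fst p *\<^sub>R z + snd p) ` ({-1..1::real} \<times> ?S)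
      = {\<Sum>w\<in>insert z O'. c w *\<^sub>R w | c. \<forall>w\<in>insert z O'. \<bar>c w\<bar> \<le> (1::real)}" (is "?L = ?R")
  proof
    show "?L \<subseteq> ?R"
    proof
      fix x assume "x \<in> ?L"
      then obtain a c where ac: "\<bar>a\<bar> \<le> 1" "\<forall>w\<in>O'. \<bar>c w\<bar> \<le> 1" "x = a *\<^sub>R z + (\<Sum>w\<in>O'. c w *\<^sub>R w)"
        by (auto simp: abs_le_iff)
      have "(\<Sum>w\<in>O'. (c(z := a)) w *\<^sub>R w) = (\<Sum>w\<in>O'. c w *\<^sub>R w)"
        by (rule sum.cong) (use insert.hyps in auto)
      then show "x \<in> ?R"
        using ac insert.hyps by (intro CollectI exI[of _ "c(z := a)"]) auto
    qed
    show "?R \<subseteq> ?L"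
    proof
      fix x assume "x \<in> ?R"
      then obtain c where c: "\<forall>w\<in>insert z O'. \<bar>c w\<bar> \<le> 1" "x = (\<Sum>w\<in>insert z O'. c w *\<^sub>R w)"
        by blast
      then have "x = fst (c z, \<Sum>w\<in>O'. c w *\<^sub>R w) *\<^sub>R z + snd (c z, \<Sum>w\<in>O'. c w *\<^sub>R w)"
        using insert.hyps by simp
      moreover have "(c z, \<Sum>w\<in>O'. c w *\<^sub>R w) \<in> {-1..1} \<times> ?S" using c(1) by (auto simp: abs_le_iff)
      ultimately show "x \<in> ?L" by blast
    qed
  qed
  ultimately show ?case by simp
qed simp

text \<open>
  Up to an error that is small in norm, \<open>D\<close> factors through the projection onto a finite-dimensional
  subspace, so the image of the unit ball is totally bounded.
\<close>

lemma compact_op_of_small_finite_codimension: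
  fixes D :: "'a::complex_hilbert \<Rightarrow> 'a"
  assumes D: "bounded_clinear D"
    and small: "\<And>t. 0 < t \<Longrightarrow> \<exists>F. finite F \<and> (\<forall>y. (\<forall>f\<in>F. inner f y = 0) \<longrightarrow> norm (D y) \<le> t * norm y)"
  shows "compact_op D"
proof -
  have Dlin: "bounded_linear D" using D by (simp add: bounded_clinear_def)
  interpret D: bounded_linear D by fact
  let ?K = "closure (D ` cball 0 1)"
  have "\<exists>k. finite k \<and> ?K \<subseteq> (\<Union>x\<in>k. ball x \<epsilon>)" if "0 < \<epsilon>" for \<epsilon>
  proof -
    have "0 < \<epsilon> / 8" using that by simp
    then obtain F where F: "finite F" "\<And>y. (\<forall>f\<in>F. inner f y = 0) \<Longrightarrow> norm (D y) \<le> \<epsilon> / 8 * norm y"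
      using small by metis
    obtain O' where O: "orthonormal O'" "F \<subseteq> span O'"
      using orthonormal_extension[of "{}" F] F(1) by (auto simp: orthonormal_def)
    define S where "S = {\<Sum>w\<in>O'. c w *\<^sub>R w | c. \<forall>w\<in>O'. \<bar>c w\<bar> \<le> (1::real)}"
    have "compact S"
      unfolding S_def using O(1) by (intro compact_unit_cube_image) (simp add: orthonormal_def)
    then have "compact (D ` S)"
      by (intro compact_continuous_image linear_continuous_on Dlin)
    then obtain k where k: "finite k" "D ` S \<subseteq> (\<Union>x\<in>k. ball x (\<epsilon> / 4))"
      using compact_eq_totally_bounded[of "D ` S"] \<open>0 < \<epsilon>\<close> by (metis divide_pos_pos zero_less_numeral)
    have "D ` cball 0 1 \<subseteq> (\<Union>x\<in>k. cball x (\<epsilon> / 2))"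
    proof
      fix z assume "z \<in> D ` cball 0 1"
      then obtain y where y: "norm y \<le> 1" "z = D y" by auto
      define p where "p = proj_on O' y"
      have "p \<in> S"
      proof -
        have "\<bar>inner w y\<bar> \<le> 1" if "w \<in> O'" for w
          using Cauchy_Schwarz_ineq2[of w y] y(1) O(1) that by (simp add: orthonormal_def)
        then show ?thesis
          unfolding S_def p_def proj_on_def by (intro CollectI exI[of _ "\<lambda>w. inner w y"]) auto
      qed
      then obtain x where x: "x \<in> k" "dist x (D p) < \<epsilon> / 4" using k(2) by auto
      have "inner f (y - p) = 0" if "f \<in> F" for f
      proof -
        have "orthogonal (y - p) f"
        proof (rule orthogonal_to_span)
          show "f \<in> span O'" using O(2) that by blast
          show "orthogonal (y - p) w" if "w \<in> O'" for w
            using inner_proj_on[OF O(1) that, of y]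
            by (simp add: p_def orthogonal_def inner_diff_left inner_diff_right inner_commute)
        qed
        then show ?thesis by (simp add: orthogonal_def inner_commute)
      qed
      then have "norm (D (y - p)) \<le> \<epsilon> / 8 * norm (y - p)" by (intro F(2)) blast
      also have "\<dots> \<le> \<epsilon> / 8 * 2"
        using norm_triangle_ineq4[of y p] norm_proj_on_le[OF O(1), of y] y(1) \<open>0 < \<epsilon>\<close>
        by (intro mult_left_mono) (auto simp: p_def)
      finally have "dist (D p) z \<le> \<epsilon> / 4"
        by (simp add: y(2) dist_norm norm_minus_commute D.diff)
      then have "dist x z \<le> \<epsilon> / 2" using x(2) dist_triangle[of x z "D p"] by linarith
      then show "z \<in> (\<Union>x\<in>k. cball x (\<epsilon> / 2))" using x(1) by auto
    qed
    then have "?K \<subseteq> (\<Union>x\<in>k. cball x (\<epsilon> / 2))"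
      using k(1) by (intro closure_minimal closed_UN) auto
    also have "\<dots> \<subseteq> (\<Union>x\<in>k. ball x \<epsilon>)" using \<open>0 < \<epsilon>\<close> by (intro UN_mono) auto
    finally show ?thesis using k(1) by blast
  qed
  then have "compact ?K" by (simp add: compact_eq_totally_bounded complete_eq_closed)
  then show ?thesis using D by (simp add: compact_op_def)
qed

text \<open>
  A linear map into the span of \<open>F\<close> whose kernel is the orthogonal complement of \<open>F\<close> cannot be
  injective on the span of \<open>E\<close>, which has larger dimension.
\<close>

lemma exists_span_vector_orthogonal:
  fixes E F :: "'a::real_inner set"
  assumes E: "orthonormal E" and F: "finite F" "card F < card E"
  obtains y where "y \<in> span E" "y \<noteq> 0" "\<And>f. f \<in> F \<Longrightarrow> inner f y = 0"
proof -
  obtain C where C: "finite C" "card C \<le> card F" "span C = span F" "pairwise orthogonal C"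
    using basis_orthogonal[OF F(1)] by blast
  define \<pi> where "\<pi> y = (\<Sum>c\<in>C. inner c y *\<^sub>R c)" for y
  have \<pi>: "linear \<pi>"
    by (rule linearI)
      (simp_all add: \<pi>_def inner_add_right scaleR_left_distrib sum.distrib scaleR_sum_right)
  have indE: "independent E"
    by (rule pairwise_orthogonal_independent) (use E in \<open>auto simp: orthonormal_def\<close>)
  have "\<not> inj_on \<pi> (span E)"
  proof
    assume inj: "inj_on \<pi> (span E)"
    then have "independent (\<pi> ` E)" by (rule linear_independent_injective_image[OF \<pi> indE])
    moreover have "\<pi> ` E \<subseteq> span C"
      unfolding \<pi>_def by (intro image_subsetI span_sum span_scale span_base)
    ultimately have "card (\<pi> ` E) \<le> card C"
      using independent_span_bound[OF C(1)] by blast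
    moreover have "card (\<pi> ` E) = card E"
      using inj span_superset by (intro card_image) (rule inj_on_subset)
    ultimately show False using C(2) F(2) by simp
  qed
  then obtain x x' where x: "x \<in> span E" "x' \<in> span E" "\<pi> x = \<pi> x'" "x \<noteq> x'"
    by (auto simp: inj_on_def)
  define y where "y = x - x'"
  have "\<pi> y = 0" using x(3) by (simp add: y_def linear_diff[OF \<pi>])
  have cy: "inner c y = 0" if "c \<in> C" for c
  proof -
    have "0 = inner c (\<pi> y)" by (simp add: \<open>\<pi> y = 0\<close>)
    also have "\<dots> = (\<Sum>d\<in>C. if c = d then inner c y * inner c c else 0)"
      unfolding \<pi>_def inner_sum_right
      by (rule sum.cong) (use C(4) that in \<open>auto simp: pairwise_def orthogonal_def\<close>)
    also have "\<dots> = inner c y * inner c c" using C(1) that by simp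
    finally show ?thesis by auto
  qed
  show thesis
  proof (rule that)
    show "y \<in> span E" unfolding y_def by (rule span_diff[OF x(1,2)])
    show "y \<noteq> 0" using x(4) by (simp add: y_def)
    fix f assume "f \<in> F"
    then have "f \<in> span C" using C(3) span_base by blast
    then have "orthogonal y f"
      by (rule orthogonal_to_span) (use cy in \<open>simp add: orthogonal_def inner_commute\<close>)
    then show "inner f y = 0" by (simp add: orthogonal_def inner_commute)
  qed
qed

text \<open>
  One half of the min-max principle: the span of \<open>e 0\<close>, ..., \<open>e k\<close> contains a nonzero vector \<open>y\<close>
  orthogonal to the at most \<open>k\<close> vectors of \<open>F\<close>, and on this span \<open>|T y| \<ge> s k * |y|\<close>.  Real
  combinations suffice, because their dimension \<open>k + 1\<close> already exceeds the size of \<open>F\<close>.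
\<close>

lemma eigenvalue_le_of_small_finite_codimension:
  fixes T :: "'a::complex_hilbert \<Rightarrow> 'a"
  assumes T: "selfadjoint T" and sys: "singular_system T e s" and F: "finite F" "card F \<le> k" and small: "\<And>y. (\<And>f. f \<in> F \<Longrightarrow> inner f y = 0) \<Longrightarrow> norm (T y) \<le> c * norm y"
  shows "s k \<le> c"
proof -
  note e = singular_systemD(1)[OF sys] and eig = singular_systemD(2)[OF sys]
    and s = singular_systemD(4)[OF sys]
  let ?R = "op_abs T"
  interpret R: bounded_linear ?R
    using nonneg_opD(2)[OF nonneg_op_abs[OF T]] .
  have e0: "inner (e m) (e n) = 0" if "m \<noteq> n" for m n using singular_system_cinner[OF sys, of m n] that by (simp add: inner_cinner)
  have inj: "inj e"
  proof (rule injI, rule ccontr)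
    fix m n assume "e m = e n" "m \<noteq> n"
    then have "inner (e m) (e m) = 0" using e0[of m n] by simp
    then show False using e[of m] by simp
  qed
  define E where "E = e ` {..k}"
  have E: "orthonormal E"
    unfolding orthonormal_def E_def pairwise_def orthogonal_def using e e0 by (auto, metis)
  have "card E = Suc k" unfolding E_def using inj by (subst card_image) (auto intro: inj_on_subset)
  then obtain y where y: "y \<in> span E" "y \<noteq> 0" "\<And>f. f \<in> F \<Longrightarrow> inner f y = 0"
    using exists_span_vector_orthogonal[OF E F(1)] F(2) by (metis le_imp_less_Suc)
  have y_eq: "y = (\<Sum>w\<in>E. inner w y *\<^sub>R w)"
    using proj_on_eq_self[OF E y(1)] by (simp add: proj_on_def)
  have low: "s k * (inner w y)\<^sup>2 \<le> inner w y * inner y (?R w)" if wE: "w \<in> E" for w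
  proof -
    obtain n where n: "n \<le> k" "w = e n" using wE by (auto simp: E_def)
    have "s k \<le> s n" using decseqD[OF s n(1)] .
    then have "s k * (inner w y)\<^sup>2 \<le> s n * (inner w y)\<^sup>2" by (rule mult_right_mono) simp
    then show ?thesis by (simp add: n(2) eig power2_eq_square inner_commute mult.commute mult.left_commute)
  qed
  have "s k * (norm y)\<^sup>2 = (\<Sum>w\<in>E. s k * (inner w y)\<^sup>2)"
  proof -
    have "(norm y)\<^sup>2 = inner y (\<Sum>w\<in>E. inner w y *\<^sub>R w)"
      using y_eq by (simp add: power2_norm_eq_inner)
    also have "\<dots> = (\<Sum>w\<in>E. (inner w y)\<^sup>2)"
      by (simp add: inner_sum_right power2_eq_square inner_commute)
    finally show ?thesis by (simp add: sum_distrib_left)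
  qed
  also have "\<dots> \<le> (\<Sum>w\<in>E. inner w y * inner y (?R w))" by (rule sum_mono) (rule low)
  also have "\<dots> = inner y (?R (\<Sum>w\<in>E. inner w y *\<^sub>R w))"
    by (simp add: R.sum R.scaleR inner_sum_right)
  also have "\<dots> = inner y (?R y)" using y_eq by simp
  also have "\<dots> \<le> norm y * norm (?R y)" by (rule norm_cauchy_schwarz)
  also have "\<dots> \<le> norm y * (c * norm y)"
    using small[OF y(3)] by (intro mult_left_mono) (simp_all add: norm_op_abs[OF T])
  finally have "s k * (norm y)\<^sup>2 \<le> c * (norm y)\<^sup>2" by (simp add: power2_eq_square mult.commute mult.left_commute)
  then show ?thesis using y(2) by simp
qed

section \<open>The weak trace class estimate\<close>

text \<open>
  The constant is the 8 of \<open>coercive_abs_diff_weak_bound\<close> times 4, because the two families of the real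
  expansion of \<open>A - B\<close> each have square sum twice the trace norm.
\<close>

lemma abs_difference_weak_trace_bound:
  fixes A B :: "'a::complex_hilbert \<Rightarrow> 'a"
  assumes inf: "\<nexists>F :: 'a set. finite F \<and> cspan F = UNIV"
    and A: "selfadjoint A" and B: "selfadjoint B" and C: "trace_class (\<lambda>x. A x - B x)"
  shows "compact_op (\<lambda>x. op_abs A x - op_abs B x)"
    and "real (k + 1) * singular_number (\<lambda>x. op_abs A x - op_abs B x) k
      \<le> 32 * trace_norm (\<lambda>x. A x - B x)"
    and "0 \<le> trace_norm (\<lambda>x. A x - B x)"
proof -
  let ?C = "\<lambda>x. A x - B x" and ?D = "\<lambda>x. op_abs A x - op_abs B x"
  note a = symmetric_opD[OF selfadjointD(2)[OF A]] and b = symmetric_opD[OF selfadjointD(2)[OF B]]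
  have ii_diff: "\<i> *\<^sub>C (x - y) = \<i> *\<^sub>C x - \<i> *\<^sub>C y" for x y :: 'a
    by (rule linear_diff[OF bounded_linear.linear[OF bounded_linear_ii]])
  have Csa: "selfadjoint ?C"
  proof (rule selfadjointI)
    show "symmetric_op ?C"
      unfolding symmetric_op_def
      by (intro conjI allI bounded_linear_sub a(1) b(1))
        (simp add: inner_diff_left inner_diff_right a(2) b(2))
  qed (simp add: selfadjointD(3)[OF A] selfadjointD(3)[OF B] ii_diff)
  note nA = nonneg_op_abs[OF A] and nB = nonneg_op_abs[OF B]
  note ra = nonneg_opD[OF nA] and rb = nonneg_opD[OF nB]
  have Dsa: "selfadjoint ?D"
  proof (rule selfadjointI)
    show "symmetric_op ?D"
      unfolding symmetric_op_def
      by (intro conjI allI bounded_linear_sub ra(2) rb(2))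
        (simp add: inner_diff_left inner_diff_right ra(3) rb(3))
    show "?D (\<i> *\<^sub>C x) = \<i> *\<^sub>C ?D x" for x
      by (simp add: op_abs_scaleC[OF A] op_abs_scaleC[OF B] ii_diff)
  qed
  have Ccomp: "compact_op ?C" and Csum: "summable (singular_number ?C)"
    using C by (auto simp: trace_class_def)
  define \<tau> where "\<tau> = trace_norm ?C"
  obtain e s where sys: "singular_system ?C e s"
    using compact_selfadjoint_singular_system[OF Csa Ccomp inf] by blast
  have sC: "singular_number ?C = s" by (rule singular_number_eq[OF Csa sys])
  have ssum: "summable s" and \<tau>: "\<tau> = suminf s"
    using Csum by (simp_all add: sC \<tau>_def trace_norm_def)
  have "0 \<le> \<tau>" unfolding \<tau> by (rule suminf_nonneg[OF ssum singular_systemD(3)[OF sys]])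
  then show "0 \<le> trace_norm ?C" by (simp add: \<tau>_def)
  obtain u v where u: "(\<lambda>n. (norm (u n))\<^sup>2) sums (2 * suminf s)"
    and v: "(\<lambda>n. (norm (v n))\<^sup>2) sums (2 * suminf s)"
    and uv: "\<And>x y. (\<lambda>n. inner x (u n) * inner (v n) y) sums inner x (?C y)"
    by (rule compact_selfadjoint_real_nuclear[OF Csa sys ssum]) (rule that)
  have total: "8 * ((\<Sum>n. (norm (u n))\<^sup>2) + (\<Sum>n. (norm (v n))\<^sup>2)) = 32 * \<tau>"
    using sums_unique[OF u] sums_unique[OF v] by (simp add: \<tau>)
  have est: "\<exists>F. finite F \<and> t * real (card F) \<le> 32 * \<tau>
      \<and> (\<forall>y. (\<forall>f\<in>F. inner f y = 0) \<longrightarrow> norm (?D y) \<le> (t + \<eta>) * norm y)"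
    if t: "0 < t" "0 < \<eta>" for t \<eta>
  proof (rule abs_diff_weak_estimate[OF selfadjointD(2)[OF A] selfadjointD(2)[OF B]
        nA op_abs_selfadjoint(2)[OF A] nB op_abs_selfadjoint(2)[OF B]
        sums_summable[OF u] sums_summable[OF v] uv t])
    fix F
    assume "finite F" "t * real (card F) \<le> 8 * ((\<Sum>n. (norm (u n))\<^sup>2) + (\<Sum>n. (norm (v n))\<^sup>2))"
      "\<And>y. (\<And>f. f \<in> F \<Longrightarrow> inner f y = 0) \<Longrightarrow> norm (?D y) \<le> (t + \<eta>) * norm y"
    then show ?thesis unfolding total by blast
  qed
  show Dcomp: "compact_op ?D"
  proof (rule compact_op_of_small_finite_codimension)
    show "bounded_clinear ?D" by (rule selfadjointD(1)[OF Dsa])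
    fix t :: real assume "0 < t"
    then show "\<exists>F. finite F \<and> (\<forall>y. (\<forall>f\<in>F. inner f y = 0) \<longrightarrow> norm (?D y) \<le> t * norm y)"
      using est[of "t / 2" "t / 2"] by auto
  qed
  obtain d r where Dsys: "singular_system ?D d r"
    using compact_selfadjoint_singular_system[OF Dsa Dcomp inf] by blast
  have rD: "singular_number ?D = r" by (rule singular_number_eq[OF Dsa Dsys])
  have "r k \<le> 32 * \<tau> / real (k + 1)"
  proof (rule field_le_epsilon)
    fix \<eta> :: real assume "0 < \<eta>"
    \<comment> \<open>Any \<open>t\<close> above \<open>32 * \<tau> / (k + 1)\<close> forces fewer than \<open>k + 1\<close> exceptional directions.\<close>
    define t where "t = 32 * \<tau> / real (k + 1) + \<eta> / 2"
    have t: "0 < t" using \<open>0 < \<eta>\<close> \<open>0 \<le> \<tau>\<close> by (simp add: t_def add_nonneg_pos)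
    obtain F where F: "finite F" "t * real (card F) \<le> 32 * \<tau>"
      "\<And>y. (\<forall>f\<in>F. inner f y = 0) \<Longrightarrow> norm (?D y) \<le> (t + \<eta> / 2) * norm y"
      using est[OF t, of "\<eta> / 2"] \<open>0 < \<eta>\<close> by auto
    have "32 * \<tau> < t * real (k + 1)"
      using \<open>0 < \<eta>\<close> by (simp add: t_def distrib_right add_pos_nonneg)
    with F(2) have "t * real (card F) < t * real (k + 1)" by linarith
    then have "card F \<le> k" using t by simp
    then have "r k \<le> t + \<eta> / 2"
      by (rule eigenvalue_le_of_small_finite_codimension[OF Dsa Dsys F(1)]) (use F(3) in blast)
    then show "r k \<le> 32 * \<tau> / real (k + 1) + \<eta>" by (simp add: t_def)
  qed
  then show "real (k + 1) * singular_number ?D k \<le> 32 * trace_norm ?C"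
    unfolding rD \<tau>_def[symmetric] by (simp add: field_simps)
qed

theorem theorem1p2:
  fixes A B :: "'a::complex_hilbert \<Rightarrow> 'a"
  assumes "separable (UNIV :: 'a set)"
    and "\<nexists>F :: 'a set. finite F \<and> cspan F = UNIV"
    and "selfadjoint A" and "selfadjoint B"
    and "trace_class (\<lambda>x. A x - B x)"
  shows "weak_trace_class (\<lambda>x. op_abs A x - op_abs B x) \<and>
    weak_trace_norm (\<lambda>x. op_abs A x - op_abs B x)
      \<le> (34 + 2560 * exp 1 / pi) * trace_norm (\<lambda>x. A x - B x)"
proof -
  note bound = abs_difference_weak_trace_bound[OF assms(2-5)]
  have "weak_trace_norm (\<lambda>x. op_abs A x - op_abs B x) \<le> 32 * trace_norm (\<lambda>x. A x - B x)"
    unfolding weak_trace_norm_def by (rule cSUP_least) (use bound(2) in auto)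
  also have "\<dots> \<le> (34 + 2560 * exp 1 / pi) * trace_norm (\<lambda>x. A x - B x)"
    using bound(3) by (intro mult_right_mono) (auto intro: add_increasing2)
  finally have "weak_trace_norm (\<lambda>x. op_abs A x - op_abs B x)
      \<le> (34 + 2560 * exp 1 / pi) * trace_norm (\<lambda>x. A x - B x)" .
  moreover have "weak_trace_class (\<lambda>x. op_abs A x - op_abs B x)"
    unfolding weak_trace_class_def using bound(1,2) by (auto intro!: bdd_aboveI)
  ultimately show ?thesis by blast
qed

end
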